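(* Let $R$ be an algebra over $\mathbb{C}$, $\mathcal{B}$ a right $\times_R$-Hopf algebra, $T$ a right $\mathcal{B}$-comodule algebra, $S=T^{\mathcal{B}}$, $\mathcal{K}$ a left $\times_S$-Hopf algebra, $T$ a left $\mathcal{K}$-module algebra, and $M$ a right-left stable anti Yetter-Drinfeld (SAYD) module over $\mathcal{K}$. If $T$ is a $\mathcal{K}$-equivariant $\mathcal{B}$-Galois extension of $S$, then $\widetilde M:=M\otimes_{\mathcal{K}}T$ is a left-right SAYD module over $\mathcal{B}$ by the action $$b\triangleright(m\otimes_{\mathcal{K}}t)=m_{\langle 0\rangle}\otimes_{\mathcal{K}}b_{\langle +\rangle}\big(m_{\langle -1\rangle}\triangleright(t\,b_{\langle -\rangle})\big)$$ and the coaction $$m\otimes_{\mathcal{K}}t\longmapsto m\otimes_{\mathcal{K}}t_{\langle 0\rangle}\otimes_Rt_{\langle 1\rangle}.$$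
   Context: All algebras are unital associative over $\mathbb{C}$. Sweedler notation is used for coproducts ($\Delta(k)=k^{(1)}\otimes k^{(2)}$) and coactions ($m\mapsto m_{\langle -1\rangle}\otimes m_{\langle 0\rangle}$ or $m\mapsto m_{\langle 0\rangle}\otimes m_{\langle 1\rangle}$). **Left bialgebroids and left $\times_S$-Hopf algebras.** Let $S$ be an algebra. A left $S$-bialgebroid is an algebra $\mathcal{K}$ with algebra maps $\mathfrak{s}:S\to\mathcal{K}$, $\mathfrak{t}:S^{op}\to\mathcal{K}$ with commuting ranges, which is an $S$-coring $(\Delta,\varepsilon)$ for the bimodule structure $r_1kr_2=\mathfrak{s}(r_1)\mathfrak{t}(r_2)k$, such that $k^{(1)}\mathfrak{t}(r)\otimes_S k^{(2)}=k^{(1)}\otimes_S k^{(2)}\mathfrak{s}(r)$; $\Delta(1)=1\otimes_S1$, $\Delta(kk')=k^{(1)}k'^{(1)}\otimes_S k^{(2)}k'^{(2)}$; $\varepsilon(1)=1$, $\varepsilon(kk')=\varepsilon(k\,\mathfrak{s}(\varepsilon(k')))$. It is a left $\times_S$-Hopf algebra if $\nu:\mathcal{K}\otimes_{S^{op}}\mathcal{K}\to\mathcal{K}\otimes_S\mathcal{K}$, $k\otimes k'\mapsto k^{(1)}\otimes_S k^{(2)}k'$ is bijective (domain: $k\mathfrak{t}(r)\otimes k'=k\otimes\mathfrak{t}(r)k'$). Write $k^-\otimes_{S^{op}}k^+:=\nu^{-1}(k\otimes_S1)$. **Right bialgebroids and right $\times_R$-Hopf algebras.** A right $R$-bialgebroid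 is an algebra $\mathcal{B}$ with an algebra map $\mathfrak{s}:R\to\mathcal{B}$ and an anti-algebra map $\mathfrak{t}:R\to\mathcal{B}$ with commuting ranges, which is an $R$-coring for the bimodule structure $r b r'=b\,\mathfrak{s}(r')\mathfrak{t}(r)$, such that $b^{(1)}\otimes_R\mathfrak{t}(r)b^{(2)}=\mathfrak{s}(r)b^{(1)}\otimes_Rb^{(2)}$; $\Delta(1)=1\otimes_R1$, $\Delta(bb')=b^{(1)}b'^{(1)}\otimes_Rb^{(2)}b'^{(2)}$; $\varepsilon(1)=1$, $\varepsilon(bb')=\varepsilon(\mathfrak{s}(\varepsilon(b))b')$. It is a right $\times_R$-Hopf algebra if $\nu:\mathcal{B}\otimes_{R^{op}}\mathcal{B}\to\mathcal{B}\otimes_R\mathcal{B}$, $b\otimes b'\mapsto bb'^{(1)}\otimes_Rb'^{(2)}$ is bijective (domain: $b\mathfrak{t}(r)\otimes b'=b\otimes\mathfrak{t}(r)b'$). Write $b^-\otimes_{R^{op}}b^+:=\nu^{-1}(1\otimes_Rb)$. **Comodules.** A left $\mathcal{K}$-comodule is a left $S$-module $M$ with a left $S$-linear coassociative counital coaction $M\to\mathcal{K}\otimes_SM$; it has a canonical right $S$-action $mr=\varepsilon(m_{\langle -1\rangle}\mathfrak{s}(r))m_{\langle 0\rangle}$. A right $\mathcal{B}$-comodule is a right $R$-module $M$ with a right $R$-linear coassociative counital coaction $M\to M\otimes_R\mathcal{B}$; it has a canonical left $R$-action $rm=m_{\langle 0\rangle}\varepsilon(\mathfrak{s}(r)m_{\langle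 1\rangle})$. **SAYD modules.** A right-left SAYD module over $\mathcal{K}$ is a right $\mathcal{K}$-module and left $\mathcal{K}$-comodule $M$ such that (i) $mr=m\triangleleft\mathfrak{s}(r)$ and $rm=m\triangleleft\mathfrak{t}(r)$, where the left sides are the comodule $S$-actions; (ii) $(m\triangleleft k)_{\langle -1\rangle}\otimes_S(m\triangleleft k)_{\langle 0\rangle}={k^{(2)}}^+m_{\langle -1\rangle}k^{(1)}\otimes_Sm_{\langle 0\rangle}\triangleleft{k^{(2)}}^-$; (iii) $m_{\langle 0\rangle}\triangleleft m_{\langle -1\rangle}=m$. A left-right SAYD module over $\mathcal{B}$ is a left $\mathcal{B}$-module and right $\mathcal{B}$-comodule $M$ such that (i) $mr=\mathfrak{t}(r)\triangleright m$ and $rm=\mathfrak{s}(r)\triangleright m$, where the left sides are the comodule $R$-actions; (ii) $(b\triangleright m)_{\langle 0\rangle}\otimes_R(b\triangleright m)_{\langle 1\rangle}={b^{(1)}}^+\triangleright m_{\langle 0\rangle}\otimes_Rb^{(2)}m_{\langle 1\rangle}{b^{(1)}}^-$; (iii) $m_{\langle 1\rangle}\triangleright m_{\langle 0\rangle}=m$. **Module algebras.** A left $\mathcal{K}$-module algebra is an algebra $T$ that is a left $\mathcal{K}$-module with $k\triangleright1=\mathfrak{s}(\varepsilon(k))\triangleright1$, $k\triangleright(tt')=(k^{(1)}\triangleright t)(k^{(2)}\triangleright t')$, $(\mathfrak{t}(r)\triangleright t)t'=t(\mathfrak{s}(r)\triangleright t')$. It is an $S$-bimodule by $rt=\mathfrak{s}(r)\triangleright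 t$, $tr=\mathfrak{t}(r)\triangleright t$. **Comodule algebras.** A right $\mathcal{B}$-comodule algebra is an algebra $T$ that is an $R$-bimodule and a right $\mathcal{B}$-comodule with $(tr)t'=t(rt')$, $1\mapsto1\otimes_R1$, and $(tt')_{\langle 0\rangle}\otimes_R(tt')_{\langle 1\rangle}=t_{\langle 0\rangle}t'_{\langle 0\rangle}\otimes_Rt_{\langle 1\rangle}t'_{\langle 1\rangle}$. Its coinvariants are $T^{\mathcal{B}}=\{s\in T: s_{\langle 0\rangle}\otimes_Rs_{\langle 1\rangle}=s\otimes_R1\}$. **Equivariant Galois extension.** Let $T$ be a right $\mathcal{B}$-comodule algebra, $S=T^{\mathcal{B}}$, $\mathcal{K}$ a left $\times_S$-Hopf algebra, and $T$ a left $\mathcal{K}$-module algebra. $T$ is a $\mathcal{K}$-equivariant $\mathcal{B}$-Galois extension of $S$ if $can:T\otimes_ST\to T\otimes_R\mathcal{B}$, $t'\otimes_St\mapsto t't_{\langle 0\rangle}\otimes_Rt_{\langle 1\rangle}$ is bijective and the right coaction of $\mathcal{B}$ on $T$ is $\mathcal{K}$-equivariant, i.e. $(k\triangleright t)_{\langle 0\rangle}\otimes_R(k\triangleright t)_{\langle 1\rangle}=k\triangleright t_{\langle 0\rangle}\otimes_Rt_{\langle 1\rangle}$ for all $k\in\mathcal{K},t\in T$. Write $b_{\langle -\rangle}\otimes_Sb_{\langle +\rangle}:=can^{-1}(1\otimes_Rb)$. *)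

theory Defs
  imports Complex_Main "HOL-Algebra.Module"
begin

section \<open>Complex algebras and their one-sided modules\<close>

definition complex_ring :: "complex ring" where
  "complex_ring = \<lparr>carrier = UNIV, mult = (*), one = 1, zero = 0, add = (+)\<rparr>"

text \<open>
  Complex vector spaces are modules over \<^const>\<open>complex_ring\<close>. The locale
  \<^locale>\<open>algebra\<close> of the library is commutative, so the noncommutative notion is introduced
  here. The zero algebra is admitted.
\<close>

locale calgebra = ring A + module complex_ring A
  for A :: "(complex, 'a, 'x) module_scheme" (structure) +
  assumes smult_mult_left:
      "\<lbrakk>x \<in> carrier A; y \<in> carrier A\<rbrakk> \<Longrightarrow> (c \<odot> x) \<otimes> y = c \<odot> (x \<otimes> y)"
    and smult_mult_right:
      "\<lbrakk>x \<in> carrier A; y \<in> carrier A\<rbrakk> \<Longrightarrow> x \<otimes> (c \<odot> y) = c \<odot> (x \<otimes> y)"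

definition clinear_map ::
  "(complex, 'v, 'x) module_scheme \<Rightarrow> (complex, 'w, 'y) module_scheme \<Rightarrow> ('v \<Rightarrow> 'w) \<Rightarrow> bool" where
  "clinear_map V W f \<longleftrightarrow>
     f \<in> carrier V \<rightarrow> carrier W \<and>
     (\<forall>x\<in>carrier V. \<forall>y\<in>carrier V. f (x \<oplus>\<^bsub>V\<^esub> y) = f x \<oplus>\<^bsub>W\<^esub> f y) \<and>
     (\<forall>c. \<forall>x\<in>carrier V. f (c \<odot>\<^bsub>V\<^esub> x) = c \<odot>\<^bsub>W\<^esub> f x)"

definition calgebra_hom ::
  "(complex, 'a, 'x) module_scheme \<Rightarrow> (complex, 'b, 'y) module_scheme \<Rightarrow> ('a \<Rightarrow> 'b) \<Rightarrow> bool" where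
  "calgebra_hom A B f \<longleftrightarrow> f \<in> ring_hom A B \<and> clinear_map A B f"

definition opp :: "(complex, 'a, 'x) module_scheme \<Rightarrow> (complex, 'a, 'x) module_scheme" where
  "opp A = A\<lparr>mult := \<lambda>x y. y \<otimes>\<^bsub>A\<^esub> x\<rparr>"

locale left_module = A: calgebra A + M: module complex_ring M
  for A :: "(complex, 'a, 'x) module_scheme" and M :: "(complex, 'm, 'y) module_scheme"
    and act :: "'a \<Rightarrow> 'm \<Rightarrow> 'm" +
  assumes act_linear_left: "m \<in> carrier M \<Longrightarrow> clinear_map A M (\<lambda>a. act a m)"
    and act_linear_right: "a \<in> carrier A \<Longrightarrow> clinear_map M M (act a)"
    and act_mult: "\<lbrakk>a \<in> carrier A; b \<in> carrier A; m \<in> carrier M\<rbrakk> \<Longrightarrow>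
      act (a \<otimes>\<^bsub>A\<^esub> b) m = act a (act b m)"
    and act_one: "m \<in> carrier M \<Longrightarrow> act \<one>\<^bsub>A\<^esub> m = m"

locale right_module = A: calgebra A + M: module complex_ring M
  for A :: "(complex, 'a, 'x) module_scheme" and M :: "(complex, 'm, 'y) module_scheme"
    and act :: "'m \<Rightarrow> 'a \<Rightarrow> 'm" +
  assumes act_linear_right: "m \<in> carrier M \<Longrightarrow> clinear_map A M (act m)"
    and act_linear_left: "a \<in> carrier A \<Longrightarrow> clinear_map M M (\<lambda>m. act m a)"
    and act_mult: "\<lbrakk>a \<in> carrier A; b \<in> carrier A; m \<in> carrier M\<rbrakk> \<Longrightarrow>
      act m (a \<otimes>\<^bsub>A\<^esub> b) = act (act m a) b"
    and act_one: "m \<in> carrier M \<Longrightarrow> act m \<one>\<^bsub>A\<^esub> = m"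

locale bimodule = left: left_module A M lact + right: right_module A M ract
  for A :: "(complex, 'a, 'x) module_scheme" and M :: "(complex, 'm, 'y) module_scheme"
    and lact :: "'a \<Rightarrow> 'm \<Rightarrow> 'm" and ract :: "'m \<Rightarrow> 'a \<Rightarrow> 'm" +
  assumes actions_commute: "\<lbrakk>a \<in> carrier A; b \<in> carrier A; m \<in> carrier M\<rbrakk> \<Longrightarrow>
      ract (lact a m) b = lact a (ract m b)"


section \<open>Tensor products over a noncommutative algebra\<close>

text \<open>
  The tensor product of a right \<open>A\<close>-module \<open>M\<close> (action \<open>r\<close>) and a left \<open>A\<close>-module \<open>N\<close>
  (action \<open>l\<close>) is presented by generators and relations: a finite list of pairs
  \<open>[(m1, n1), \<dots>, (mk, nk)]\<close> stands for the sum of the \<open>mi \<otimes> ni\<close>, and an element of the tensor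
  product is the class of all lists that stand for it. The congruence makes the lists a
  commutative monoid and imposes biadditivity and \<open>A\<close>-balancing; the quotient is a group, since
  \<open>[(m, n), (- m, n)]\<close> is congruent to \<open>[(0, n)]\<close> and hence to \<open>[]\<close>. Complex scalars act on the
  left factor (equivalently on the right one, as multiples of the unit of \<open>A\<close> are balanced).
\<close>

inductive tensor_cong ::
  "(complex, 'a, 'x) module_scheme \<Rightarrow> (complex, 'm, 'y) module_scheme \<Rightarrow> ('m \<Rightarrow> 'a \<Rightarrow> 'm) \<Rightarrow>
   (complex, 'n, 'z) module_scheme \<Rightarrow> ('a \<Rightarrow> 'n \<Rightarrow> 'n) \<Rightarrow>
   ('m \<times> 'n) list \<Rightarrow> ('m \<times> 'n) list \<Rightarrow> bool"
  for A M r N l where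
  tc_refl: "xs \<in> lists (carrier M \<times> carrier N) \<Longrightarrow> tensor_cong A M r N l xs xs"
| tc_sym: "tensor_cong A M r N l xs ys \<Longrightarrow> tensor_cong A M r N l ys xs"
| tc_trans: "\<lbrakk>tensor_cong A M r N l xs ys; tensor_cong A M r N l ys zs\<rbrakk> \<Longrightarrow>
    tensor_cong A M r N l xs zs"
| tc_append: "\<lbrakk>tensor_cong A M r N l xs xs'; tensor_cong A M r N l ys ys'\<rbrakk> \<Longrightarrow>
    tensor_cong A M r N l (xs @ ys) (xs' @ ys')"
| tc_commute: "\<lbrakk>xs \<in> lists (carrier M \<times> carrier N); ys \<in> lists (carrier M \<times> carrier N)\<rbrakk> \<Longrightarrow>
    tensor_cong A M r N l (xs @ ys) (ys @ xs)"
| tc_zero: "n \<in> carrier N \<Longrightarrow> tensor_cong A M r N l [(\<zero>\<^bsub>M\<^esub>, n)] []"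
| tc_add_left: "\<lbrakk>m \<in> carrier M; m' \<in> carrier M; n \<in> carrier N\<rbrakk> \<Longrightarrow>
    tensor_cong A M r N l [(m \<oplus>\<^bsub>M\<^esub> m', n)] [(m, n), (m', n)]"
| tc_add_right: "\<lbrakk>m \<in> carrier M; n \<in> carrier N; n' \<in> carrier N\<rbrakk> \<Longrightarrow>
    tensor_cong A M r N l [(m, n \<oplus>\<^bsub>N\<^esub> n')] [(m, n), (m, n')]"
| tc_balance: "\<lbrakk>m \<in> carrier M; a \<in> carrier A; n \<in> carrier N\<rbrakk> \<Longrightarrow>
    tensor_cong A M r N l [(r m a, n)] [(m, l a n)]"

text \<open>
  The fields \<^const>\<open>mult\<close> and \<^const>\<open>one\<close> of the record are not used for modules.
\<close>

definition tensor ::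
  "(complex, 'a, 'x) module_scheme \<Rightarrow> (complex, 'm, 'y) module_scheme \<Rightarrow> ('m \<Rightarrow> 'a \<Rightarrow> 'm) \<Rightarrow>
   (complex, 'n, 'z) module_scheme \<Rightarrow> ('a \<Rightarrow> 'n \<Rightarrow> 'n) \<Rightarrow> (complex, ('m \<times> 'n) list set) module" where
  "tensor A M r N l =
    (let cl = (\<lambda>xs. {ys. tensor_cong A M r N l xs ys}) in
     \<lparr>carrier = lists (carrier M \<times> carrier N) // {(xs, ys). tensor_cong A M r N l xs ys},
      mult = undefined, one = undefined,
      zero = cl [],
      add = (\<lambda>X Y. \<Union>xs\<in>X. \<Union>ys\<in>Y. cl (xs @ ys)),
      smult = (\<lambda>c X. \<Union>xs\<in>X. cl (map (\<lambda>(m, n). (c \<odot>\<^bsub>M\<^esub> m, n)) xs))\<rparr>)"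

text \<open>
  \<open>m \<boxtimes>\<^bsub>P\<^esub> n\<close> is the pure tensor in the tensor product \<open>P\<close>, i.e. the class in \<open>P\<close> containing the
  list \<open>[(m, n)]\<close>.
\<close>

definition pure_tensor ::
  "(complex, ('m \<times> 'n) list set, 'x) module_scheme \<Rightarrow> 'm \<Rightarrow> 'n \<Rightarrow> ('m \<times> 'n) list set"
  (infixl \<open>\<boxtimes>\<index>\<close> 70) where
  "m \<boxtimes>\<^bsub>P\<^esub> n = (THE X. X \<in> carrier P \<and> [(m, n)] \<in> X)"

text \<open>
  \<open>sum_over W xs f\<close> is the sum of the \<open>f m n\<close> over the entries \<open>(m, n)\<close> of \<open>xs\<close>, taken in \<open>W\<close>.
  \<open>sweedler W X (\<lambda>m n. f m n)\<close> renders an expression in Sweedler notation: it is \<open>sum_over W xs f\<close>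
  for a representative \<open>xs\<close> of \<open>X\<close>, that is, the value at \<open>X\<close> of the additive map sending
  \<open>m \<otimes> n\<close> to \<open>f m n\<close>. It is used where the preceding axioms make the value independent of the
  representative; elsewhere all representatives are quantified over explicitly.
\<close>

definition sum_over :: "('w, 'x) ring_scheme \<Rightarrow> ('m \<times> 'n) list \<Rightarrow> ('m \<Rightarrow> 'n \<Rightarrow> 'w) \<Rightarrow> 'w" where
  "sum_over W xs f = foldr (\<lambda>(m, n) w. f m n \<oplus>\<^bsub>W\<^esub> w) xs \<zero>\<^bsub>W\<^esub>"

definition sweedler :: "('w, 'x) ring_scheme \<Rightarrow> ('m \<times> 'n) list set \<Rightarrow> ('m \<Rightarrow> 'n \<Rightarrow> 'w) \<Rightarrow> 'w" where
  "sweedler W X f = sum_over W (SOME xs. xs \<in> X) f"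

text \<open>Balanced biadditive maps do factor through the tensor product.\<close>

lemma (in abelian_group) sum_over_closed:
  assumes "xs \<in> lists (C \<times> D)" "\<And>m n. \<lbrakk>m \<in> C; n \<in> D\<rbrakk> \<Longrightarrow> f m n \<in> carrier G"
  shows "sum_over G xs f \<in> carrier G"
  using assms(1) by (induction xs) (auto simp: sum_over_def assms(2))

lemma (in abelian_group) sum_over_append:
  assumes "xs \<in> lists (C \<times> D)" "ys \<in> lists (C \<times> D)"
    and "\<And>m n. \<lbrakk>m \<in> C; n \<in> D\<rbrakk> \<Longrightarrow> f m n \<in> carrier G"
  shows "sum_over G (xs @ ys) f = sum_over G xs f \<oplus> sum_over G ys f"
  using assms(1)
proof (induction xs)
  case Nil
  then show ?case using sum_over_closed[of _ C D f, OF assms(2,3)] by (simp add: sum_over_def)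
next
  case (Cons p xs)
  then obtain m n where p: "p = (m, n)" "m \<in> C" "n \<in> D" by auto
  have "sum_over G xs f \<in> carrier G" "sum_over G ys f \<in> carrier G"
    using sum_over_closed[of _ C D f, OF _ assms(3)] Cons.hyps assms(2) by auto
  then show ?case using Cons p assms(3)[of m n] by (simp add: sum_over_def a_assoc)
qed

lemma (in abelian_group) sum_over_tensor_cong:
  assumes f: "\<And>m n. \<lbrakk>m \<in> carrier M; n \<in> carrier N\<rbrakk> \<Longrightarrow> f m n \<in> carrier G"
    and zero: "\<And>n. n \<in> carrier N \<Longrightarrow> f \<zero>\<^bsub>M\<^esub> n = \<zero>"
    and addl: "\<And>m m' n. \<lbrakk>m \<in> carrier M; m' \<in> carrier M; n \<in> carrier N\<rbrakk> \<Longrightarrow>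
      f (m \<oplus>\<^bsub>M\<^esub> m') n = f m n \<oplus> f m' n"
    and addr: "\<And>m n n'. \<lbrakk>m \<in> carrier M; n \<in> carrier N; n' \<in> carrier N\<rbrakk> \<Longrightarrow>
      f m (n \<oplus>\<^bsub>N\<^esub> n') = f m n \<oplus> f m n'"
    and bal: "\<And>m a n. \<lbrakk>m \<in> carrier M; a \<in> carrier A; n \<in> carrier N\<rbrakk> \<Longrightarrow>
      f (r m a) n = f m (l a n)"
    and M: "\<And>m m'. \<lbrakk>m \<in> carrier M; m' \<in> carrier M\<rbrakk> \<Longrightarrow> m \<oplus>\<^bsub>M\<^esub> m' \<in> carrier M" "\<zero>\<^bsub>M\<^esub> \<in> carrier M"
    and N: "\<And>n n'. \<lbrakk>n \<in> carrier N; n' \<in> carrier N\<rbrakk> \<Longrightarrow> n \<oplus>\<^bsub>N\<^esub> n' \<in> carrier N"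
    and r: "\<And>m a. \<lbrakk>m \<in> carrier M; a \<in> carrier A\<rbrakk> \<Longrightarrow> r m a \<in> carrier M"
    and l: "\<And>a n. \<lbrakk>a \<in> carrier A; n \<in> carrier N\<rbrakk> \<Longrightarrow> l a n \<in> carrier N"
    and cong: "tensor_cong A M r N l xs ys"
  shows "xs \<in> lists (carrier M \<times> carrier N) \<and> ys \<in> lists (carrier M \<times> carrier N) \<and>
    sum_over G xs f = sum_over G ys f"
  using cong
proof (induction rule: tensor_cong.induct)
  case (tc_append xs xs' ys ys')
  then show ?case using sum_over_append[of _ "carrier M" "carrier N" _ f, OF _ _ f] by auto
next
  case (tc_commute xs ys)
  then show ?case
    using sum_over_append[of _ "carrier M" "carrier N" _ f, OF _ _ f]
      sum_over_closed[of _ "carrier M" "carrier N" f, OF _ f] a_comm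
    by auto
next
  case (tc_zero n)
  then show ?case using M f zero by (auto simp: sum_over_def)
next
  case (tc_add_left m m' n)
  then show ?case using M f addl by (auto simp: sum_over_def)
next
  case (tc_add_right m n n')
  then show ?case using N f addr by (auto simp: sum_over_def)
next
  case (tc_balance m a n)
  then show ?case using r l f bal by (auto simp: sum_over_def)
qed auto


section \<open>Left bialgebroids, comodules and SAYD modules\<close>

text \<open>
  A bialgebroid is represented by its total algebra, extended by source, target, coproduct and
  counit; the base algebra is a separate argument. The same record serves left and right
  bialgebroids.
\<close>

record ('s, 'k) bialgebroid = "(complex, 'k) module" +
  source :: "'s \<Rightarrow> 'k"
  target :: "'s \<Rightarrow> 'k"
  comult :: "'k \<Rightarrow> ('k \<times> 'k) list set"
  counit :: "'k \<Rightarrow> 's"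

text \<open>
  \<open>ltensor S K M l\<close> is \<open>\<K> \<otimes>\<^sub>S M\<close> for a left \<open>S\<close>-module \<open>M\<close> with action \<open>l\<close>, where
  \<open>\<t>(r)k \<otimes> m = k \<otimes> rm\<close>; \<open>ltensor2 S K M l\<close> is \<open>(\<K> \<otimes>\<^sub>S \<K>) \<otimes>\<^sub>S M\<close>.
\<close>

definition ltensor ::
  "(complex, 's, 'x) module_scheme \<Rightarrow> ('s, 'k, 'y) bialgebroid_scheme \<Rightarrow>
   (complex, 'm, 'z) module_scheme \<Rightarrow> ('s \<Rightarrow> 'm \<Rightarrow> 'm) \<Rightarrow> (complex, ('k \<times> 'm) list set) module" where
  "ltensor S K M l = tensor S K (\<lambda>k r. target K r \<otimes>\<^bsub>K\<^esub> k) M l"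

abbreviation ltensor_self ::
  "(complex, 's, 'x) module_scheme \<Rightarrow> ('s, 'k, 'y) bialgebroid_scheme \<Rightarrow>
   (complex, ('k \<times> 'k) list set) module" where
  "ltensor_self S K \<equiv> ltensor S K K (\<lambda>r k. source K r \<otimes>\<^bsub>K\<^esub> k)"

definition ltensor2 ::
  "(complex, 's, 'x) module_scheme \<Rightarrow> ('s, 'k, 'y) bialgebroid_scheme \<Rightarrow>
   (complex, 'm, 'z) module_scheme \<Rightarrow> ('s \<Rightarrow> 'm \<Rightarrow> 'm) \<Rightarrow>
   (complex, (('k \<times> 'k) list set \<times> 'm) list set) module" where
  "ltensor2 S K M l =
    (let KK = ltensor_self S K in
     tensor S KK (\<lambda>X r. sweedler KK X (\<lambda>a b. a \<boxtimes>\<^bsub>KK\<^esub> (target K r \<otimes>\<^bsub>K\<^esub> b))) M l)"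

text \<open>
  Both sides of the coassociativity law live in \<open>(\<K> \<otimes>\<^sub>S \<K>) \<otimes>\<^sub>S M\<close>. For \<open>M = \<K>\<close> with the action
  through the source map and \<open>\<rho> = \<Delta>\<close> this is the coassociativity of the coring \<open>\<K>\<close>.
\<close>

definition left_coassociative ::
  "(complex, 's, 'x) module_scheme \<Rightarrow> ('s, 'k, 'y) bialgebroid_scheme \<Rightarrow>
   (complex, 'm, 'z) module_scheme \<Rightarrow> ('s \<Rightarrow> 'm \<Rightarrow> 'm) \<Rightarrow> ('m \<Rightarrow> ('k \<times> 'm) list set) \<Rightarrow> bool" where
  "left_coassociative S K M l \<rho> \<longleftrightarrow>
    (let KK = ltensor_self S K; Q = ltensor2 S K M l in
     \<forall>m\<in>carrier M.
       sweedler Q (\<rho> m) (\<lambda>k n. comult K k \<boxtimes>\<^bsub>Q\<^esub> n) =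
       sweedler Q (\<rho> m) (\<lambda>k n. sweedler Q (\<rho> n) (\<lambda>k' n'. (k \<boxtimes>\<^bsub>KK\<^esub> k') \<boxtimes>\<^bsub>Q\<^esub> n')))"

locale left_bialgebroid = S: calgebra S + K: calgebra K
  for S :: "(complex, 's, 'x) module_scheme" and K :: "('s, 'k, 'y) bialgebroid_scheme" +
  assumes source_hom: "calgebra_hom S K (source K)"
    and target_hom: "calgebra_hom (opp S) K (target K)"
    and ranges_commute: "\<lbrakk>r \<in> carrier S; r' \<in> carrier S\<rbrakk> \<Longrightarrow>
      source K r \<otimes>\<^bsub>K\<^esub> target K r' = target K r' \<otimes>\<^bsub>K\<^esub> source K r"
    \<comment> \<open>coring axioms\<close>
    and comult_linear: "clinear_map K (ltensor_self S K) (comult K)"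
    and comult_bilinear: "\<lbrakk>r \<in> carrier S; r' \<in> carrier S; k \<in> carrier K\<rbrakk> \<Longrightarrow>
      comult K (source K r \<otimes>\<^bsub>K\<^esub> target K r' \<otimes>\<^bsub>K\<^esub> k) =
      sweedler (ltensor_self S K) (comult K k)
        (\<lambda>a b. (source K r \<otimes>\<^bsub>K\<^esub> a) \<boxtimes>\<^bsub>ltensor_self S K\<^esub> (target K r' \<otimes>\<^bsub>K\<^esub> b))"
    and counit_linear: "clinear_map K S (counit K)"
    and counit_bilinear: "\<lbrakk>r \<in> carrier S; r' \<in> carrier S; k \<in> carrier K\<rbrakk> \<Longrightarrow>
      counit K (source K r \<otimes>\<^bsub>K\<^esub> target K r' \<otimes>\<^bsub>K\<^esub> k) = r \<otimes>\<^bsub>S\<^esub> counit K k \<otimes>\<^bsub>S\<^esub> r'"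
    and coassociative:
      "left_coassociative S K K (\<lambda>r k. source K r \<otimes>\<^bsub>K\<^esub> k) (comult K)"
    and counit_left: "k \<in> carrier K \<Longrightarrow>
      sweedler K (comult K k) (\<lambda>a b. source K (counit K a) \<otimes>\<^bsub>K\<^esub> b) = k"
    and counit_right: "k \<in> carrier K \<Longrightarrow>
      sweedler K (comult K k) (\<lambda>a b. target K (counit K b) \<otimes>\<^bsub>K\<^esub> a) = k"
    \<comment> \<open>compatibility of the ring and coring structures\<close>
    and comult_takeuchi: "\<lbrakk>r \<in> carrier S; k \<in> carrier K\<rbrakk> \<Longrightarrow>
      sweedler (ltensor_self S K) (comult K k)
        (\<lambda>a b. (a \<otimes>\<^bsub>K\<^esub> target K r) \<boxtimes>\<^bsub>ltensor_self S K\<^esub> b) =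
      sweedler (ltensor_self S K) (comult K k)
        (\<lambda>a b. a \<boxtimes>\<^bsub>ltensor_self S K\<^esub> (b \<otimes>\<^bsub>K\<^esub> source K r))"
    and comult_one: "comult K \<one>\<^bsub>K\<^esub> = \<one>\<^bsub>K\<^esub> \<boxtimes>\<^bsub>ltensor_self S K\<^esub> \<one>\<^bsub>K\<^esub>"
    and comult_mult: "\<lbrakk>k \<in> carrier K; k' \<in> carrier K\<rbrakk> \<Longrightarrow>
      comult K (k \<otimes>\<^bsub>K\<^esub> k') =
      sweedler (ltensor_self S K) (comult K k) (\<lambda>a b.
        sweedler (ltensor_self S K) (comult K k') (\<lambda>a' b'.
          (a \<otimes>\<^bsub>K\<^esub> a') \<boxtimes>\<^bsub>ltensor_self S K\<^esub> (b \<otimes>\<^bsub>K\<^esub> b')))"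
    and counit_one: "counit K \<one>\<^bsub>K\<^esub> = \<one>\<^bsub>S\<^esub>"
    and counit_mult: "\<lbrakk>k \<in> carrier K; k' \<in> carrier K\<rbrakk> \<Longrightarrow>
      counit K (k \<otimes>\<^bsub>K\<^esub> k') = counit K (k \<otimes>\<^bsub>K\<^esub> source K (counit K k'))"

definition left_hopf_domain ::
  "(complex, 's, 'x) module_scheme \<Rightarrow> ('s, 'k, 'y) bialgebroid_scheme \<Rightarrow>
   (complex, ('k \<times> 'k) list set) module" where
  "left_hopf_domain S K =
    tensor (opp S) K (\<lambda>k r. k \<otimes>\<^bsub>K\<^esub> target K r) K (\<lambda>r k. target K r \<otimes>\<^bsub>K\<^esub> k)"

definition left_hopf_map ::
  "(complex, 's, 'x) module_scheme \<Rightarrow> ('s, 'k, 'y) bialgebroid_scheme \<Rightarrow>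
   ('k \<times> 'k) list set \<Rightarrow> ('k \<times> 'k) list set" where
  "left_hopf_map S K X =
    (let KK = ltensor_self S K in
     sweedler KK X (\<lambda>k k'. sweedler KK (comult K k) (\<lambda>a b. a \<boxtimes>\<^bsub>KK\<^esub> (b \<otimes>\<^bsub>K\<^esub> k'))))"

locale left_times_hopf = left_bialgebroid S K
  for S :: "(complex, 's, 'x) module_scheme" and K :: "('s, 'k, 'y) bialgebroid_scheme" +
  assumes hopf_bij:
    "bij_betw (left_hopf_map S K) (carrier (left_hopf_domain S K)) (carrier (ltensor_self S K))"

text \<open>The element \<open>k\<^sup>- \<otimes> k\<^sup>+ = \<nu>\<^sup>-\<^sup>1(k \<otimes>\<^sub>S 1)\<close>.\<close>

definition left_translation ::
  "(complex, 's, 'x) module_scheme \<Rightarrow> ('s, 'k, 'y) bialgebroid_scheme \<Rightarrow>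
   'k \<Rightarrow> ('k \<times> 'k) list set" where
  "left_translation S K k =
    inv_into (carrier (left_hopf_domain S K)) (left_hopf_map S K)
      (k \<boxtimes>\<^bsub>ltensor_self S K\<^esub> \<one>\<^bsub>K\<^esub>)"

locale left_comodule = M: left_module S M l
  for S :: "(complex, 's, 'x) module_scheme" and K :: "('s, 'k, 'y) bialgebroid_scheme"
    and M :: "(complex, 'm, 'z) module_scheme" and l :: "'s \<Rightarrow> 'm \<Rightarrow> 'm"
    and \<rho> :: "'m \<Rightarrow> ('k \<times> 'm) list set" +
  assumes coact_linear: "clinear_map M (ltensor S K M l) \<rho>"
    and coact_left_linear: "\<lbrakk>r \<in> carrier S; m \<in> carrier M\<rbrakk> \<Longrightarrow>
      \<rho> (l r m) =
      sweedler (ltensor S K M l) (\<rho> m) (\<lambda>k n. (source K r \<otimes>\<^bsub>K\<^esub> k) \<boxtimes>\<^bsub>ltensor S K M l\<^esub> n)"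
    and coact_coassociative: "left_coassociative S K M l \<rho>"
    and coact_counital: "m \<in> carrier M \<Longrightarrow> sweedler M (\<rho> m) (\<lambda>k n. l (counit K k) n) = m"

definition left_comodule_right_action ::
  "('s, 'k, 'y) bialgebroid_scheme \<Rightarrow> (complex, 'm, 'z) module_scheme \<Rightarrow> ('s \<Rightarrow> 'm \<Rightarrow> 'm) \<Rightarrow>
   ('m \<Rightarrow> ('k \<times> 'm) list set) \<Rightarrow> 'm \<Rightarrow> 's \<Rightarrow> 'm" where
  "left_comodule_right_action K M l \<rho> m r =
    sweedler M (\<rho> m) (\<lambda>k n. l (counit K (k \<otimes>\<^bsub>K\<^esub> source K r)) n)"

locale right_left_SAYD = mod: right_module K M act + comod: left_comodule S K M l \<rho>
  for S :: "(complex, 's, 'x) module_scheme" and K :: "('s, 'k, 'y) bialgebroid_scheme"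
    and M :: "(complex, 'm, 'z) module_scheme" and l :: "'s \<Rightarrow> 'm \<Rightarrow> 'm"
    and act :: "'m \<Rightarrow> 'k \<Rightarrow> 'm" and \<rho> :: "'m \<Rightarrow> ('k \<times> 'm) list set" +
  assumes right_action: "\<lbrakk>r \<in> carrier S; m \<in> carrier M\<rbrakk> \<Longrightarrow>
      left_comodule_right_action K M l \<rho> m r = act m (source K r)"
    and left_action: "\<lbrakk>r \<in> carrier S; m \<in> carrier M\<rbrakk> \<Longrightarrow> l r m = act m (target K r)"
    and anti_yetter_drinfeld: "\<lbrakk>k \<in> carrier K; m \<in> carrier M\<rbrakk> \<Longrightarrow>
      \<rho> (act m k) =
      sweedler (ltensor S K M l) (comult K k) (\<lambda>k1 k2.
        sweedler (ltensor S K M l) (left_translation S K k2) (\<lambda>kminus kplus.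
          sweedler (ltensor S K M l) (\<rho> m) (\<lambda>h n.
            (kplus \<otimes>\<^bsub>K\<^esub> h \<otimes>\<^bsub>K\<^esub> k1) \<boxtimes>\<^bsub>ltensor S K M l\<^esub> act n kminus)))"
    and stable: "m \<in> carrier M \<Longrightarrow> sweedler M (\<rho> m) (\<lambda>h n. act n h) = m"


section \<open>Right bialgebroids, comodules and SAYD modules\<close>

text \<open>
  \<open>rtensor R B M r\<close> is \<open>M \<otimes>\<^sub>R \<B>\<close> for a right \<open>R\<close>-module \<open>M\<close> with action \<open>r\<close>, where
  \<open>mx \<otimes> b = m \<otimes> b\<t>(x)\<close>; \<open>rtensor2 R B M r\<close> is \<open>(M \<otimes>\<^sub>R \<B>) \<otimes>\<^sub>R \<B>\<close>, with \<open>R\<close> acting on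
  \<open>M \<otimes>\<^sub>R \<B>\<close> by \<open>(m \<otimes> b)x = m \<otimes> b\<s>(x)\<close>.
\<close>

definition rtensor ::
  "(complex, 'r, 'x) module_scheme \<Rightarrow> ('r, 'b, 'y) bialgebroid_scheme \<Rightarrow>
   (complex, 'm, 'z) module_scheme \<Rightarrow> ('m \<Rightarrow> 'r \<Rightarrow> 'm) \<Rightarrow> (complex, ('m \<times> 'b) list set) module" where
  "rtensor R B M r = tensor R M r B (\<lambda>x b. b \<otimes>\<^bsub>B\<^esub> target B x)"

abbreviation rtensor_self ::
  "(complex, 'r, 'x) module_scheme \<Rightarrow> ('r, 'b, 'y) bialgebroid_scheme \<Rightarrow>
   (complex, ('b \<times> 'b) list set) module" where
  "rtensor_self R B \<equiv> rtensor R B B (\<lambda>b x. b \<otimes>\<^bsub>B\<^esub> source B x)"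

definition rtensor2 ::
  "(complex, 'r, 'x) module_scheme \<Rightarrow> ('r, 'b, 'y) bialgebroid_scheme \<Rightarrow>
   (complex, 'm, 'z) module_scheme \<Rightarrow> ('m \<Rightarrow> 'r \<Rightarrow> 'm) \<Rightarrow>
   (complex, (('m \<times> 'b) list set \<times> 'b) list set) module" where
  "rtensor2 R B M r =
    (let MB = rtensor R B M r in
     rtensor R B MB (\<lambda>X x. sweedler MB X (\<lambda>m b. m \<boxtimes>\<^bsub>MB\<^esub> (b \<otimes>\<^bsub>B\<^esub> source B x))))"

definition right_coassociative ::
  "(complex, 'r, 'x) module_scheme \<Rightarrow> ('r, 'b, 'y) bialgebroid_scheme \<Rightarrow>
   (complex, 'm, 'z) module_scheme \<Rightarrow> ('m \<Rightarrow> 'r \<Rightarrow> 'm) \<Rightarrow> ('m \<Rightarrow> ('m \<times> 'b) list set) \<Rightarrow> bool" where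
  "right_coassociative R B M r \<rho> \<longleftrightarrow>
    (let MB = rtensor R B M r; Q = rtensor2 R B M r in
     \<forall>m\<in>carrier M.
       sweedler Q (\<rho> m) (\<lambda>n b. \<rho> n \<boxtimes>\<^bsub>Q\<^esub> b) =
       sweedler Q (\<rho> m) (\<lambda>n b. sweedler Q (comult B b) (\<lambda>b1 b2. (n \<boxtimes>\<^bsub>MB\<^esub> b1) \<boxtimes>\<^bsub>Q\<^esub> b2)))"

locale right_bialgebroid = R: calgebra R + B: calgebra B
  for R :: "(complex, 'r, 'x) module_scheme" and B :: "('r, 'b, 'y) bialgebroid_scheme" +
  assumes source_hom: "calgebra_hom R B (source B)"
    and target_hom: "calgebra_hom (opp R) B (target B)"
    and ranges_commute: "\<lbrakk>x \<in> carrier R; x' \<in> carrier R\<rbrakk> \<Longrightarrow>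
      source B x \<otimes>\<^bsub>B\<^esub> target B x' = target B x' \<otimes>\<^bsub>B\<^esub> source B x"
    \<comment> \<open>coring axioms\<close>
    and comult_linear: "clinear_map B (rtensor_self R B) (comult B)"
    and comult_bilinear: "\<lbrakk>x \<in> carrier R; x' \<in> carrier R; b \<in> carrier B\<rbrakk> \<Longrightarrow>
      comult B (b \<otimes>\<^bsub>B\<^esub> source B x' \<otimes>\<^bsub>B\<^esub> target B x) =
      sweedler (rtensor_self R B) (comult B b)
        (\<lambda>a c. (a \<otimes>\<^bsub>B\<^esub> target B x) \<boxtimes>\<^bsub>rtensor_self R B\<^esub> (c \<otimes>\<^bsub>B\<^esub> source B x'))"
    and counit_linear: "clinear_map B R (counit B)"
    and counit_bilinear: "\<lbrakk>x \<in> carrier R; x' \<in> carrier R; b \<in> carrier B\<rbrakk> \<Longrightarrow>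
      counit B (b \<otimes>\<^bsub>B\<^esub> source B x' \<otimes>\<^bsub>B\<^esub> target B x) = x \<otimes>\<^bsub>R\<^esub> counit B b \<otimes>\<^bsub>R\<^esub> x'"
    and coassociative:
      "right_coassociative R B B (\<lambda>b x. b \<otimes>\<^bsub>B\<^esub> source B x) (comult B)"
    and counit_left: "b \<in> carrier B \<Longrightarrow>
      sweedler B (comult B b) (\<lambda>a c. c \<otimes>\<^bsub>B\<^esub> target B (counit B a)) = b"
    and counit_right: "b \<in> carrier B \<Longrightarrow>
      sweedler B (comult B b) (\<lambda>a c. a \<otimes>\<^bsub>B\<^esub> source B (counit B c)) = b"
    \<comment> \<open>compatibility of the ring and coring structures\<close>
    and comult_takeuchi: "\<lbrakk>x \<in> carrier R; b \<in> carrier B\<rbrakk> \<Longrightarrow>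
      sweedler (rtensor_self R B) (comult B b)
        (\<lambda>a c. a \<boxtimes>\<^bsub>rtensor_self R B\<^esub> (target B x \<otimes>\<^bsub>B\<^esub> c)) =
      sweedler (rtensor_self R B) (comult B b)
        (\<lambda>a c. (source B x \<otimes>\<^bsub>B\<^esub> a) \<boxtimes>\<^bsub>rtensor_self R B\<^esub> c)"
    and comult_one: "comult B \<one>\<^bsub>B\<^esub> = \<one>\<^bsub>B\<^esub> \<boxtimes>\<^bsub>rtensor_self R B\<^esub> \<one>\<^bsub>B\<^esub>"
    and comult_mult: "\<lbrakk>b \<in> carrier B; b' \<in> carrier B\<rbrakk> \<Longrightarrow>
      comult B (b \<otimes>\<^bsub>B\<^esub> b') =
      sweedler (rtensor_self R B) (comult B b) (\<lambda>a c.
        sweedler (rtensor_self R B) (comult B b') (\<lambda>a' c'.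
          (a \<otimes>\<^bsub>B\<^esub> a') \<boxtimes>\<^bsub>rtensor_self R B\<^esub> (c \<otimes>\<^bsub>B\<^esub> c')))"
    and counit_one: "counit B \<one>\<^bsub>B\<^esub> = \<one>\<^bsub>R\<^esub>"
    and counit_mult: "\<lbrakk>b \<in> carrier B; b' \<in> carrier B\<rbrakk> \<Longrightarrow>
      counit B (b \<otimes>\<^bsub>B\<^esub> b') = counit B (source B (counit B b) \<otimes>\<^bsub>B\<^esub> b')"

definition right_hopf_domain ::
  "(complex, 'r, 'x) module_scheme \<Rightarrow> ('r, 'b, 'y) bialgebroid_scheme \<Rightarrow>
   (complex, ('b \<times> 'b) list set) module" where
  "right_hopf_domain R B =
    tensor (opp R) B (\<lambda>b x. b \<otimes>\<^bsub>B\<^esub> target B x) B (\<lambda>x b. target B x \<otimes>\<^bsub>B\<^esub> b)"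

definition right_hopf_map ::
  "(complex, 'r, 'x) module_scheme \<Rightarrow> ('r, 'b, 'y) bialgebroid_scheme \<Rightarrow>
   ('b \<times> 'b) list set \<Rightarrow> ('b \<times> 'b) list set" where
  "right_hopf_map R B X =
    (let BB = rtensor_self R B in
     sweedler BB X (\<lambda>b b'. sweedler BB (comult B b') (\<lambda>a c. (b \<otimes>\<^bsub>B\<^esub> a) \<boxtimes>\<^bsub>BB\<^esub> c)))"

locale right_times_hopf = right_bialgebroid R B
  for R :: "(complex, 'r, 'x) module_scheme" and B :: "('r, 'b, 'y) bialgebroid_scheme" +
  assumes hopf_bij:
    "bij_betw (right_hopf_map R B) (carrier (right_hopf_domain R B)) (carrier (rtensor_self R B))"

text \<open>The element \<open>b\<^sup>- \<otimes> b\<^sup>+ = \<nu>\<^sup>-\<^sup>1(1 \<otimes>\<^sub>R b)\<close>.\<close>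

definition right_translation ::
  "(complex, 'r, 'x) module_scheme \<Rightarrow> ('r, 'b, 'y) bialgebroid_scheme \<Rightarrow>
   'b \<Rightarrow> ('b \<times> 'b) list set" where
  "right_translation R B b =
    inv_into (carrier (right_hopf_domain R B)) (right_hopf_map R B)
      (\<one>\<^bsub>B\<^esub> \<boxtimes>\<^bsub>rtensor_self R B\<^esub> b)"

locale right_comodule = M: right_module R M r
  for R :: "(complex, 'r, 'x) module_scheme" and B :: "('r, 'b, 'y) bialgebroid_scheme"
    and M :: "(complex, 'm, 'z) module_scheme" and r :: "'m \<Rightarrow> 'r \<Rightarrow> 'm"
    and \<rho> :: "'m \<Rightarrow> ('m \<times> 'b) list set" +
  assumes coact_linear: "clinear_map M (rtensor R B M r) \<rho>"
    and coact_right_linear: "\<lbrakk>x \<in> carrier R; m \<in> carrier M\<rbrakk> \<Longrightarrow>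
      \<rho> (r m x) =
      sweedler (rtensor R B M r) (\<rho> m) (\<lambda>n b. n \<boxtimes>\<^bsub>rtensor R B M r\<^esub> (b \<otimes>\<^bsub>B\<^esub> source B x))"
    and coact_coassociative: "right_coassociative R B M r \<rho>"
    and coact_counital: "m \<in> carrier M \<Longrightarrow> sweedler M (\<rho> m) (\<lambda>n b. r n (counit B b)) = m"

definition right_comodule_left_action ::
  "('r, 'b, 'y) bialgebroid_scheme \<Rightarrow> (complex, 'm, 'z) module_scheme \<Rightarrow> ('m \<Rightarrow> 'r \<Rightarrow> 'm) \<Rightarrow>
   ('m \<Rightarrow> ('m \<times> 'b) list set) \<Rightarrow> 'r \<Rightarrow> 'm \<Rightarrow> 'm" where
  "right_comodule_left_action B M r \<rho> x m =
    sweedler M (\<rho> m) (\<lambda>n b. r n (counit B (source B x \<otimes>\<^bsub>B\<^esub> b)))"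

locale left_right_SAYD = mod: left_module B M act + comod: right_comodule R B M r \<rho>
  for R :: "(complex, 'r, 'x) module_scheme" and B :: "('r, 'b, 'y) bialgebroid_scheme"
    and M :: "(complex, 'm, 'z) module_scheme" and r :: "'m \<Rightarrow> 'r \<Rightarrow> 'm"
    and act :: "'b \<Rightarrow> 'm \<Rightarrow> 'm" and \<rho> :: "'m \<Rightarrow> ('m \<times> 'b) list set" +
  assumes right_action: "\<lbrakk>x \<in> carrier R; m \<in> carrier M\<rbrakk> \<Longrightarrow> r m x = act (target B x) m"
    and left_action: "\<lbrakk>x \<in> carrier R; m \<in> carrier M\<rbrakk> \<Longrightarrow>
      right_comodule_left_action B M r \<rho> x m = act (source B x) m"
    and anti_yetter_drinfeld: "\<lbrakk>b \<in> carrier B; m \<in> carrier M\<rbrakk> \<Longrightarrow>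
      \<rho> (act b m) =
      sweedler (rtensor R B M r) (comult B b) (\<lambda>b1 b2.
        sweedler (rtensor R B M r) (right_translation R B b1) (\<lambda>bminus bplus.
          sweedler (rtensor R B M r) (\<rho> m) (\<lambda>n c.
            act bplus n \<boxtimes>\<^bsub>rtensor R B M r\<^esub> (b2 \<otimes>\<^bsub>B\<^esub> c \<otimes>\<^bsub>B\<^esub> bminus))))"
    and stable: "m \<in> carrier M \<Longrightarrow> sweedler M (\<rho> m) (\<lambda>n c. act c n) = m"


section \<open>Module algebras, comodule algebras and equivariant Galois extensions\<close>

locale module_algebra = T: calgebra T + mod: left_module K T act
  for S :: "(complex, 's, 'x) module_scheme" and K :: "('s, 'k, 'y) bialgebroid_scheme"
    and T :: "(complex, 't, 'z) module_scheme" and act :: "'k \<Rightarrow> 't \<Rightarrow> 't" +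
  assumes act_unit: "k \<in> carrier K \<Longrightarrow> act k \<one>\<^bsub>T\<^esub> = act (source K (counit K k)) \<one>\<^bsub>T\<^esub>"
    and act_target_source: "\<lbrakk>x \<in> carrier S; t \<in> carrier T; t' \<in> carrier T\<rbrakk> \<Longrightarrow>
      act (target K x) t \<otimes>\<^bsub>T\<^esub> t' = t \<otimes>\<^bsub>T\<^esub> act (source K x) t'"
    and act_product: "\<lbrakk>k \<in> carrier K; t \<in> carrier T; t' \<in> carrier T\<rbrakk> \<Longrightarrow>
      act k (t \<otimes>\<^bsub>T\<^esub> t') = sweedler T (comult K k) (\<lambda>k1 k2. act k1 t \<otimes>\<^bsub>T\<^esub> act k2 t')"

text \<open>
  In the multiplicativity of the coaction, the right-hand side is well defined only through an
  interplay of the \<open>R\<close>-bimodule structure with the coaction. The axiom is therefore stated for all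
  representatives \<open>xs\<close>, \<open>ys\<close>, which expresses that it is well defined; it forces the left
  \<open>R\<close>-action \<open>l\<close> to be the canonical one of the comodule.
\<close>

locale comodule_algebra = T: calgebra T + bimod: bimodule R T l r + comod: right_comodule R B T r \<rho>
  for R :: "(complex, 'r, 'x) module_scheme" and B :: "('r, 'b, 'y) bialgebroid_scheme"
    and T :: "(complex, 't, 'z) module_scheme" and l :: "'r \<Rightarrow> 't \<Rightarrow> 't" and r :: "'t \<Rightarrow> 'r \<Rightarrow> 't"
    and \<rho> :: "'t \<Rightarrow> ('t \<times> 'b) list set" +
  assumes balanced: "\<lbrakk>x \<in> carrier R; t \<in> carrier T; t' \<in> carrier T\<rbrakk> \<Longrightarrow>
      r t x \<otimes>\<^bsub>T\<^esub> t' = t \<otimes>\<^bsub>T\<^esub> l x t'"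
    and coact_one: "\<rho> \<one>\<^bsub>T\<^esub> = \<one>\<^bsub>T\<^esub> \<boxtimes>\<^bsub>rtensor R B T r\<^esub> \<one>\<^bsub>B\<^esub>"
    and coact_mult: "\<lbrakk>t \<in> carrier T; t' \<in> carrier T; xs \<in> \<rho> t; ys \<in> \<rho> t'\<rbrakk> \<Longrightarrow>
      \<rho> (t \<otimes>\<^bsub>T\<^esub> t') =
      sum_over (rtensor R B T r) xs (\<lambda>t0 t1. sum_over (rtensor R B T r) ys (\<lambda>u0 u1.
        (t0 \<otimes>\<^bsub>T\<^esub> u0) \<boxtimes>\<^bsub>rtensor R B T r\<^esub> (t1 \<otimes>\<^bsub>B\<^esub> u1)))"

definition coinvariants ::
  "(complex, 'r, 'x) module_scheme \<Rightarrow> ('r, 'b, 'y) bialgebroid_scheme \<Rightarrow>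
   (complex, 't, 'z) module_scheme \<Rightarrow> ('t \<Rightarrow> 'r \<Rightarrow> 't) \<Rightarrow> ('t \<Rightarrow> ('t \<times> 'b) list set) \<Rightarrow>
   (complex, 't, 'z) module_scheme" where
  "coinvariants R B T r \<rho> =
    T\<lparr>carrier := {s \<in> carrier T. \<rho> s = s \<boxtimes>\<^bsub>rtensor R B T r\<^esub> \<one>\<^bsub>B\<^esub>}\<rparr>"

text \<open>
  In \<open>T \<otimes>\<^sub>S T\<close>, \<open>T\<close> carries the \<open>S\<close>-bimodule structure of a \<open>\<K>\<close>-module algebra,
  \<open>xt = \<s>(x) \<triangleright> t\<close> and \<open>tx = \<t>(x) \<triangleright> t\<close>. If this agrees with multiplication in \<open>T\<close> by elements of
  the subalgebra \<open>S\<close>, it is the tensor product for the ring extension \<open>S \<subseteq> T\<close>.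
\<close>

definition galois_domain ::
  "(complex, 's, 'x) module_scheme \<Rightarrow> ('s, 'k, 'y) bialgebroid_scheme \<Rightarrow>
   (complex, 't, 'z) module_scheme \<Rightarrow> ('k \<Rightarrow> 't \<Rightarrow> 't) \<Rightarrow>
   (complex, ('t \<times> 't) list set) module" where
  "galois_domain S K T act = tensor S T (\<lambda>t x. act (target K x) t) T (\<lambda>x t. act (source K x) t)"

definition galois_map ::
  "(complex, 'r, 'x) module_scheme \<Rightarrow> ('r, 'b, 'y) bialgebroid_scheme \<Rightarrow>
   (complex, 't, 'z) module_scheme \<Rightarrow> ('t \<Rightarrow> 'r \<Rightarrow> 't) \<Rightarrow> ('t \<Rightarrow> ('t \<times> 'b) list set) \<Rightarrow>
   ('t \<times> 't) list set \<Rightarrow> ('t \<times> 'b) list set" where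
  "galois_map R B T r \<rho> X =
    (let TB = rtensor R B T r in
     sweedler TB X (\<lambda>t' t. sweedler TB (\<rho> t) (\<lambda>t0 t1. (t' \<otimes>\<^bsub>T\<^esub> t0) \<boxtimes>\<^bsub>TB\<^esub> t1)))"

text \<open>
  Equivariance of the coaction is again required for all representatives, as its right-hand side is
  well defined only if \<open>\<K>\<close> acts by right \<open>R\<close>-linear maps.
\<close>

locale equivariant_galois =
    B: right_times_hopf R B + comodalg: comodule_algebra R B T l r \<rho> +
    K: left_times_hopf S K + modalg: module_algebra S K T act
  for R :: "(complex, 'r, 'x) module_scheme" and B :: "('r, 'b, 'y) bialgebroid_scheme"
    and S :: "(complex, 't, 'z) module_scheme" and K :: "('t, 'k, 'v) bialgebroid_scheme"
    and T :: "(complex, 't, 'z) module_scheme" and l :: "'r \<Rightarrow> 't \<Rightarrow> 't" and r :: "'t \<Rightarrow> 'r \<Rightarrow> 't"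
    and \<rho> :: "'t \<Rightarrow> ('t \<times> 'b) list set" and act :: "'k \<Rightarrow> 't \<Rightarrow> 't" +
  assumes base: "S = coinvariants R B T r \<rho>"
    and galois_bij:
      "bij_betw (galois_map R B T r \<rho>) (carrier (galois_domain S K T act))
        (carrier (rtensor R B T r))"
    and equivariant: "\<lbrakk>k \<in> carrier K; t \<in> carrier T; xs \<in> \<rho> t\<rbrakk> \<Longrightarrow>
      \<rho> (act k t) =
      sum_over (rtensor R B T r) xs (\<lambda>t0 t1. act k t0 \<boxtimes>\<^bsub>rtensor R B T r\<^esub> t1)"

text \<open>The element \<open>b\<^sub>- \<otimes> b\<^sub>+ = can\<^sup>-\<^sup>1(1 \<otimes>\<^sub>R b)\<close> of \<open>T \<otimes>\<^sub>S T\<close>.\<close>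

definition galois_translation ::
  "(complex, 'r, 'x) module_scheme \<Rightarrow> ('r, 'b, 'y) bialgebroid_scheme \<Rightarrow>
   (complex, 't, 'z) module_scheme \<Rightarrow> ('t, 'k, 'v) bialgebroid_scheme \<Rightarrow>
   (complex, 't, 'z) module_scheme \<Rightarrow> ('t \<Rightarrow> 'r \<Rightarrow> 't) \<Rightarrow> ('t \<Rightarrow> ('t \<times> 'b) list set) \<Rightarrow>
   ('k \<Rightarrow> 't \<Rightarrow> 't) \<Rightarrow> 'b \<Rightarrow> ('t \<times> 't) list set" where
  "galois_translation R B S K T r \<rho> act b =
    inv_into (carrier (galois_domain S K T act)) (galois_map R B T r \<rho>)
      (\<one>\<^bsub>T\<^esub> \<boxtimes>\<^bsub>rtensor R B T r\<^esub> b)"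


section \<open>The induced module and its structure maps\<close>

text \<open>
  \<open>\<M> = M \<otimes>\<^sub>\<K> T\<close> with its right \<open>R\<close>-action \<open>(m \<otimes> t)x = m \<otimes> tx\<close>, the coaction
  \<open>m \<otimes> t \<mapsto> m \<otimes> t\<^sub>0 \<otimes> t\<^sub>1\<close> into \<open>\<M> \<otimes>\<^sub>R \<B>\<close>, and the action
  \<open>b \<triangleright> (m \<otimes> t) = m\<^sub>0 \<otimes> b\<^sub>+ (m\<^sub>-\<^sub>1 \<triangleright> (t b\<^sub>-))\<close>. They are evaluated
  at a representative of the argument; their formulas on pure tensors, for arbitrary
  representatives, are therefore assertions and not definitions.
\<close>

definition induced ::
  "('t, 'k, 'v) bialgebroid_scheme \<Rightarrow> (complex, 'm, 'w) module_scheme \<Rightarrow> ('m \<Rightarrow> 'k \<Rightarrow> 'm) \<Rightarrow>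
   (complex, 't, 'z) module_scheme \<Rightarrow> ('k \<Rightarrow> 't \<Rightarrow> 't) \<Rightarrow>
   (complex, ('m \<times> 't) list set) module" where
  "induced K M actM T actT = tensor K M actM T actT"

definition induced_ract ::
  "(complex, ('m \<times> 't) list set) module \<Rightarrow> ('t \<Rightarrow> 'r \<Rightarrow> 't) \<Rightarrow>
   ('m \<times> 't) list set \<Rightarrow> 'r \<Rightarrow> ('m \<times> 't) list set" where
  "induced_ract Mt rT X x = sweedler Mt X (\<lambda>m t. m \<boxtimes>\<^bsub>Mt\<^esub> rT t x)"

definition induced_coact ::
  "(complex, 'r, 'x) module_scheme \<Rightarrow> ('r, 'b, 'y) bialgebroid_scheme \<Rightarrow>
   (complex, ('m \<times> 't) list set) module \<Rightarrow> ('t \<Rightarrow> 'r \<Rightarrow> 't) \<Rightarrow> ('t \<Rightarrow> ('t \<times> 'b) list set) \<Rightarrow>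
   ('m \<times> 't) list set \<Rightarrow> (('m \<times> 't) list set \<times> 'b) list set" where
  "induced_coact R B Mt rT \<rho>T X =
    (let P = rtensor R B Mt (induced_ract Mt rT) in
     sweedler P X (\<lambda>m t. sweedler P (\<rho>T t) (\<lambda>t0 t1. (m \<boxtimes>\<^bsub>Mt\<^esub> t0) \<boxtimes>\<^bsub>P\<^esub> t1)))"

definition induced_act ::
  "(complex, ('m \<times> 't) list set) module \<Rightarrow> (complex, 't, 'z) module_scheme \<Rightarrow>
   ('k \<Rightarrow> 't \<Rightarrow> 't) \<Rightarrow> ('m \<Rightarrow> ('k \<times> 'm) list set) \<Rightarrow> ('b \<Rightarrow> ('t \<times> 't) list set) \<Rightarrow>
   'b \<Rightarrow> ('m \<times> 't) list set \<Rightarrow> ('m \<times> 't) list set" where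
  "induced_act Mt T actT \<rho>M \<tau> b X =
    sweedler Mt X (\<lambda>m t. sweedler Mt (\<rho>M m) (\<lambda>k n. sweedler Mt (\<tau> b) (\<lambda>bminus bplus.
      n \<boxtimes>\<^bsub>Mt\<^esub> (bplus \<otimes>\<^bsub>T\<^esub> actT k (t \<otimes>\<^bsub>T\<^esub> bminus)))))"

end

(*
  Every identity is tested on additive functionals. A complex vector space has enough additive
  functionals to separate its points (Zorn), and a functional on a tensor product is the same as a
  balanced biadditive map. An expression in Sweedler notation thereby becomes an iterated finite sum of
  complex numbers over chosen representatives; such sums may be interchanged freely, and only the
  use of a structural identity requires some map to be balanced.

  The mathematics lies in the translation map b |-> b_- (x) b_+. Injectivity of can gives its
  multiplicativity, its compatibility with the coaction on either factor, and its invariance under K,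
      h1 b_- (x) h2 b_+ = s(eps h) b_- (x) b_+.
  Together with the anti Yetter-Drinfeld condition for M, invariance shows that the action is well
  defined over K. For associativity, stability of M is used backwards to insert two further
  factors of the coaction of m, which invariance then absorbs. The anti Yetter-Drinfeld condition
  for the induced module is the compatibility of the translation map with the coactions, and
  its stability comes from t_0 t_1- (x) t_1+ = 1 (x) t.
*)
theory Submission
  imports Defs
begin

section \<open>Additive functionals on complex vector spaces\<close>

text \<open>Every identity for a translation map rests on one device. A candidate for the inverse
  image is built as an actual element of the tensor product. Two such elements agree as soon as
  functionals of the form \<open>can F\<close>, pulled back along the injective Hopf or Galois map,
  agree on them. The equality of elements then serves for every balanced \<open>G\<close>, whether
  or not it is visibly a pullback.

  The obstacle is that \<open>T\<close> carries fewer axioms than the computation uses. Neither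
  \<open>(t u) x = t (u x)\<close>, nor the Takeuchi property of the coaction, nor the R-linearity
  of the action of K is an axiom. They are hidden in the requirement that multiplicativity and
  equivariance of the coaction hold for all representatives. To extract them, the formula is
  evaluated at an unusual representative, typically one padded with entries that cancel in the
  tensor product: their images must cancel as well.

  Most side conditions say that a map is balanced between two slots, and the scalar that has to
  cross usually crosses by the Takeuchi property of a third element.\<close>

lemma complex_ring_simps [simp]:
  "carrier complex_ring = UNIV" "c \<otimes>\<^bsub>complex_ring\<^esub> d = c * d" "c \<oplus>\<^bsub>complex_ring\<^esub> d = c + d"
  "\<one>\<^bsub>complex_ring\<^esub> = 1" "\<zero>\<^bsub>complex_ring\<^esub> = 0"
  by (simp_all add: complex_ring_def)

locale complex_space = module complex_ring V for V :: "(complex, 'v, 'x) module_scheme" (structure)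
begin

lemma scale_closed [simp, intro]: "x \<in> carrier V \<Longrightarrow> c \<odot> x \<in> carrier V"
  by simp

lemma scale_add_left: "x \<in> carrier V \<Longrightarrow> (c + d) \<odot> x = c \<odot> x \<oplus> d \<odot> x"
  using smult_l_distr[of c d x] by simp

lemma scale_scale: "x \<in> carrier V \<Longrightarrow> c \<odot> (d \<odot> x) = (c * d) \<odot> x"
  using smult_assoc1[of c d x] by simp

lemma scale_add_right: "x \<in> carrier V \<Longrightarrow> y \<in> carrier V \<Longrightarrow> c \<odot> (x \<oplus> y) = c \<odot> x \<oplus> c \<odot> y"
  using smult_r_distr[of c x y] by simp

lemma scale_one [simp]: "x \<in> carrier V \<Longrightarrow> 1 \<odot> x = x"
  using smult_one[of x] by simp

lemma scale_zero [simp]: "x \<in> carrier V \<Longrightarrow> 0 \<odot> x = \<zero>"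
  using smult_l_null[of x] by simp

lemma scale_minus_one: "x \<in> carrier V \<Longrightarrow> (-1) \<odot> x = \<ominus> x"
  using scale_add_left[of x "-1" 1] by (simp add: minus_equality)

end

text \<open>Additivity suffices because the relations of \<open>tensor_cong\<close> are biadditivity
  and balancing; complex scalars are reached through multiples of the unit of the base
  algebra.\<close>

definition additive_functional :: "('v, 'x) ring_scheme \<Rightarrow> ('v \<Rightarrow> complex) \<Rightarrow> bool" where
  "additive_functional V p \<longleftrightarrow> (\<forall>x\<in>carrier V. \<forall>y\<in>carrier V. p (x \<oplus>\<^bsub>V\<^esub> y) = p x + p y)"

lemma additive_functionalD:
  "\<lbrakk>additive_functional V p; x \<in> carrier V; y \<in> carrier V\<rbrakk> \<Longrightarrow> p (x \<oplus>\<^bsub>V\<^esub> y) = p x + p y"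
  by (simp add: additive_functional_def)

lemma (in abelian_group) additive_functional_zero:
  assumes "additive_functional G p" shows "p \<zero> = 0"
  using additive_functionalD[OF assms, of \<zero> \<zero>] by simp

lemma (in abelian_group) additive_functional_minus:
  assumes "additive_functional G p" "x \<in> carrier G" "y \<in> carrier G" shows "p (x \<ominus> y) = p x - p y"
proof -
  have "p (x \<ominus> y \<oplus> y) = p (x \<ominus> y) + p y"
    using assms by (intro additive_functionalD) auto
  moreover have "x \<ominus> y \<oplus> y = x"
    using assms by (simp add: a_minus_def a_assoc l_neg)
  ultimately show ?thesis by simp
qed

definition complex_subspace :: "(complex, 'v, 'x) module_scheme \<Rightarrow> 'v set \<Rightarrow> bool" where
  "complex_subspace V H \<longleftrightarrow> H \<subseteq> carrier V \<and> \<zero>\<^bsub>V\<^esub> \<in> H \<and> (\<forall>x\<in>H. \<forall>y\<in>H. x \<oplus>\<^bsub>V\<^esub> y \<in> H) \<and>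
     (\<forall>c. \<forall>x\<in>H. c \<odot>\<^bsub>V\<^esub> x \<in> H)"

context complex_space
begin

text \<open>Zorn's lemma, with the union of a chain as its upper bound. Maximality will force the
  subspace to be a complement of the line through \<open>x\<close>.\<close>

lemma maximal_subspace_avoiding:
  assumes "x \<in> carrier V" "x \<noteq> \<zero>"
  obtains H where "complex_subspace V H" "x \<notin> H"
    "\<And>H'. \<lbrakk>complex_subspace V H'; x \<notin> H'; H \<subseteq> H'\<rbrakk> \<Longrightarrow> H' = H"
proof -
  let ?A = "{H. complex_subspace V H \<and> x \<notin> H}"
  have "{\<zero>} \<in> ?A"
    using assms by (auto simp: complex_subspace_def smult_r_null)
  moreover have "\<Union>C \<in> ?A" if "C \<noteq> {}" "subset.chain ?A C" for C
  proof -
    have C: "\<And>H. H \<in> C \<Longrightarrow> complex_subspace V H \<and> x \<notin> H"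
      and lin: "\<And>H H'. H \<in> C \<Longrightarrow> H' \<in> C \<Longrightarrow> H \<subseteq> H' \<or> H' \<subseteq> H"
      using that(2) by (auto simp: subset_chain_def)
    have "y \<oplus> z \<in> \<Union>C" if yz: "y \<in> H" "z \<in> H'" "H \<in> C" "H' \<in> C" for y z H H'
      using lin[OF yz(3,4)] C[OF yz(3)] C[OF yz(4)] yz
      unfolding complex_subspace_def by (meson UnionI subsetD)
    moreover have "y \<in> carrier V \<and> c \<odot> y \<in> \<Union>C" if "y \<in> H" "H \<in> C" for c y H
      using C[OF that(2)] that unfolding complex_subspace_def by blast
    moreover obtain H0 where H0: "H0 \<in> C" using \<open>C \<noteq> {}\<close> by blast
    have "\<zero> \<in> H0" using C[OF H0] by (simp add: complex_subspace_def)
    ultimately have "complex_subspace V (\<Union>C)"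
      unfolding complex_subspace_def
    proof (intro conjI ballI allI subsetI)
      show "\<zero> \<in> \<Union>C" using \<open>\<zero> \<in> H0\<close> H0 by blast
    qed (elim UnionE, simp del: Union_iff)+
    then show ?thesis using C by auto
  qed
  ultimately have "\<exists>H\<in>?A. \<forall>X\<in>?A. H \<subseteq> X \<longrightarrow> X = H"
    by (intro subset_Zorn_nonempty) auto
  then show ?thesis using that by auto
qed

text \<open>A maximal \<open>H\<close> missing \<open>x\<close> has codimension one, and
  \<open>p\<close> is the coordinate along \<open>x\<close> modulo \<open>H\<close>.\<close>

lemma separating_functional:
  assumes x: "x \<in> carrier V" "x \<noteq> \<zero>"
  obtains p where "additive_functional V p" "p x \<noteq> 0"
proof -
  obtain H where H: "complex_subspace V H" "x \<notin> H"
    and max: "\<And>H'. \<lbrakk>complex_subspace V H'; x \<notin> H'; H \<subseteq> H'\<rbrakk> \<Longrightarrow> H' = H"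
    using maximal_subspace_avoiding[OF x] by metis
  have sub: "\<And>h. h \<in> H \<Longrightarrow> h \<in> carrier V" "\<zero> \<in> H" "\<And>h h'. h \<in> H \<Longrightarrow> h' \<in> H \<Longrightarrow> h \<oplus> h' \<in> H"
    "\<And>c h. h \<in> H \<Longrightarrow> c \<odot> h \<in> H"
    using H(1) by (auto simp: complex_subspace_def)
  have zero: "c = 0" if "c \<odot> x \<in> H" for c
  proof (rule ccontr)
    assume "c \<noteq> 0"
    then have "x = inverse c \<odot> (c \<odot> x)" using x by (simp add: scale_scale)
    then show False using sub(4)[OF that, of "inverse c"] H(2) by simp
  qed
  have decomp: "\<exists>c. \<exists>h\<in>H. y = h \<oplus> c \<odot> x" if y: "y \<in> carrier V" for y
  proof (cases "y \<in> H")
    case True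
    then show ?thesis using y x by (intro exI[of _ 0] bexI[of _ y]) auto
  next
    case False
    \<comment> \<open>By maximality the span of \<open>H\<close> and \<open>y\<close> contains
      \<open>x\<close>. The coefficient of \<open>y\<close> in that expression cannot vanish, so it
      can be solved for \<open>y\<close>.\<close>
    let ?H = "{h \<oplus> c \<odot> y | h c. h \<in> H}"
    have "complex_subspace V ?H"
      unfolding complex_subspace_def
    proof (intro conjI ballI allI)
      show "?H \<subseteq> carrier V" using sub y by auto
      show "\<zero> \<in> ?H" using sub(2) y by (auto intro!: exI[of _ \<zero>] exI[of _ 0])
    next
      fix u v assume "u \<in> ?H" "v \<in> ?H"
      then obtain h c h' c' where "u = h \<oplus> c \<odot> y" "v = h' \<oplus> c' \<odot> y" "h \<in> H" "h' \<in> H" by auto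
      then have "u \<oplus> v = (h \<oplus> h') \<oplus> (c + c') \<odot> y" "h \<oplus> h' \<in> H"
        using sub y by (auto simp: scale_add_left a_ac)
      then show "u \<oplus> v \<in> ?H" by blast
    next
      fix a u assume "u \<in> ?H"
      then obtain h c where "u = h \<oplus> c \<odot> y" "h \<in> H" by auto
      then have "a \<odot> u = (a \<odot> h) \<oplus> (a * c) \<odot> y" "a \<odot> h \<in> H"
        using sub y by (auto simp: scale_add_right scale_scale)
      then show "a \<odot> u \<in> ?H" by blast
    qed
    moreover have "H \<subseteq> ?H"
    proof
      fix h assume "h \<in> H"
      then show "h \<in> ?H" using sub y by (auto intro!: exI[of _ h] exI[of _ 0])
    qed
    moreover have "y \<in> ?H" using sub(2) y by (auto intro!: exI[of _ \<zero>] exI[of _ 1])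
    ultimately have "x \<in> ?H" using max False by blast
    then obtain h c where hc: "x = h \<oplus> c \<odot> y" "h \<in> H" by auto
    have "c \<noteq> 0" using hc H(2) y sub by auto
    have "y = (- inverse c) \<odot> h \<oplus> inverse c \<odot> x"
      unfolding hc(1) using y hc(2) sub \<open>c \<noteq> 0\<close>
      by (simp add: scale_add_right scale_scale a_assoc[symmetric] scale_add_left[symmetric])
    then show ?thesis using sub(4)[OF hc(2)] by blast
  qed
  have unique: "c = c'" if "h \<oplus> c \<odot> x = h' \<oplus> c' \<odot> x" "h \<in> H" "h' \<in> H" for c c' h h'
  proof -
    have "(-1) \<odot> h \<oplus> (h \<oplus> c \<odot> x) \<oplus> (- c') \<odot> x = (-1) \<odot> h \<oplus> (h' \<oplus> c' \<odot> x) \<oplus> (- c') \<odot> x"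
      using that(1) by simp
    moreover have "(-1) \<odot> h \<oplus> (h \<oplus> c \<odot> x) \<oplus> (- c') \<odot> x = (c - c') \<odot> x"
      using that(2) sub x scale_add_left[of x c "- c'"]
      by (simp add: a_assoc[symmetric] scale_minus_one l_neg)
    moreover have "(-1) \<odot> h \<oplus> (h' \<oplus> c' \<odot> x) \<oplus> (- c') \<odot> x = (-1) \<odot> h \<oplus> h'"
      using that sub x by (simp add: a_assoc scale_add_left[symmetric])
    ultimately have "(c - c') \<odot> x = (-1) \<odot> h \<oplus> h'" by simp
    then have "(c - c') \<odot> x \<in> H" using that sub by simp
    then show ?thesis using zero by force
  qed
  define p where "p y = (THE c. \<exists>h\<in>H. y = h \<oplus> c \<odot> x)" for y
  have p: "p (h \<oplus> c \<odot> x) = c" if "h \<in> H" for h c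
    unfolding p_def using that unique by (intro the_equality) blast+
  have "additive_functional V p"
    unfolding additive_functional_def
  proof (intro ballI)
    fix y z assume "y \<in> carrier V" "z \<in> carrier V"
    then obtain h c h' c' where yz: "y = h \<oplus> c \<odot> x" "z = h' \<oplus> c' \<odot> x" "h \<in> H" "h' \<in> H"
      using decomp by metis
    then have "y \<oplus> z = (h \<oplus> h') \<oplus> (c + c') \<odot> x"
      using sub x by (simp add: scale_add_left a_ac)
    then show "p (y \<oplus> z) = p y + p z" using yz p sub by simp
  qed
  moreover have "p x \<noteq> 0" using p[OF sub(2), of 1] x by simp
  ultimately show ?thesis using that by blast
qed

lemma functionals_separate:
  assumes "x \<in> carrier V" "y \<in> carrier V" "\<And>p. additive_functional V p \<Longrightarrow> p x = p y"
  shows "x = y"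
proof (rule ccontr)
  assume "x \<noteq> y"
  moreover have "x = (x \<ominus> y) \<oplus> y"
    using assms by (simp add: a_minus_def a_assoc l_neg)
  ultimately have "x \<ominus> y \<noteq> \<zero>" "x \<ominus> y \<in> carrier V" using assms by auto
  then obtain p where "additive_functional V p" "p (x \<ominus> y) \<noteq> 0"
    using separating_functional by metis
  then show False using assms additive_functional_minus[of p x y] by simp
qed

end

section \<open>Evaluating biadditive maps on tensors\<close>

definition list_total :: "('m \<times> 'n) list \<Rightarrow> ('m \<Rightarrow> 'n \<Rightarrow> complex) \<Rightarrow> complex" where
  "list_total xs F = (\<Sum>(m, n)\<leftarrow>xs. F m n)"

lemma list_total_simps [simp]:
  "list_total [] F = 0" "list_total ((m, n) # xs) F = F m n + list_total xs F"
  "list_total (xs @ ys) F = list_total xs F + list_total ys F"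
  by (simp_all add: list_total_def)

lemma list_total_cong:
  assumes "xs \<in> lists (C \<times> D)" "\<And>m n. \<lbrakk>m \<in> C; n \<in> D\<rbrakk> \<Longrightarrow> F m n = G m n"
  shows "list_total xs F = list_total xs G"
  using assms(1) by (induction xs) (auto simp: assms(2))

text \<open>The clauses mirror the generators of \<open>tensor_cong\<close>; for
  \<open>tc_zero\<close>, additivity in the left argument already forces the value 0.\<close>

definition balanced_map ::
  "(complex, 'a, 'x) module_scheme \<Rightarrow> (complex, 'm, 'y) module_scheme \<Rightarrow> ('m \<Rightarrow> 'a \<Rightarrow> 'm) \<Rightarrow>
   (complex, 'n, 'z) module_scheme \<Rightarrow> ('a \<Rightarrow> 'n \<Rightarrow> 'n) \<Rightarrow> ('m \<Rightarrow> 'n \<Rightarrow> complex) \<Rightarrow> bool" where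
  "balanced_map A M r N l F \<longleftrightarrow>
    (\<forall>m\<in>carrier M. \<forall>m'\<in>carrier M. \<forall>n\<in>carrier N. F (m \<oplus>\<^bsub>M\<^esub> m') n = F m n + F m' n) \<and>
    (\<forall>m\<in>carrier M. \<forall>n\<in>carrier N. \<forall>n'\<in>carrier N. F m (n \<oplus>\<^bsub>N\<^esub> n') = F m n + F m n') \<and>
    (\<forall>m\<in>carrier M. \<forall>a\<in>carrier A. \<forall>n\<in>carrier N. F (r m a) n = F m (l a n))"

lemma balanced_mapI:
  assumes "\<And>m m' n. \<lbrakk>m \<in> carrier M; m' \<in> carrier M; n \<in> carrier N\<rbrakk> \<Longrightarrow> F (m \<oplus>\<^bsub>M\<^esub> m') n = F m n + F m' n"
    and "\<And>m n n'. \<lbrakk>m \<in> carrier M; n \<in> carrier N; n' \<in> carrier N\<rbrakk> \<Longrightarrow> F m (n \<oplus>\<^bsub>N\<^esub> n') = F m n + F m n'"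
    and "\<And>m a n. \<lbrakk>m \<in> carrier M; a \<in> carrier A; n \<in> carrier N\<rbrakk> \<Longrightarrow> F (r m a) n = F m (l a n)"
  shows "balanced_map A M r N l F"
  using assms by (simp add: balanced_map_def)

lemma balanced_mapD:
  assumes "balanced_map A M r N l F"
  shows "\<And>m m' n. \<lbrakk>m \<in> carrier M; m' \<in> carrier M; n \<in> carrier N\<rbrakk> \<Longrightarrow> F (m \<oplus>\<^bsub>M\<^esub> m') n = F m n + F m' n"
    and "\<And>m n n'. \<lbrakk>m \<in> carrier M; n \<in> carrier N; n' \<in> carrier N\<rbrakk> \<Longrightarrow> F m (n \<oplus>\<^bsub>N\<^esub> n') = F m n + F m n'"
    and "\<And>m a n. \<lbrakk>m \<in> carrier M; a \<in> carrier A; n \<in> carrier N\<rbrakk> \<Longrightarrow> F (r m a) n = F m (l a n)"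
  using assms by (simp_all add: balanced_map_def)

text \<open>
  The total of \<open>F\<close> over a chosen representative of \<open>X\<close>. Terms outside \<open>C \<times> D\<close> are dropped; for
  an element \<open>X\<close> of a tensor product with factors \<open>C\<close> and \<open>D\<close> there are none, and \<open>tsum_cong\<close> holds
  without any hypothesis on \<open>X\<close>.
\<close>

definition tsum :: "'m set \<Rightarrow> 'n set \<Rightarrow> ('m \<times> 'n) list set \<Rightarrow> ('m \<Rightarrow> 'n \<Rightarrow> complex) \<Rightarrow> complex" where
  "tsum C D X F = list_total (SOME xs. xs \<in> X) (\<lambda>m n. if m \<in> C \<and> n \<in> D then F m n else 0)"

text \<open>As a congruence rule it lets the simplifier assume that the bound variables lie in their
  carriers, which is how identities get applied below several nested sums.\<close>

lemma tsum_cong [cong]: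
  assumes "C = C'" "D = D'" "X = X'" "\<And>m n. \<lbrakk>m \<in> C'; n \<in> D'\<rbrakk> \<Longrightarrow> F m n = G m n"
  shows "tsum C D X F = tsum C' D' X' G"
proof -
  have "(\<lambda>m n. if m \<in> C \<and> n \<in> D then F m n else 0) = (\<lambda>m n. if m \<in> C' \<and> n \<in> D' then G m n else 0)"
    using assms by (auto simp: fun_eq_iff)
  then show ?thesis using assms(3) by (simp add: tsum_def)
qed

lemma tsum_ext:
  "(\<And>m n. \<lbrakk>m \<in> C; n \<in> D\<rbrakk> \<Longrightarrow> F m n = G m n) \<Longrightarrow> tsum C D X F = tsum C D X G"
  by (rule tsum_cong) auto

lemma list_total_add: "list_total xs (\<lambda>m n. F m n + G m n) = list_total xs F + list_total xs G"
  by (induction xs) auto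

lemma tsum_add: "tsum C D X (\<lambda>m n. F m n + G m n) = tsum C D X F + tsum C D X G"
  unfolding tsum_def list_total_add[symmetric]
  by (rule arg_cong[where f = "list_total _"]) (auto simp: fun_eq_iff)

lemma list_total_swap:
  "list_total xs (\<lambda>m n. list_total ys (\<lambda>u v. F m n u v)) =
   list_total ys (\<lambda>u v. list_total xs (\<lambda>m n. F m n u v))"
proof (induction xs)
  case Nil
  show ?case by (induction ys) auto
next
  case (Cons p xs)
  then show ?case by (cases p) (simp add: list_total_add)
qed

text \<open>The representatives of \<open>X\<close> and \<open>Y\<close> are chosen independently of
  the summation variables, so this is a finite double sum, whatever \<open>F\<close> is.\<close>

lemma tsum_swap:
  "tsum C D X (\<lambda>m n. tsum C' D' Y (\<lambda>u v. F m n u v)) =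
   tsum C' D' Y (\<lambda>u v. tsum C D X (\<lambda>m n. F m n u v))"
proof -
  have zero: "list_total ys (\<lambda>u v. 0) = 0" for ys :: "('c \<times> 'd) list"
    by (induction ys) auto
  have if_total: "(if b then list_total ys G else 0) = list_total ys (\<lambda>u v. if b then G u v else 0)"
    for b and ys :: "('c \<times> 'd) list" and G
    by (induction ys) auto
  have if_if_total: "list_total xs (\<lambda>m n. if Q m n then if b then H m n else 0 else 0) =
      (if b then list_total xs (\<lambda>m n. if Q m n then H m n else 0) else 0)"
    for b Q H and xs :: "('a \<times> 'b) list"
    by (induction xs) auto
  show ?thesis
    unfolding tsum_def if_total by (subst list_total_swap) (simp only: if_if_total)
qed

text \<open>Scalars act on the left factor of the tensor product, so the scalar structure is asked
  of \<open>M\<close> together with an action \<open>r\<close> commuting with it. The same locale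
  thereby covers comodule targets, iterated products, the Hopf domains over the opposite algebra,
  and the products over S and K.\<close>

locale tensor_product = M: complex_space M + N: abelian_group N
  for A :: "(complex, 'a, 'x) module_scheme" and M :: "(complex, 'm, 'y) module_scheme"
    and r :: "'m \<Rightarrow> 'a \<Rightarrow> 'm" and N :: "(complex, 'n, 'z) module_scheme" and l :: "'a \<Rightarrow> 'n \<Rightarrow> 'n" +
  assumes r_closed: "\<lbrakk>m \<in> carrier M; a \<in> carrier A\<rbrakk> \<Longrightarrow> r m a \<in> carrier M"
    and r_scale: "\<lbrakk>m \<in> carrier M; a \<in> carrier A\<rbrakk> \<Longrightarrow> r (c \<odot>\<^bsub>M\<^esub> m) a = c \<odot>\<^bsub>M\<^esub> r m a"
    and l_closed: "\<lbrakk>a \<in> carrier A; n \<in> carrier N\<rbrakk> \<Longrightarrow> l a n \<in> carrier N"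
begin

text \<open>Each interpretation adds its own instance to the simpset, which discharges the first
  premise of \<open>eval_sweedler\<close>.\<close>

declare tensor_product_axioms [simp]

abbreviation cong (infix \<open>\<simeq>\<close> 50) where "xs \<simeq> ys \<equiv> tensor_cong A M r N l xs ys"

definition cls :: "('m \<times> 'n) list \<Rightarrow> ('m \<times> 'n) list set" where
  "cls xs = {ys. xs \<simeq> ys}"

abbreviation P where "P \<equiv> tensor A M r N l"

abbreviation Ls where "Ls \<equiv> lists (carrier M \<times> carrier N)"

lemma cong_lists: "xs \<simeq> ys \<Longrightarrow> xs \<in> Ls \<and> ys \<in> Ls"
  by (induction rule: tensor_cong.induct) (auto simp: r_closed l_closed)

lemma cls_eq_iff: "xs \<in> Ls \<Longrightarrow> ys \<in> Ls \<Longrightarrow> cls xs = cls ys \<longleftrightarrow> xs \<simeq> ys"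
  unfolding cls_def by (auto intro: tc_refl tc_sym tc_trans)

lemma cls_self: "xs \<in> Ls \<Longrightarrow> xs \<in> cls xs"
  by (simp add: cls_def tc_refl)

lemma carrier_tensor: "carrier P = cls ` Ls"
  by (auto simp: tensor_def Let_def quotient_def cls_def)

lemma tensor_cases:
  assumes "X \<in> carrier P" obtains xs where "xs \<in> Ls" "X = cls xs"
  using assms by (auto simp: carrier_tensor)

lemma mem_cls: "xs \<in> Ls \<Longrightarrow> ys \<in> cls xs \<longleftrightarrow> ys \<in> Ls \<and> cls ys = cls xs"
  using cls_eq_iff[of ys xs] cong_lists[of xs ys] unfolding cls_def mem_Collect_eq by (blast intro: tc_sym)

lemma add_cls: "xs \<in> Ls \<Longrightarrow> ys \<in> Ls \<Longrightarrow> cls xs \<oplus>\<^bsub>P\<^esub> cls ys = cls (xs @ ys)"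
proof -
  assume xy: "xs \<in> Ls" "ys \<in> Ls"
  have "cls (us @ vs) = cls (xs @ ys)" if "us \<in> cls xs" "vs \<in> cls ys" for us vs
    using that cong_lists[of xs us] cong_lists[of ys vs] xy
    by (subst cls_eq_iff) (auto simp: cls_def intro: tc_append tc_sym)
  moreover have "cls xs \<oplus>\<^bsub>P\<^esub> cls ys = (\<Union>us\<in>cls xs. \<Union>vs\<in>cls ys. cls (us @ vs))"
    by (simp add: tensor_def Let_def cls_def)
  moreover have "cls xs \<noteq> {}" "cls ys \<noteq> {}" using cls_self xy by blast+
  ultimately show ?thesis by (simp add: SUP_eq_const)
qed

lemma zero_tensor: "\<zero>\<^bsub>P\<^esub> = cls []"
  by (simp add: tensor_def Let_def cls_def)

abbreviation scale where "scale c \<equiv> map (\<lambda>(m, n). (c \<odot>\<^bsub>M\<^esub> m, n))"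

lemma scale_lists: "xs \<in> Ls \<Longrightarrow> scale c xs \<in> Ls"
  by (induction xs) auto

lemma cong_scale: "xs \<simeq> ys \<Longrightarrow> scale c xs \<simeq> scale c ys"
proof (induction rule: tensor_cong.induct)
  case (tc_refl xs)
  then show ?case by (intro tensor_cong.tc_refl scale_lists)
next
  case (tc_commute xs ys)
  then show ?case unfolding map_append by (intro tensor_cong.tc_commute scale_lists)
next
  case (tc_zero n)
  then show ?case using tensor_cong.tc_zero[of n N A M r l] M.smult_r_null[of c] by simp
next
  case (tc_add_left m m' n)
  then show ?case
    using tensor_cong.tc_add_left[of "c \<odot>\<^bsub>M\<^esub> m" M "c \<odot>\<^bsub>M\<^esub> m'" n N A r l]
    by (simp add: M.scale_add_right)
next
  case (tc_add_right m n n')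
  then show ?case using tensor_cong.tc_add_right[of "c \<odot>\<^bsub>M\<^esub> m" M n N n' A r l] by simp
next
  case (tc_balance m a n)
  then show ?case using tensor_cong.tc_balance[of "c \<odot>\<^bsub>M\<^esub> m" M a A n N r l] by (simp add: r_scale)
qed (auto intro: tc_sym tc_trans tc_append)

lemma scale_cls: "xs \<in> Ls \<Longrightarrow> c \<odot>\<^bsub>P\<^esub> cls xs = cls (scale c xs)"
proof -
  assume xs: "xs \<in> Ls"
  have "cls (scale c us) = cls (scale c xs)"
    if "us \<in> cls xs" for us
    using that cong_lists[of xs us] xs scale_lists
    by (subst cls_eq_iff) (auto simp: cls_def intro: cong_scale tc_sym)
  moreover have "c \<odot>\<^bsub>P\<^esub> cls xs = (\<Union>us\<in>cls xs. cls (scale c us))"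
    by (simp add: tensor_def Let_def cls_def)
  moreover have "cls xs \<noteq> {}" using cls_self[OF xs] by blast
  ultimately show ?thesis by (simp add: SUP_eq_const)
qed

lemma cls_Cons:
  "\<lbrakk>m \<in> carrier M; n \<in> carrier N; xs \<in> Ls\<rbrakk> \<Longrightarrow> cls ((m, n) # xs) = cls [(m, n)] \<oplus>\<^bsub>P\<^esub> cls xs"
  using add_cls[of "[(m, n)]" xs] by simp

lemma tensor_abelian_group [simp]: "abelian_group P"
proof (rule abelian_groupI)
  fix X Y Z assume "X \<in> carrier P" "Y \<in> carrier P" "Z \<in> carrier P"
  then obtain xs ys zs where "xs \<in> Ls" "X = cls xs" "ys \<in> Ls" "Y = cls ys" "zs \<in> Ls" "Z = cls zs"
    by (metis tensor_cases)
  then show "X \<oplus>\<^bsub>P\<^esub> Y \<oplus>\<^bsub>P\<^esub> Z = X \<oplus>\<^bsub>P\<^esub> (Y \<oplus>\<^bsub>P\<^esub> Z)"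
    using add_cls by simp
next
  fix X Y assume "X \<in> carrier P" "Y \<in> carrier P"
  then obtain xs ys where xy: "xs \<in> Ls" "X = cls xs" "ys \<in> Ls" "Y = cls ys"
    by (metis tensor_cases)
  then show "X \<oplus>\<^bsub>P\<^esub> Y \<in> carrier P"
    by (auto simp: add_cls carrier_tensor)
  show "X \<oplus>\<^bsub>P\<^esub> Y = Y \<oplus>\<^bsub>P\<^esub> X"
    using xy by (simp add: add_cls) (auto simp: cls_eq_iff intro: tc_commute)
next
  show "\<zero>\<^bsub>P\<^esub> \<in> carrier P" by (auto simp: carrier_tensor zero_tensor)
next
  fix X assume "X \<in> carrier P"
  then obtain xs where xs: "xs \<in> Ls" "X = cls xs" by (metis tensor_cases)
  then show "\<zero>\<^bsub>P\<^esub> \<oplus>\<^bsub>P\<^esub> X = X" by (simp add: zero_tensor add_cls)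
  \<comment> \<open>The inverse negates all left entries. In the induction each pair is moved next
    to its negative, where the two merge into \<open>(0, n)\<close> and disappear.\<close>
  have "scale (-1) xs @ xs \<simeq> []"
    using xs(1)
  proof (induction xs)
    case Nil
    then show ?case by (auto intro: tc_refl)
  next
    case (Cons p xs)
    then obtain m n where p: "p = (m, n)" "m \<in> carrier M" "n \<in> carrier N" by auto
    let ?ys = "scale (-1) xs"
    let ?q = "((-1) \<odot>\<^bsub>M\<^esub> m, n)"
    have xs: "xs \<in> Ls" and ys: "?ys \<in> Ls" using Cons scale_lists by auto
    have q: "[?q] \<in> Ls" using p by simp
    have "?ys @ [p] @ xs \<simeq> [p] @ ?ys @ xs"
      using tc_append[OF tc_commute[of ?ys M N "[p]"] tc_refl[of xs]] p xs ys by simp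
    then have "[?q] @ ?ys @ [p] @ xs \<simeq> [?q] @ [p] @ ?ys @ xs"
      using tc_append[OF tc_refl[OF q]] by blast
    also have "[?q] @ [p] @ ?ys @ xs = [?q, p] @ (?ys @ xs)" by simp
    finally have 1: "[?q] @ ?ys @ [p] @ xs \<simeq> [?q, p] @ (?ys @ xs)" .
    have "[((-1) \<odot>\<^bsub>M\<^esub> m \<oplus>\<^bsub>M\<^esub> m, n)] \<simeq> [?q, p]"
      using p tc_add_left[of "(-1) \<odot>\<^bsub>M\<^esub> m" M m n] by simp
    moreover have "(-1) \<odot>\<^bsub>M\<^esub> m \<oplus>\<^bsub>M\<^esub> m = \<zero>\<^bsub>M\<^esub>" using p by (simp add: M.scale_minus_one M.l_neg)
    ultimately have "[?q, p] \<simeq> []" using tc_zero[OF p(3)] by (metis tc_sym tc_trans)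
    then have "[?q, p] @ (?ys @ xs) \<simeq> [] @ []" using Cons by (intro tc_append) auto
    then show ?case using tc_trans[OF 1] p(1) by simp
  qed
  then have "cls (scale (-1) xs @ xs) = cls []"
    using xs scale_lists by (subst cls_eq_iff) auto
  then show "\<exists>Y\<in>carrier P. Y \<oplus>\<^bsub>P\<^esub> X = \<zero>\<^bsub>P\<^esub>"
    using xs scale_lists[OF xs(1)]
    by (intro bexI[of _ "cls (scale (-1) xs)"])
       (auto simp: add_cls zero_tensor carrier_tensor)
qed

sublocale P: abelian_group P by (rule tensor_abelian_group)

lemma cls_closed [simp]: "xs \<in> Ls \<Longrightarrow> cls xs \<in> carrier P"
  by (auto simp: carrier_tensor)

lemma scale_cls_single:
  "\<lbrakk>m \<in> carrier M; n \<in> carrier N\<rbrakk> \<Longrightarrow> c \<odot>\<^bsub>P\<^esub> cls [(m, n)] = cls [(c \<odot>\<^bsub>M\<^esub> m, n)]"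
  by (simp add: scale_cls)

lemma scale_tensor_add:
  assumes "X \<in> carrier P" "Y \<in> carrier P"
  shows "c \<odot>\<^bsub>P\<^esub> (X \<oplus>\<^bsub>P\<^esub> Y) = c \<odot>\<^bsub>P\<^esub> X \<oplus>\<^bsub>P\<^esub> c \<odot>\<^bsub>P\<^esub> Y"
proof -
  obtain xs ys where "xs \<in> Ls" "X = cls xs" "ys \<in> Ls" "Y = cls ys" using assms by (metis tensor_cases)
  then show ?thesis by (simp add: add_cls scale_cls scale_lists)
qed

lemma scale_tensor_closed: "X \<in> carrier P \<Longrightarrow> c \<odot>\<^bsub>P\<^esub> X \<in> carrier P"
  by (metis scale_cls scale_lists cls_closed tensor_cases)

lemma single_add_left:
  "\<lbrakk>m \<in> carrier M; m' \<in> carrier M; n \<in> carrier N\<rbrakk> \<Longrightarrow>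
    cls [(m \<oplus>\<^bsub>M\<^esub> m', n)] = cls [(m, n)] \<oplus>\<^bsub>P\<^esub> cls [(m', n)]"
  by (simp add: add_cls cls_eq_iff tc_add_left)

lemma tensor_induct [consumes 1, case_names zero add]:
  assumes "X \<in> carrier P" and "Q \<zero>\<^bsub>P\<^esub>"
    and "\<And>m n X. \<lbrakk>m \<in> carrier M; n \<in> carrier N; X \<in> carrier P; Q X\<rbrakk> \<Longrightarrow> Q (cls [(m, n)] \<oplus>\<^bsub>P\<^esub> X)"
  shows "Q X"
proof -
  obtain xs where xs: "xs \<in> Ls" "X = cls xs" using assms(1) by (metis tensor_cases)
  have "Q (cls xs)" using xs(1)
  proof (induction xs)
    case Nil
    then show ?case using assms(2) by (simp add: zero_tensor)
  next
    case (Cons p xs)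
    then obtain m n where p: "p = (m, n)" "m \<in> carrier M" "n \<in> carrier N" by auto
    then show ?case using assms(3)[of m n "cls xs"] Cons cls_Cons[of m n xs] by simp
  qed
  then show ?thesis using xs by simp
qed

lemma tensor_module: "module complex_ring P"
proof (rule moduleI)
  show "cring complex_ring" by (rule M.R.is_cring)
  show "abelian_group P" by (rule tensor_abelian_group)
next
  fix a b :: complex and X assume X: "X \<in> carrier P"
  show "a \<odot>\<^bsub>P\<^esub> X \<in> carrier P" using X by (rule scale_tensor_closed)
  have z: "c \<odot>\<^bsub>P\<^esub> \<zero>\<^bsub>P\<^esub> = \<zero>\<^bsub>P\<^esub>" for c by (simp add: zero_tensor scale_cls)
  show "(a \<oplus>\<^bsub>complex_ring\<^esub> b) \<odot>\<^bsub>P\<^esub> X = a \<odot>\<^bsub>P\<^esub> X \<oplus>\<^bsub>P\<^esub> b \<odot>\<^bsub>P\<^esub> X"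
    using X
  proof (induction X rule: tensor_induct)
    case zero
    then show ?case by (simp add: z)
  next
    case (add m n X)
    then have "cls [((a + b) \<odot>\<^bsub>M\<^esub> m, n)] = cls [(a \<odot>\<^bsub>M\<^esub> m, n)] \<oplus>\<^bsub>P\<^esub> cls [(b \<odot>\<^bsub>M\<^esub> m, n)]"
      by (simp add: M.scale_add_left single_add_left)
    then show ?case
      using add by (simp add: scale_tensor_add scale_cls_single P.a_ac scale_tensor_closed)
  qed
  show "(a \<otimes>\<^bsub>complex_ring\<^esub> b) \<odot>\<^bsub>P\<^esub> X = a \<odot>\<^bsub>P\<^esub> (b \<odot>\<^bsub>P\<^esub> X)"
    using X
    by (induction X rule: tensor_induct)
       (simp_all add: z scale_tensor_add scale_cls_single scale_tensor_closed M.scale_scale)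
  show "\<one>\<^bsub>complex_ring\<^esub> \<odot>\<^bsub>P\<^esub> X = X"
    using X by (induction X rule: tensor_induct) (simp_all add: z scale_tensor_add scale_cls_single)
next
  fix a :: complex and X Y assume "X \<in> carrier P" "Y \<in> carrier P"
  then show "a \<odot>\<^bsub>P\<^esub> (X \<oplus>\<^bsub>P\<^esub> Y) = a \<odot>\<^bsub>P\<^esub> X \<oplus>\<^bsub>P\<^esub> a \<odot>\<^bsub>P\<^esub> Y" by (rule scale_tensor_add)
qed

lemma tensor_complex_space: "complex_space P"
  using tensor_module by (simp add: complex_space_def)

sublocale P: complex_space P by (rule tensor_complex_space)

lemma pure_tensor_eq: "\<lbrakk>m \<in> carrier M; n \<in> carrier N\<rbrakk> \<Longrightarrow> m \<boxtimes>\<^bsub>P\<^esub> n = cls [(m, n)]"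
  unfolding pure_tensor_def
proof (rule the_equality)
  assume mn: "m \<in> carrier M" "n \<in> carrier N"
  show "cls [(m, n)] \<in> carrier P \<and> [(m, n)] \<in> cls [(m, n)]" using mn by (simp add: cls_self)
  fix X assume "X \<in> carrier P \<and> [(m, n)] \<in> X"
  then show "X = cls [(m, n)]" using mn by (metis mem_cls tensor_cases)
qed

lemma pure_tensor_closed [simp, intro]:
  "\<lbrakk>m \<in> carrier M; n \<in> carrier N\<rbrakk> \<Longrightarrow> m \<boxtimes>\<^bsub>P\<^esub> n \<in> carrier P"
  by (simp add: pure_tensor_eq)

lemma pure_tensor_add_left:
  "\<lbrakk>m \<in> carrier M; m' \<in> carrier M; n \<in> carrier N\<rbrakk> \<Longrightarrow>
    (m \<oplus>\<^bsub>M\<^esub> m') \<boxtimes>\<^bsub>P\<^esub> n = m \<boxtimes>\<^bsub>P\<^esub> n \<oplus>\<^bsub>P\<^esub> m' \<boxtimes>\<^bsub>P\<^esub> n"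
  by (simp add: pure_tensor_eq single_add_left)

lemma pure_tensor_add_right:
  "\<lbrakk>m \<in> carrier M; n \<in> carrier N; n' \<in> carrier N\<rbrakk> \<Longrightarrow>
    m \<boxtimes>\<^bsub>P\<^esub> (n \<oplus>\<^bsub>N\<^esub> n') = m \<boxtimes>\<^bsub>P\<^esub> n \<oplus>\<^bsub>P\<^esub> m \<boxtimes>\<^bsub>P\<^esub> n'"
  by (simp add: pure_tensor_eq add_cls cls_eq_iff tc_add_right)

lemma pure_tensor_balanced:
  "\<lbrakk>m \<in> carrier M; a \<in> carrier A; n \<in> carrier N\<rbrakk> \<Longrightarrow> r m a \<boxtimes>\<^bsub>P\<^esub> n = m \<boxtimes>\<^bsub>P\<^esub> l a n"
  by (simp add: pure_tensor_eq r_closed l_closed cls_eq_iff tc_balance)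

abbreviation eval where "eval \<equiv> tsum (carrier M) (carrier N)"

abbreviation bal where "bal \<equiv> balanced_map A M r N l"

lemma rep_props: "X \<in> carrier P \<Longrightarrow> xs \<in> X \<Longrightarrow> xs \<in> Ls \<and> cls xs = X"
  using mem_cls by (elim tensor_cases) blast

lemma some_rep:
  assumes "X \<in> carrier P"
  shows "(SOME xs. xs \<in> X) \<in> Ls" "X = cls (SOME xs. xs \<in> X)"
proof -
  obtain xs where xs: "xs \<in> Ls" "X = cls xs" using assms by (metis tensor_cases)
  have "(SOME ys. ys \<in> X) \<in> X" using cls_self[OF xs(1)] xs(2) someI[of "\<lambda>ys. ys \<in> X" xs] by simp
  from rep_props[OF assms this] show "(SOME xs. xs \<in> X) \<in> Ls" "X = cls (SOME xs. xs \<in> X)"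
    by simp_all
qed

lemma eval_some: "X \<in> carrier P \<Longrightarrow> eval X F = list_total (SOME xs. xs \<in> X) F"
  unfolding tsum_def by (rule list_total_cong[OF some_rep(1)]) auto

lemma list_total_balanced:
  assumes "bal F" "xs \<simeq> ys" shows "list_total xs F = list_total ys F"
  using assms(2)
proof (induction rule: tensor_cong.induct)
  case (tc_zero n)
  then show ?case using balanced_mapD(1)[OF assms(1), of "\<zero>\<^bsub>M\<^esub>" "\<zero>\<^bsub>M\<^esub>" n] by simp
qed (auto simp: balanced_mapD[OF assms(1)])

lemma eval_rep:
  assumes "X \<in> carrier P" "xs \<in> X" "bal F" shows "eval X F = list_total xs F"
proof -
  have "cls (SOME ys. ys \<in> X) = cls xs" "xs \<in> Ls"
    using some_rep(2)[OF assms(1)] rep_props[OF assms(1,2)] by simp_all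
  then have "(SOME ys. ys \<in> X) \<simeq> xs" using some_rep[OF assms(1)] cls_eq_iff by blast
  then show ?thesis using list_total_balanced[OF assms(3)] assms(1) by (simp add: eval_some)
qed

lemma rep_in_lists: "X \<in> carrier P \<Longrightarrow> xs \<in> X \<Longrightarrow> xs \<in> Ls"
  using rep_props by blast

lemma eval_cls: "bal F \<Longrightarrow> xs \<in> Ls \<Longrightarrow> eval (cls xs) F = list_total xs F"
  by (simp add: eval_rep cls_self)

lemma eval_pure: "\<lbrakk>bal F; m \<in> carrier M; n \<in> carrier N\<rbrakk> \<Longrightarrow> eval (m \<boxtimes>\<^bsub>P\<^esub> n) F = F m n"
  by (simp add: pure_tensor_eq eval_cls)

lemma eval_add:
  assumes "bal F" "X \<in> carrier P" "Y \<in> carrier P"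
  shows "eval (X \<oplus>\<^bsub>P\<^esub> Y) F = eval X F + eval Y F"
proof -
  obtain xs ys where "xs \<in> Ls" "X = cls xs" "ys \<in> Ls" "Y = cls ys" using assms by (metis tensor_cases)
  then show ?thesis using assms(1) by (simp add: add_cls eval_cls)
qed

lemma eval_scale:
  assumes "bal F" "X \<in> carrier P"
  shows "eval (c \<odot>\<^bsub>P\<^esub> X) F = eval X (\<lambda>m n. F (c \<odot>\<^bsub>M\<^esub> m) n)"
proof -
  obtain xs where xs: "xs \<in> Ls" "X = cls xs" using assms by (metis tensor_cases)
  have F: "bal (\<lambda>m n. F (c \<odot>\<^bsub>M\<^esub> m) n)"
    by (rule balanced_mapI)
       (simp_all add: M.scale_add_right balanced_mapD[OF assms(1)] r_scale[symmetric] )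
  have "list_total (scale c xs) F = list_total xs (\<lambda>m n. F (c \<odot>\<^bsub>M\<^esub> m) n)"
    by (induction xs) auto
  then show ?thesis using xs assms(1) F by (simp add: scale_cls eval_cls scale_lists)
qed

lemma balanced_pure:
  assumes "additive_functional P p" shows "bal (\<lambda>m n. p (m \<boxtimes>\<^bsub>P\<^esub> n))"
  by (rule balanced_mapI)
     (simp_all add: pure_tensor_add_left pure_tensor_add_right pure_tensor_balanced
        additive_functionalD[OF assms])

lemma eval_functional:
  assumes "additive_functional P p" "X \<in> carrier P"
  shows "eval X (\<lambda>m n. p (m \<boxtimes>\<^bsub>P\<^esub> n)) = p X"
proof -
  obtain xs where xs: "xs \<in> Ls" "X = cls xs" using assms by (metis tensor_cases)
  have "list_total xs (\<lambda>m n. p (m \<boxtimes>\<^bsub>P\<^esub> n)) = p (cls xs)" using xs(1)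
  proof (induction xs)
    case Nil
    then show ?case
      using P.additive_functional_zero[OF assms(1)] by (simp add: zero_tensor)
  next
    case (Cons q xs)
    then obtain m n where "q = (m, n)" "m \<in> carrier M" "n \<in> carrier N" by auto
    then show ?case
      using Cons cls_Cons[of m n xs] by (simp add: additive_functionalD[OF assms(1)] pure_tensor_eq)
  qed
  then show ?thesis using xs balanced_pure[OF assms(1)] by (simp add: eval_cls)
qed

lemma functional_of_balanced: "bal F \<Longrightarrow> additive_functional P (\<lambda>X. eval X F)"
  by (simp add: additive_functional_def eval_add)

text \<open>An additive functional \<open>p\<close> is recovered by evaluating the balanced map that
  sends m, n to the value of \<open>p\<close> at their pure tensor, so balanced maps inherit the
  separation property of functionals.\<close>

lemma tensor_eqI:
  assumes "X \<in> carrier P" "Y \<in> carrier P" "\<And>F. bal F \<Longrightarrow> eval X F = eval Y F"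
  shows "X = Y"
  by (rule P.functionals_separate[OF assms(1,2)])
     (metis assms eval_functional balanced_pure)

lemma sum_over_functional:
  assumes "abelian_group W" "additive_functional W p" "xs \<in> lists (C \<times> D)"
    "\<And>m n. \<lbrakk>m \<in> C; n \<in> D\<rbrakk> \<Longrightarrow> f m n \<in> carrier W"
  shows "sum_over W xs f \<in> carrier W" "p (sum_over W xs f) = list_total xs (\<lambda>m n. p (f m n))"
proof -
  interpret W: abelian_group W by fact
  show "sum_over W xs f \<in> carrier W" using W.sum_over_closed[OF assms(3)] assms(4) by blast
  show "p (sum_over W xs f) = list_total xs (\<lambda>m n. p (f m n))" using assms(3)
  proof (induction xs)
    case Nil
    then show ?case by (simp add: sum_over_def W.additive_functional_zero[OF assms(2)])
  next
    case (Cons q xs)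
    then obtain m n where q: "q = (m, n)" "m \<in> C" "n \<in> D" by auto
    have "sum_over W xs f \<in> carrier W" using W.sum_over_closed[of xs C D f] Cons assms(4) by auto
    then show ?case
      using Cons q assms(4) additive_functionalD[OF assms(2)] by (simp add: sum_over_def)
  qed
qed

lemma sweedler_closed [simp, intro]:
  assumes "abelian_group W" "X \<in> carrier P"
    "\<And>m n. \<lbrakk>m \<in> carrier M; n \<in> carrier N\<rbrakk> \<Longrightarrow> f m n \<in> carrier W"
  shows "sweedler W X f \<in> carrier W"
  unfolding sweedler_def
  using abelian_group.sum_over_closed[OF assms(1) some_rep(1)[OF assms(2)]] assms(3) by blast

text \<open>No balance condition on \<open>f\<close> is needed: both sides use the same representative of \<open>X\<close>.\<close>

lemma functional_sweedler:
  assumes "abelian_group W" "additive_functional W p" "X \<in> carrier P"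
    "\<And>m n. \<lbrakk>m \<in> carrier M; n \<in> carrier N\<rbrakk> \<Longrightarrow> f m n \<in> carrier W"
  shows "p (sweedler W X f) = eval X (\<lambda>m n. p (f m n))"
  unfolding sweedler_def using sum_over_functional(2)[OF assms(1,2) some_rep(1)[OF assms(3)] assms(4)]
  by (simp add: eval_some[OF assms(3)])

end

section \<open>Comodules in terms of balanced maps\<close>

sublocale calgebra \<subseteq> space: complex_space A
  by (simp add: complex_space_def module_axioms)

lemma clinear_mapD:
  assumes "clinear_map V W f"
  shows "\<And>x. x \<in> carrier V \<Longrightarrow> f x \<in> carrier W"
    and "\<And>x y. \<lbrakk>x \<in> carrier V; y \<in> carrier V\<rbrakk> \<Longrightarrow> f (x \<oplus>\<^bsub>V\<^esub> y) = f x \<oplus>\<^bsub>W\<^esub> f y"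
    and "\<And>c x. x \<in> carrier V \<Longrightarrow> f (c \<odot>\<^bsub>V\<^esub> x) = c \<odot>\<^bsub>W\<^esub> f x"
  using assms by (auto simp: clinear_map_def)

sublocale left_module \<subseteq> M: complex_space M
  by (simp add: complex_space_def M.module_axioms)

sublocale right_module \<subseteq> M: complex_space M
  by (simp add: complex_space_def M.module_axioms)

context left_module
begin

lemma act_closed [simp]: "\<lbrakk>a \<in> carrier A; m \<in> carrier M\<rbrakk> \<Longrightarrow> act a m \<in> carrier M"
  by (rule clinear_mapD(1)[OF act_linear_right])

lemma act_add_right:
  "\<lbrakk>a \<in> carrier A; m \<in> carrier M; m' \<in> carrier M\<rbrakk> \<Longrightarrow> act a (m \<oplus>\<^bsub>M\<^esub> m') = act a m \<oplus>\<^bsub>M\<^esub> act a m'"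
  by (rule clinear_mapD(2)[OF act_linear_right])

lemma act_add_left:
  "\<lbrakk>a \<in> carrier A; b \<in> carrier A; m \<in> carrier M\<rbrakk> \<Longrightarrow> act (a \<oplus>\<^bsub>A\<^esub> b) m = act a m \<oplus>\<^bsub>M\<^esub> act b m"
  by (rule clinear_mapD(2)[OF act_linear_left])

lemma act_scale_right:
  "\<lbrakk>a \<in> carrier A; m \<in> carrier M\<rbrakk> \<Longrightarrow> act a (c \<odot>\<^bsub>M\<^esub> m) = c \<odot>\<^bsub>M\<^esub> act a m"
  by (rule clinear_mapD(3)[OF act_linear_right])

lemma act_scale_left:
  "\<lbrakk>a \<in> carrier A; m \<in> carrier M\<rbrakk> \<Longrightarrow> act (c \<odot>\<^bsub>A\<^esub> a) m = c \<odot>\<^bsub>M\<^esub> act a m"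
  by (rule clinear_mapD(3)[OF act_linear_left])

end

context right_module
begin

lemma act_closed [simp]: "\<lbrakk>a \<in> carrier A; m \<in> carrier M\<rbrakk> \<Longrightarrow> act m a \<in> carrier M"
  by (rule clinear_mapD(1)[OF act_linear_left])

lemma act_add_left:
  "\<lbrakk>a \<in> carrier A; m \<in> carrier M; m' \<in> carrier M\<rbrakk> \<Longrightarrow> act (m \<oplus>\<^bsub>M\<^esub> m') a = act m a \<oplus>\<^bsub>M\<^esub> act m' a"
  by (rule clinear_mapD(2)[OF act_linear_left])

lemma act_add_right:
  "\<lbrakk>a \<in> carrier A; b \<in> carrier A; m \<in> carrier M\<rbrakk> \<Longrightarrow> act m (a \<oplus>\<^bsub>A\<^esub> b) = act m a \<oplus>\<^bsub>M\<^esub> act m b"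
  by (rule clinear_mapD(2)[OF act_linear_right])

lemma act_scale_left:
  "\<lbrakk>a \<in> carrier A; m \<in> carrier M\<rbrakk> \<Longrightarrow> act (c \<odot>\<^bsub>M\<^esub> m) a = c \<odot>\<^bsub>M\<^esub> act m a"
  by (rule clinear_mapD(3)[OF act_linear_left])

lemma act_scale_right:
  "\<lbrakk>a \<in> carrier A; m \<in> carrier M\<rbrakk> \<Longrightarrow> act m (c \<odot>\<^bsub>A\<^esub> a) = c \<odot>\<^bsub>M\<^esub> act m a"
  by (rule clinear_mapD(3)[OF act_linear_right])

end

text \<open>Evaluation against a balanced \<open>F\<close> is an additive functional on the target,
  and such functionals pass through the sum over \<open>X\<close>. As a rewrite rule this turns
  nested Sweedler expressions into nested sums of numbers.\<close>

lemma (in tensor_product) eval_sweedler: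
  fixes A' :: "(complex, 'a1, 'x1) module_scheme" and M' :: "(complex, 'm1, 'y1) module_scheme"
    and r' :: "'m1 \<Rightarrow> 'a1 \<Rightarrow> 'm1" and N' :: "(complex, 'n1, 'z1) module_scheme" and l' :: "'a1 \<Rightarrow> 'n1 \<Rightarrow> 'n1"
  assumes "tensor_product A' M' r' N' l'" "balanced_map A' M' r' N' l' F" "X \<in> carrier P"
    "\<And>m n. \<lbrakk>m \<in> carrier M; n \<in> carrier N\<rbrakk> \<Longrightarrow> f m n \<in> carrier (tensor A' M' r' N' l')"
  shows "tsum (carrier M') (carrier N') (sweedler (tensor A' M' r' N' l') X f) F =
    eval X (\<lambda>m n. tsum (carrier M') (carrier N') (f m n) F)"
proof -
  interpret Q: tensor_product A' M' r' N' l' by fact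
  show ?thesis
    by (rule functional_sweedler[OF Q.tensor_abelian_group Q.functional_of_balanced[OF assms(2)] assms(3,4)])
qed

text \<open>
  For commuting actions of \<open>A\<close> and \<open>A'\<close> on \<open>N\<close>, the product \<open>(M \<otimes> N) \<otimes> L\<close>, with \<open>A'\<close> acting on
  \<open>M \<otimes> N\<close> through \<open>N\<close>.
\<close>

locale iterated_tensor = tensor_product A M r N l + L: abelian_group L
  for A M r and N :: "(complex, 'n, 'z) module_scheme" and l and A' :: "(complex, 'c, 'u) module_scheme" and h :: "'c \<Rightarrow> 'n \<Rightarrow> 'n"
    and L :: "(complex, 'l, 'v) module_scheme" and l' :: "'c \<Rightarrow> 'l \<Rightarrow> 'l" +
  assumes h_closed: "\<lbrakk>x \<in> carrier A'; n \<in> carrier N\<rbrakk> \<Longrightarrow> h x n \<in> carrier N"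
    and h_add: "\<lbrakk>x \<in> carrier A'; n \<in> carrier N; n' \<in> carrier N\<rbrakk> \<Longrightarrow> h x (n \<oplus>\<^bsub>N\<^esub> n') = h x n \<oplus>\<^bsub>N\<^esub> h x n'"
    and h_l: "\<lbrakk>x \<in> carrier A'; a \<in> carrier A; n \<in> carrier N\<rbrakk> \<Longrightarrow> h x (l a n) = l a (h x n)"
    and l'_closed: "\<lbrakk>x \<in> carrier A'; y \<in> carrier L\<rbrakk> \<Longrightarrow> l' x y \<in> carrier L"
begin

abbreviation ract2 where "ract2 X x \<equiv> sweedler P X (\<lambda>m n. m \<boxtimes>\<^bsub>P\<^esub> h x n)"

lemma eval_ract2:
  assumes "X \<in> carrier P" "x \<in> carrier A'"
  shows "ract2 X x \<in> carrier P"
    and "bal F \<Longrightarrow> eval (ract2 X x) F = eval X (\<lambda>m n. F m (h x n))"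
  using assms by (simp_all add: eval_sweedler eval_pure h_closed)

lemma balanced_slot:
  assumes "bal F" "x \<in> carrier A'"
  shows "bal (\<lambda>m n. F m (h x n))"
  using assms(2) by (intro balanced_mapI) (simp_all add: balanced_mapD[OF assms(1)] h_closed h_add h_l)

lemma iterated: "tensor_product A' P ract2 L l'"
proof unfold_locales
  fix X x c assume X: "X \<in> carrier P" and x: "x \<in> carrier A'"
  show "ract2 (c \<odot>\<^bsub>P\<^esub> X) x = c \<odot>\<^bsub>P\<^esub> ract2 X x"
  proof (rule tensor_eqI)
    fix F assume F: "bal F"
    have F': "bal (\<lambda>m n. F (c \<odot>\<^bsub>M\<^esub> m) n)"
      by (intro balanced_mapI)
         (simp_all add: balanced_mapD[OF F] M.scale_add_right r_scale[symmetric])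
    show "eval (ract2 (c \<odot>\<^bsub>P\<^esub> X) x) F = eval (c \<odot>\<^bsub>P\<^esub> ract2 X x) F"
      using X x F F' by (simp add: eval_ract2 eval_scale balanced_slot)
  qed (use X x eval_ract2 in auto)
qed (use eval_ract2 l'_closed in auto)

text \<open>A map of three slots that is balanced between neighbouring slots is a functional on the
  iterated product: \<open>G1\<close> makes the evaluation at \<open>X\<close> additive and
  independent of representatives, \<open>G2\<close> handles the last slot.\<close>

lemma iterated_balanced:
  assumes G1: "\<And>y. y \<in> carrier L \<Longrightarrow> bal (\<lambda>m n. G m n y)"
    and G2: "\<And>m. m \<in> carrier M \<Longrightarrow> balanced_map A' N (\<lambda>n x. h x n) L l' (G m)"
  shows "balanced_map A' P ract2 L l' (\<lambda>X y. eval X (\<lambda>m n. G m n y))"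
  by (intro balanced_mapI)
     (simp_all add: eval_add G1 balanced_mapD(2)[OF G2] tsum_add eval_ract2 balanced_mapD(3)[OF G2])

end

context right_bialgebroid
begin

abbreviation oneB (\<open>\<one>\<^sub>B\<close>) where "oneB \<equiv> \<one>\<^bsub>B\<^esub>"

abbreviation bmult (infixl \<open>\<bullet>\<close> 70) where "b \<bullet> c \<equiv> b \<otimes>\<^bsub>B\<^esub> c"

lemma source_closed [simp]: "x \<in> carrier R \<Longrightarrow> source B x \<in> carrier B"
  and source_one [simp]: "source B \<one>\<^bsub>R\<^esub> = \<one>\<^bsub>B\<^esub>"
  and source_mult: "\<lbrakk>x \<in> carrier R; y \<in> carrier R\<rbrakk> \<Longrightarrow> source B (x \<otimes>\<^bsub>R\<^esub> y) = source B x \<bullet> source B y"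
  and source_add: "\<lbrakk>x \<in> carrier R; y \<in> carrier R\<rbrakk> \<Longrightarrow> source B (x \<oplus>\<^bsub>R\<^esub> y) = source B x \<oplus>\<^bsub>B\<^esub> source B y"
  and source_scale: "x \<in> carrier R \<Longrightarrow> source B (c \<odot>\<^bsub>R\<^esub> x) = c \<odot>\<^bsub>B\<^esub> source B x"
  using source_hom by (auto simp: calgebra_hom_def clinear_map_def ring_hom_def)

lemma target_closed [simp]: "x \<in> carrier R \<Longrightarrow> target B x \<in> carrier B"
  and target_one [simp]: "target B \<one>\<^bsub>R\<^esub> = \<one>\<^bsub>B\<^esub>"
  using target_hom by (auto simp: calgebra_hom_def clinear_map_def ring_hom_def opp_def)

lemma counit_closed [simp]: "b \<in> carrier B \<Longrightarrow> counit B b \<in> carrier R"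
  and counit_add: "\<lbrakk>b \<in> carrier B; c \<in> carrier B\<rbrakk> \<Longrightarrow> counit B (b \<oplus>\<^bsub>B\<^esub> c) = counit B b \<oplus>\<^bsub>R\<^esub> counit B c"
  using counit_linear by (auto simp: clinear_map_def)

lemma source_right_module: "right_module R B (\<lambda>b x. b \<bullet> source B x)"
  by unfold_locales
     (auto simp: clinear_map_def source_add source_scale source_mult B.r_distr B.l_distr B.m_assoc
        B.smult_mult_left B.smult_mult_right)

sublocale BB: tensor_product R B "\<lambda>b x. b \<bullet> source B x" B "\<lambda>x b. b \<bullet> target B x"
  by unfold_locales (auto simp: B.smult_mult_left)

end

context left_bialgebroid
begin

abbreviation kmult (infixl \<open>\<star>\<close> 70) where "k \<star> k' \<equiv> k \<otimes>\<^bsub>K\<^esub> k'"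

lemma source_closed [simp]: "x \<in> carrier S \<Longrightarrow> source K x \<in> carrier K"
  and source_one [simp]: "source K \<one>\<^bsub>S\<^esub> = \<one>\<^bsub>K\<^esub>"
  and source_mult: "\<lbrakk>x \<in> carrier S; y \<in> carrier S\<rbrakk> \<Longrightarrow> source K (x \<otimes>\<^bsub>S\<^esub> y) = source K x \<star> source K y"
  and source_add: "\<lbrakk>x \<in> carrier S; y \<in> carrier S\<rbrakk> \<Longrightarrow> source K (x \<oplus>\<^bsub>S\<^esub> y) = source K x \<oplus>\<^bsub>K\<^esub> source K y"
  and source_scale: "x \<in> carrier S \<Longrightarrow> source K (c \<odot>\<^bsub>S\<^esub> x) = c \<odot>\<^bsub>K\<^esub> source K x"
  using source_hom by (auto simp: calgebra_hom_def clinear_map_def ring_hom_def)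

lemma target_closed [simp]: "x \<in> carrier S \<Longrightarrow> target K x \<in> carrier K"
  and target_one [simp]: "target K \<one>\<^bsub>S\<^esub> = \<one>\<^bsub>K\<^esub>"
  and target_mult: "\<lbrakk>x \<in> carrier S; y \<in> carrier S\<rbrakk> \<Longrightarrow> target K (x \<otimes>\<^bsub>S\<^esub> y) = target K y \<star> target K x"
  and target_add: "\<lbrakk>x \<in> carrier S; y \<in> carrier S\<rbrakk> \<Longrightarrow> target K (x \<oplus>\<^bsub>S\<^esub> y) = target K x \<oplus>\<^bsub>K\<^esub> target K y"
  using target_hom by (auto simp: calgebra_hom_def clinear_map_def ring_hom_def opp_def)

lemma counit_closed [simp]: "b \<in> carrier K \<Longrightarrow> counit K b \<in> carrier S"
  and counit_add: "\<lbrakk>b \<in> carrier K; c \<in> carrier K\<rbrakk> \<Longrightarrow> counit K (b \<oplus>\<^bsub>K\<^esub> c) = counit K b \<oplus>\<^bsub>S\<^esub> counit K c"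
  using counit_linear by (auto simp: clinear_map_def)

lemma source_left_module: "left_module S K (\<lambda>x k. source K x \<star> k)"
  by unfold_locales
     (auto simp: clinear_map_def source_add source_scale source_mult K.r_distr K.l_distr K.m_assoc
        K.smult_mult_left K.smult_mult_right)

sublocale KK: tensor_product S K "\<lambda>k x. target K x \<star> k" K "\<lambda>x k. source K x \<star> k"
  by unfold_locales (auto simp: K.smult_mult_right)

end

locale right_module_over = right_bialgebroid R B + M: right_module R M r
  for R B M r
begin

sublocale MB: iterated_tensor R M r B "\<lambda>x b. b \<bullet> target B x" R "\<lambda>x b. b \<bullet> source B x"
    B "\<lambda>x b. b \<bullet> target B x"
  by unfold_locales (auto simp: M.act_scale_left B.l_distr B.m_assoc ranges_commute)

end

locale right_comodule_over = right_module_over R B M r + comod: right_comodule R B M r \<rho>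
  for R B M r \<rho>
begin

lemma coact_closed [simp]: "m \<in> carrier M \<Longrightarrow> \<rho> m \<in> carrier MB.P"
  using clinear_mapD(1)[OF comod.coact_linear] by (simp add: rtensor_def)

lemma comult_closed [simp]: "b \<in> carrier B \<Longrightarrow> comult B b \<in> carrier BB.P"
  using clinear_mapD(1)[OF comult_linear] by (simp add: rtensor_def)

abbreviation coact_eval where "coact_eval m F \<equiv> MB.eval (\<rho> m) F"

abbreviation comult_eval where "comult_eval b F \<equiv> BB.eval (comult B b) F"

lemma coact_eval_plus:
  assumes "MB.bal F" "m \<in> carrier M" "m' \<in> carrier M"
  shows "coact_eval (m \<oplus>\<^bsub>M\<^esub> m') F = coact_eval m F + coact_eval m' F"
  using clinear_mapD(2)[OF comod.coact_linear assms(2,3)] assms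
  by (simp add: rtensor_def MB.eval_add)

lemma coact_eval_act:
  assumes "MB.bal F" "m \<in> carrier M" "x \<in> carrier R"
  shows "coact_eval (r m x) F = coact_eval m (\<lambda>n b. F n (b \<bullet> source B x))"
  using comod.coact_right_linear[OF assms(3,2)] assms
  by (simp add: rtensor_def MB.eval_sweedler MB.eval_pure)

lemma coact_eval_counit:
  assumes "additive_functional M p" "m \<in> carrier M"
  shows "coact_eval m (\<lambda>n b. p (r n (counit B b))) = p m"
  using MB.functional_sweedler[OF M.M.abelian_group_axioms assms(1) coact_closed[OF assms(2)],
      of "\<lambda>n b. r n (counit B b)"]
    comod.coact_counital[OF assms(2)] assms
  by simp

text \<open>\<open>G1\<close> and \<open>G2\<close> make \<open>G\<close> a functional on the triple
  tensor product, which is then applied to both sides of the coassociativity law.\<close>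

lemma coact_eval_coassoc:
  assumes m: "m \<in> carrier M"
    and G1: "\<And>c. c \<in> carrier B \<Longrightarrow> MB.bal (\<lambda>n b. G n b c)"
    and G2: "\<And>n. n \<in> carrier M \<Longrightarrow> BB.bal (G n)"
  shows "coact_eval m (\<lambda>n c. coact_eval n (\<lambda>u b. G u b c)) =
    coact_eval m (\<lambda>n b. comult_eval b (G n))"
proof -
  interpret Q: tensor_product R MB.P MB.ract2 B "\<lambda>x b. b \<bullet> target B x" by (rule MB.iterated)
  note F = MB.iterated_balanced[of "\<lambda>u b c. G u b c", OF G1 G2]
  let ?L = "sweedler Q.P (\<rho> m) (\<lambda>n b. \<rho> n \<boxtimes>\<^bsub>Q.P\<^esub> b)"
  let ?R = "sweedler Q.P (\<rho> m) (\<lambda>n b. sweedler Q.P (comult B b) (\<lambda>b1 b2. (n \<boxtimes>\<^bsub>MB.P\<^esub> b1) \<boxtimes>\<^bsub>Q.P\<^esub> b2))"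
  have "?L = ?R"
    using comod.coact_coassociative m by (simp add: right_coassociative_def rtensor2_def rtensor_def Let_def)
  moreover have "Q.eval ?L (\<lambda>X c. MB.eval X (\<lambda>n b. G n b c)) =
      coact_eval m (\<lambda>n c. coact_eval n (\<lambda>u b. G u b c))"
    using m F by (simp add: MB.eval_sweedler Q.eval_pure)
  moreover have "Q.eval ?R (\<lambda>X c. MB.eval X (\<lambda>n b. G n b c)) =
      coact_eval m (\<lambda>n b. comult_eval b (G n))"
    using m F
    by (simp add: MB.eval_sweedler BB.eval_sweedler
        Q.eval_pure MB.eval_pure G1)
  ultimately show ?thesis by simp
qed

end

locale left_comodule_over = left_bialgebroid S K + comod: left_comodule S K M l \<rho>
  for S K M l \<rho>
begin

sublocale KM: tensor_product S K "\<lambda>k x. target K x \<star> k" M l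
  by unfold_locales (auto simp: K.smult_mult_right)

lemma coact_closed [simp]: "m \<in> carrier M \<Longrightarrow> \<rho> m \<in> carrier KM.P"
  using clinear_mapD(1)[OF comod.coact_linear] by (simp add: ltensor_def)

lemma comult_closed [simp]: "k \<in> carrier K \<Longrightarrow> comult K k \<in> carrier KK.P"
  using clinear_mapD(1)[OF comult_linear] by (simp add: ltensor_def)

abbreviation coact_eval where "coact_eval m F \<equiv> KM.eval (\<rho> m) F"

abbreviation comult_eval where "comult_eval b F \<equiv> KK.eval (comult K b) F"

lemma coact_eval_plus:
  assumes "KM.bal F" "m \<in> carrier M" "m' \<in> carrier M"
  shows "coact_eval (m \<oplus>\<^bsub>M\<^esub> m') F = coact_eval m F + coact_eval m' F"
  using clinear_mapD(2)[OF comod.coact_linear assms(2,3)] assms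
  by (simp add: ltensor_def KM.eval_add)

lemma coact_eval_scale:
  assumes "KM.bal F" "m \<in> carrier M"
  shows "coact_eval (c \<odot>\<^bsub>M\<^esub> m) F = coact_eval m (\<lambda>k n. F (c \<odot>\<^bsub>K\<^esub> k) n)"
  using clinear_mapD(3)[OF comod.coact_linear assms(2)] assms
  by (simp add: ltensor_def KM.eval_scale)

lemma coact_eval_act:
  assumes "KM.bal F" "m \<in> carrier M" "x \<in> carrier S"
  shows "coact_eval (l x m) F = coact_eval m (\<lambda>k n. F (source K x \<star> k) n)"
  using comod.coact_left_linear[OF assms(3,2)] assms
  by (simp add: ltensor_def KM.eval_sweedler KM.eval_pure)

lemma coact_eval_counit:
  assumes "additive_functional M p" "m \<in> carrier M"
  shows "coact_eval m (\<lambda>k n. p (l (counit K k) n)) = p m"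
  using KM.functional_sweedler[OF comod.M.M.abelian_group_axioms assms(1) coact_closed[OF assms(2)],
      of "\<lambda>k n. l (counit K k) n"]
    comod.coact_counital[OF assms(2)] assms
  by simp

sublocale KK2: iterated_tensor S K "\<lambda>k x. target K x \<star> k" K "\<lambda>x k. source K x \<star> k"
    S "\<lambda>x k. target K x \<star> k" M l
  by unfold_locales (auto simp: K.r_distr K.m_assoc[symmetric] ranges_commute)

lemma coact_eval_coassoc:
  assumes m: "m \<in> carrier M"
    and G1: "\<And>n. n \<in> carrier M \<Longrightarrow> KK.bal (\<lambda>k k'. G k k' n)"
    and G2: "\<And>k. k \<in> carrier K \<Longrightarrow> KM.bal (G k)"
  shows "coact_eval m (\<lambda>k n. comult_eval k (\<lambda>k1 k2. G k1 k2 n)) =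
    coact_eval m (\<lambda>k n. coact_eval n (G k))"
proof -
  interpret Q: tensor_product S KK.P KK2.ract2 M l by (rule KK2.iterated)
  note F = KK2.iterated_balanced[of "\<lambda>u b c. G u b c", OF G1 G2]
  let ?L = "sweedler Q.P (\<rho> m) (\<lambda>k n. comult K k \<boxtimes>\<^bsub>Q.P\<^esub> n)"
  let ?R = "sweedler Q.P (\<rho> m) (\<lambda>k n. sweedler Q.P (\<rho> n) (\<lambda>k' n'. (k \<boxtimes>\<^bsub>KK.P\<^esub> k') \<boxtimes>\<^bsub>Q.P\<^esub> n'))"
  have "?L = ?R"
    using comod.coact_coassociative m by (simp add: left_coassociative_def ltensor2_def ltensor_def Let_def)
  moreover have "Q.eval ?L (\<lambda>X n. KK.eval X (\<lambda>k k'. G k k' n)) =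
      coact_eval m (\<lambda>k n. comult_eval k (\<lambda>k1 k2. G k1 k2 n))"
    using m F by (simp add: KM.eval_sweedler Q.eval_pure)
  moreover have "Q.eval ?R (\<lambda>X n. KK.eval X (\<lambda>k k'. G k k' n)) =
      coact_eval m (\<lambda>k n. coact_eval n (G k))"
    using m F
    by (simp add: KM.eval_sweedler
        Q.eval_pure KK.eval_pure G1)
  ultimately show ?thesis by simp
qed

end

text \<open>The regular comodule makes the lemmas on coactions available for the coproduct. Its
  right linearity is \<open>comult_bilinear\<close> with the unit as the other scalar.\<close>

lemma (in right_bialgebroid) self_comodule:
  "right_comodule_over R B B (\<lambda>b x. b \<bullet> source B x) (comult B)"
proof -
  interpret right_module R B "\<lambda>b x. b \<bullet> source B x" by (rule source_right_module)
  show ?thesis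
  proof unfold_locales
    fix x b assume x: "x \<in> carrier R" and b: "b \<in> carrier B"
    have c: "comult B b \<in> carrier BB.P" using clinear_mapD(1)[OF comult_linear b] by (simp add: rtensor_def)
    have "comult B (b \<bullet> source B x) = sweedler (rtensor_self R B) (comult B b)
        (\<lambda>a c. (a \<bullet> target B \<one>\<^bsub>R\<^esub>) \<boxtimes>\<^bsub>rtensor_self R B\<^esub> (c \<bullet> source B x))"
      using comult_bilinear[of "\<one>\<^bsub>R\<^esub>" x b] x b by simp
    also have "\<dots> = sweedler (rtensor_self R B) (comult B b)
        (\<lambda>a c. a \<boxtimes>\<^bsub>rtensor_self R B\<^esub> (c \<bullet> source B x))"
      unfolding rtensor_def
      using c x by (intro BB.tensor_eqI BB.sweedler_closed BB.tensor_abelian_group)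
        (auto simp: BB.eval_sweedler)
    finally show "comult B (b \<bullet> source B x) = sweedler (rtensor_self R B) (comult B b)
        (\<lambda>n c. n \<boxtimes>\<^bsub>rtensor_self R B\<^esub> (c \<bullet> source B x))" .
  qed (use comult_linear coassociative counit_right in auto)
qed

lemma (in left_bialgebroid) self_comodule:
  "left_comodule_over S K K (\<lambda>x k. source K x \<star> k) (comult K)"
proof -
  interpret left_module S K "\<lambda>x k. source K x \<star> k" by (rule source_left_module)
  show ?thesis
  proof unfold_locales
    fix x k assume x: "x \<in> carrier S" and k: "k \<in> carrier K"
    have c: "comult K k \<in> carrier KK.P" using clinear_mapD(1)[OF comult_linear k] by (simp add: ltensor_def)
    have "comult K (source K x \<star> k) = sweedler (ltensor_self S K) (comult K k)
        (\<lambda>a b. (source K x \<star> a) \<boxtimes>\<^bsub>ltensor_self S K\<^esub> (target K \<one>\<^bsub>S\<^esub> \<star> b))"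
      using comult_bilinear[of x "\<one>\<^bsub>S\<^esub>" k] x k by simp
    also have "\<dots> = sweedler (ltensor_self S K) (comult K k)
        (\<lambda>a b. (source K x \<star> a) \<boxtimes>\<^bsub>ltensor_self S K\<^esub> b)"
      unfolding ltensor_def
      using c x by (intro KK.tensor_eqI KK.sweedler_closed KK.tensor_abelian_group)
        (auto simp: KK.eval_sweedler)
    finally show "comult K (source K x \<star> k) = sweedler (ltensor_self S K) (comult K k)
        (\<lambda>a b. (source K x \<star> a) \<boxtimes>\<^bsub>ltensor_self S K\<^esub> b)" .
  qed (use comult_linear coassociative counit_left in auto)
qed

section \<open>The translation maps of Hopf algebroids\<close>

lemma carrier_opp [simp]: "carrier (opp A) = carrier A"
  by (simp add: opp_def)

context right_times_hopf
begin

sublocale self: right_comodule_over R B B "\<lambda>b x. b \<bullet> source B x" "comult B"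
  by (rule self_comodule)

abbreviation \<Delta> where "\<Delta> b F \<equiv> BB.eval (comult B b) F"

lemma comult_eval_mult:
  assumes "BB.bal F" "b \<in> carrier B" "b' \<in> carrier B"
  shows "\<Delta> (b \<bullet> b') F = \<Delta> b (\<lambda>a c. \<Delta> b' (\<lambda>a' c'. F (a \<bullet> a') (c \<bullet> c')))"
  unfolding comult_mult[OF assms(2,3)] rtensor_def using assms
  by (simp add: BB.eval_sweedler
      BB.eval_pure)

lemma comult_eval_takeuchi:
  assumes "BB.bal F" "b \<in> carrier B" "x \<in> carrier R"
  shows "\<Delta> b (\<lambda>a c. F a (target B x \<bullet> c)) = \<Delta> b (\<lambda>a c. F (source B x \<bullet> a) c)"
  using arg_cong[OF comult_takeuchi[OF assms(3,2)], of "\<lambda>X. BB.eval X F"] assms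
  by (simp add: rtensor_def BB.eval_sweedler BB.eval_pure)

lemma comult_eval_one: "BB.bal F \<Longrightarrow> \<Delta> \<one>\<^sub>B F = F \<one>\<^sub>B \<one>\<^sub>B"
  by (simp add: comult_one rtensor_def BB.eval_pure)

lemma comult_eval_target_right:
  assumes "BB.bal F" "b \<in> carrier B" "x \<in> carrier R"
  shows "\<Delta> (b \<bullet> target B x) F = \<Delta> b (\<lambda>a c. F (a \<bullet> target B x) c)"
  using arg_cong[OF comult_bilinear[of x "\<one>\<^bsub>R\<^esub>" b], of "\<lambda>X. BB.eval X F"] assms
  by (simp add: rtensor_def BB.eval_sweedler BB.eval_pure)

lemma balanced_mult_left:
  assumes F: "BB.bal F" and p: "p \<in> carrier B"
  shows "BB.bal (\<lambda>a c. F (p \<bullet> a) c)"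
  using p by (intro balanced_mapI) (simp_all add: balanced_mapD[OF F] B.r_distr B.m_assoc[symmetric])

lemma balanced_target_right:
  assumes F: "BB.bal F" and x: "x \<in> carrier R"
  shows "BB.bal (\<lambda>a c. F (a \<bullet> target B x) c)"
proof (intro balanced_mapI)
  fix a y c assume a: "a \<in> carrier B" "y \<in> carrier R" "c \<in> carrier B"
  then have "a \<bullet> source B y \<bullet> target B x = a \<bullet> target B x \<bullet> source B y"
    using x by (simp add: B.m_assoc ranges_commute)
  then show "F (a \<bullet> source B y \<bullet> target B x) c = F (a \<bullet> target B x) (c \<bullet> target B y)"
    using x a by (simp add: balanced_mapD[OF F])
qed (use x in \<open>simp_all add: balanced_mapD[OF F] B.l_distr\<close>)

text \<open>The coring axioms control \<open>b t(x)\<close>, not \<open>t(x) b\<close>. Here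
  \<open>t(x)\<close> is treated as a factor of a product, with coproduct
  \<open>t(x) (x) 1\<close>.\<close>

lemma comult_eval_target_left:
  assumes F: "BB.bal F" and b: "b \<in> carrier B" and x: "x \<in> carrier R"
  shows "\<Delta> (target B x \<bullet> b) F = \<Delta> b (\<lambda>a c. F (target B x \<bullet> a) c)"
proof -
  \<comment> \<open>Before the coproduct of \<open>t(x)\<close> can be inserted, the outer summand
    must be balanced; a scalar crosses by the Takeuchi property of the coproduct of
    \<open>b\<close>.\<close>
  have F': "BB.bal (\<lambda>a c. \<Delta> b (\<lambda>a' c'. F (a \<bullet> a') (c \<bullet> c')))"
  proof (intro balanced_mapI)
    fix a y c assume a: "a \<in> carrier B" "y \<in> carrier R" "c \<in> carrier B"
    have "BB.bal (\<lambda>a' c'. F (a \<bullet> a') (c \<bullet> c'))"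
      using a by (intro balanced_mapI)
        (simp_all add: balanced_mapD[OF F] B.r_distr B.m_assoc[symmetric])
    from comult_eval_takeuchi[OF this b a(2)]
    show "\<Delta> b (\<lambda>a' c'. F (a \<bullet> source B y \<bullet> a') (c \<bullet> c')) =
        \<Delta> b (\<lambda>a' c'. F (a \<bullet> a') (c \<bullet> target B y \<bullet> c'))"
      using a by (simp add: B.m_assoc)
  qed (simp_all add: balanced_mapD[OF F] B.l_distr tsum_add)
  have "\<Delta> (\<one>\<^sub>B \<bullet> target B x) (\<lambda>a c. \<Delta> b (\<lambda>a' c'. F (a \<bullet> a') (c \<bullet> c'))) =
      \<Delta> b (\<lambda>a' c'. F (target B x \<bullet> a') c')"
    using b x by (subst comult_eval_target_right[OF F'])
      (simp_all add: comult_eval_one[OF balanced_target_right[OF F']])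
  then show ?thesis
    using b x by (simp add: comult_eval_mult[OF F])
qed

sublocale BoB: tensor_product "opp R" B "\<lambda>b x. b \<bullet> target B x" B "\<lambda>x b. target B x \<bullet> b"
  by unfold_locales (auto simp: B.smult_mult_left)

abbreviation can where "can F \<equiv> (\<lambda>b b'. \<Delta> b' (\<lambda>a c. F (b \<bullet> a) c))"

lemma hopf_balanced:
  assumes F: "BB.bal F"
  shows "BoB.bal (can F)"
  by (intro balanced_mapI)
     (simp_all add: balanced_mapD[OF F] B.l_distr tsum_add self.coact_eval_plus balanced_mult_left[OF F]
       comult_eval_target_left B.m_assoc)

lemma hopf_map_closed: "X \<in> carrier BoB.P \<Longrightarrow> right_hopf_map R B X \<in> carrier BB.P"
  by (simp add: right_hopf_map_def rtensor_def Let_def)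

lemma hopf_map_eval:
  "\<lbrakk>X \<in> carrier BoB.P; BB.bal F\<rbrakk> \<Longrightarrow>
    BB.eval (right_hopf_map R B X) F = BoB.eval X (can F)"
  by (simp add: right_hopf_map_def rtensor_def Let_def BoB.eval_sweedler
      BB.eval_sweedler BB.eval_pure)

text \<open>Injectivity of the Hopf map in dual form: functionals pulled back along it separate the
  points of its domain.\<close>

lemma hopf_eqI:
  assumes "X \<in> carrier BoB.P" "Y \<in> carrier BoB.P"
    and "\<And>F. BB.bal F \<Longrightarrow> BoB.eval X (can F) =
      BoB.eval Y (can F)"
  shows "X = Y"
proof -
  have "right_hopf_map R B X = right_hopf_map R B Y"
    using assms by (intro BB.tensor_eqI) (simp_all add: hopf_map_closed hopf_map_eval)
  then show ?thesis
    using hopf_bij assms(1,2) by (auto simp: bij_betw_def right_hopf_domain_def dest: inj_onD)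
qed

abbreviation \<nu> where "\<nu> b F \<equiv> BoB.eval (right_translation R B b) F"

lemma right_translation_closed [simp]: "b \<in> carrier B \<Longrightarrow> right_translation R B b \<in> carrier BoB.P"
  and hopf_map_translation:
    "b \<in> carrier B \<Longrightarrow> right_hopf_map R B (right_translation R B b) = \<one>\<^sub>B \<boxtimes>\<^bsub>BB.P\<^esub> b"
proof -
  assume b: "b \<in> carrier B"
  have "\<one>\<^sub>B \<boxtimes>\<^bsub>BB.P\<^esub> b \<in> right_hopf_map R B ` carrier BoB.P"
    using hopf_bij b by (simp add: bij_betw_def right_hopf_domain_def rtensor_def)
  then show "right_translation R B b \<in> carrier BoB.P"
    "right_hopf_map R B (right_translation R B b) = \<one>\<^sub>B \<boxtimes>\<^bsub>BB.P\<^esub> b"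
    by (auto simp: right_translation_def right_hopf_domain_def rtensor_def f_inv_into_f intro: inv_into_into)
qed

text \<open>The defining equation of the inverse image:
  \<open>b^- b^{+1} (x) b^{+2} = 1 (x) b\<close>.\<close>

lemma translation_comult:
  assumes "BB.bal F" "b \<in> carrier B"
  shows "\<nu> b (can F) = F \<one>\<^sub>B b"
  using hopf_map_eval[OF right_translation_closed[OF assms(2)] assms(1)] assms
  by (simp add: hopf_map_translation BB.eval_pure)

text \<open>In Sweedler notation: \<open>b\<^sup>1 b\<^sup>2\<^sup>- \<otimes> b\<^sup>2\<^sup>+ = 1 \<otimes> b\<close>.\<close>

lemma comult_translation:
  assumes G: "BoB.bal G" and b: "b \<in> carrier B"
  shows "\<Delta> b (\<lambda>b1 b2. \<nu> b2 (\<lambda>p q. G (b1 \<bullet> p) q)) = G \<one>\<^sub>B b"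
proof -
  define Y where "Y = sweedler BoB.P (comult B b) (\<lambda>b1 b2.
    sweedler BoB.P (right_translation R B b2) (\<lambda>p q. (b1 \<bullet> p) \<boxtimes>\<^bsub>BoB.P\<^esub> q))"
  have Yc: "Y \<in> carrier BoB.P"
    using b by (simp add: Y_def)
  have Y: "BoB.eval Y G = \<Delta> b (\<lambda>b1 b2. \<nu> b2 (\<lambda>p q. G (b1 \<bullet> p) q))" if "BoB.bal G" for G
    using b that
    by (simp add: Y_def BB.eval_sweedler
        BoB.eval_sweedler
        BoB.eval_pure)
  have "Y = \<one>\<^sub>B \<boxtimes>\<^bsub>BoB.P\<^esub> b"
  proof (rule hopf_eqI[OF Yc])
    \<comment> \<open>The Hopf map sends both elements to the coproduct of \<open>b\<close>, since
      \<open>b^1 b^{2-} b^{2+1} (x) b^{2+2} = b^1 (x) b^2\<close>.\<close>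
    fix F assume F: "BB.bal F"
    show "BoB.eval Y (can F) =
        BoB.eval (\<one>\<^sub>B \<boxtimes>\<^bsub>BoB.P\<^esub> b) (can F)"
      using b F translation_comult[OF balanced_mult_left[OF F]]
      by (simp add: Y hopf_balanced BoB.eval_pure B.m_assoc)
  qed (use b in simp)
  then show ?thesis using Y[OF G] G b by (simp add: BoB.eval_pure)
qed

lemma translation_plus:
  assumes "BoB.bal G" "b \<in> carrier B" "b' \<in> carrier B"
  shows "\<nu> (b \<oplus>\<^bsub>B\<^esub> b') G = \<nu> b G + \<nu> b' G"
proof -
  have "right_translation R B (b \<oplus>\<^bsub>B\<^esub> b') =
      right_translation R B b \<oplus>\<^bsub>BoB.P\<^esub> right_translation R B b'"
    using assms
    by (intro hopf_eqI)
       (simp_all add: BoB.eval_add hopf_balanced translation_comult balanced_mapD(2))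
  then show ?thesis using assms by (simp add: BoB.eval_add)
qed

text \<open>\<open>X\<close> and \<open>Y\<close> are formed on the very representatives that
  \<open>tsum\<close> selects, so \<open>g\<close>, \<open>g'\<close> and \<open>h\<close> may act
  entry by entry. Once \<open>X = Y\<close> is known from pulled-back functionals, every balanced
  \<open>G\<close> can be applied.\<close>

lemma translation_eqI:
  assumes G: "BoB.bal G" and b: "b \<in> carrier B" "b' \<in> carrier B"
    and c: "\<And>p. p \<in> carrier B \<Longrightarrow> g p \<in> carrier B \<and> g' p \<in> carrier B \<and> h p \<in> carrier B"
    and eq: "\<And>F. BB.bal F \<Longrightarrow> \<nu> b' (\<lambda>p q. can F (g' p) q) = \<nu> b (\<lambda>p q. can F (g p) (h q))"
  shows "\<nu> b' (\<lambda>p q. G (g' p) q) = \<nu> b (\<lambda>p q. G (g p) (h q))"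
proof -
  define X where "X = sweedler BoB.P (right_translation R B b') (\<lambda>p q. g' p \<boxtimes>\<^bsub>BoB.P\<^esub> q)"
  define Y where "Y = sweedler BoB.P (right_translation R B b) (\<lambda>p q. g p \<boxtimes>\<^bsub>BoB.P\<^esub> h q)"
  have X: "BoB.eval X G = \<nu> b' (\<lambda>p q. G (g' p) q)" and Y: "BoB.eval Y G = \<nu> b (\<lambda>p q. G (g p) (h q))"
    if "BoB.bal G" for G
    using b that by (simp_all add: X_def Y_def c BoB.eval_sweedler BoB.eval_pure)
  have "X = Y"
    by (rule hopf_eqI) (simp_all add: X Y hopf_balanced eq, use b in \<open>simp_all add: X_def Y_def c\<close>)
  then show ?thesis using X[OF G] Y[OF G] by simp
qed

text \<open>Under the Hopf map both sides become \<open>s(x) (x) b = 1 (x) b t(x)\<close>.\<close>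

lemma translation_mult_target:
  assumes G: "BoB.bal G" and b: "b \<in> carrier B" and x: "x \<in> carrier R"
  shows "\<nu> (b \<bullet> target B x) G = \<nu> b (\<lambda>p q. G (source B x \<bullet> p) q)"
proof (rule translation_eqI[OF G b, where g' = "\<lambda>p. p"])
  fix F assume F: "BB.bal F"
  show "\<nu> (b \<bullet> target B x) (\<lambda>p q. can F p q) = \<nu> b (\<lambda>p q. can F (source B x \<bullet> p) q)"
    using b x F translation_comult[OF balanced_mult_left[OF F, of "source B x"] b]
      balanced_mapD(3)[OF F, of "\<one>\<^sub>B" x b]
    by (simp add: translation_comult B.m_assoc)
qed (use b x in simp_all)

text \<open>The Hopf map sends both \<open>b^- (x) b^+ t(x)\<close> and
  \<open>t(x) b^- (x) b^+\<close> to \<open>t(x) (x) b\<close>.\<close>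

lemma translation_target:
  assumes G: "BoB.bal G" and b: "b \<in> carrier B" and x: "x \<in> carrier R"
  shows "\<nu> b (\<lambda>p q. G p (q \<bullet> target B x)) = \<nu> b (\<lambda>p q. G (target B x \<bullet> p) q)"
proof (rule translation_eqI[OF G b b, symmetric])
  fix F assume F: "BB.bal F"
  show "\<nu> b (\<lambda>p q. can F (target B x \<bullet> p) q) = \<nu> b (\<lambda>p q. can F p (q \<bullet> target B x))"
    using b x F translation_comult[OF balanced_mult_left[OF F, of "target B x"] b]
      translation_comult[OF balanced_target_right[OF F x] b]
    by (simp add: comult_eval_target_right balanced_mult_left B.m_assoc)
qed (use b x in simp_all)

end

context left_times_hopf
begin

sublocale self: left_comodule_over S K K "\<lambda>x k. source K x \<star> k" "comult K"
  by (rule self_comodule)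

abbreviation \<Delta> where "\<Delta> k F \<equiv> KK.eval (comult K k) F"

lemma comult_eval_takeuchi:
  assumes "KK.bal F" "k \<in> carrier K" "x \<in> carrier S"
  shows "\<Delta> k (\<lambda>a b. F (a \<star> target K x) b) = \<Delta> k (\<lambda>a b. F a (b \<star> source K x))"
  using arg_cong[OF comult_takeuchi[OF assms(3,2)], of "\<lambda>X. KK.eval X F"] assms
  by (simp add: ltensor_def KK.eval_sweedler KK.eval_pure)

lemma comult_eval_one: "KK.bal F \<Longrightarrow> \<Delta> \<one>\<^bsub>K\<^esub> F = F \<one>\<^bsub>K\<^esub> \<one>\<^bsub>K\<^esub>"
  by (simp add: comult_one ltensor_def KK.eval_pure)

lemma comult_eval_source_target:
  assumes "KK.bal F" "x \<in> carrier S" "y \<in> carrier S" "k \<in> carrier K"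
  shows "\<Delta> (source K x \<star> target K y \<star> k) F =
    \<Delta> k (\<lambda>a b. F (source K x \<star> a) (target K y \<star> b))"
  unfolding comult_bilinear[OF assms(2-4)] ltensor_def using assms
  by (simp add: KK.eval_sweedler KK.eval_pure)

lemma balanced_source_target:
  assumes F: "KK.bal F" and x: "x \<in> carrier S" "y \<in> carrier S"
  shows "KK.bal (\<lambda>a b. F (source K x \<star> a) (target K y \<star> b))"
proof (intro balanced_mapI)
  fix a z b assume a: "a \<in> carrier K" "z \<in> carrier S" "b \<in> carrier K"
  then have "source K x \<star> (target K z \<star> a) = target K z \<star> (source K x \<star> a)"
    "target K y \<star> (source K z \<star> b) = source K z \<star> (target K y \<star> b)"
    using x by (simp_all add: K.m_assoc[symmetric] ranges_commute)
  then show "F (source K x \<star> (target K z \<star> a)) (target K y \<star> b) =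
      F (source K x \<star> a) (target K y \<star> (source K z \<star> b))"
    using x a by (simp add: balanced_mapD[OF F])
qed (use x in \<open>simp_all add: balanced_mapD[OF F] K.r_distr\<close>)

lemma comult_eval_source:
  assumes "KK.bal F" "x \<in> carrier S"
  shows "\<Delta> (source K x) F = F (source K x) \<one>\<^bsub>K\<^esub>"
  using comult_eval_source_target[OF assms(1), of x "\<one>\<^bsub>S\<^esub>" "\<one>\<^bsub>K\<^esub>"] assms
    comult_eval_one[OF balanced_source_target[OF assms(1), of x "\<one>\<^bsub>S\<^esub>"]]
  by simp

lemma comult_eval_counit_right:
  assumes "additive_functional K p" "k \<in> carrier K"
  shows "\<Delta> k (\<lambda>a b. p (target K (counit K b) \<star> a)) = p k"
  using KK.functional_sweedler[OF K.abelian_group_axioms assms(1) self.comult_closed[OF assms(2)],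
      of "\<lambda>a b. target K (counit K b) \<star> a"]
    counit_right[OF assms(2)] assms
  by simp

sublocale KoK: tensor_product "opp S" K "\<lambda>k x. k \<star> target K x" K "\<lambda>x k. target K x \<star> k"
  by unfold_locales (auto simp: K.smult_mult_left)

abbreviation \<nu> where "\<nu> k F \<equiv> KoK.eval (left_translation S K k) F"

lemma left_translation_closed [simp]: "k \<in> carrier K \<Longrightarrow> left_translation S K k \<in> carrier KoK.P"
  and hopf_map_translation:
    "k \<in> carrier K \<Longrightarrow> left_hopf_map S K (left_translation S K k) = k \<boxtimes>\<^bsub>KK.P\<^esub> \<one>\<^bsub>K\<^esub>"
proof -
  assume k: "k \<in> carrier K"
  have "k \<boxtimes>\<^bsub>KK.P\<^esub> \<one>\<^bsub>K\<^esub> \<in> left_hopf_map S K ` carrier KoK.P"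
    using hopf_bij k by (simp add: bij_betw_def left_hopf_domain_def ltensor_def)
  then show "left_translation S K k \<in> carrier KoK.P"
    "left_hopf_map S K (left_translation S K k) = k \<boxtimes>\<^bsub>KK.P\<^esub> \<one>\<^bsub>K\<^esub>"
    by (auto simp: left_translation_def left_hopf_domain_def ltensor_def f_inv_into_f intro: inv_into_into)
qed

text \<open>The defining equation \<open>k^{-1} (x) k^{-2} k^+ = k (x) 1\<close>, where the upper
  digits number the factors of the coproduct of \<open>k^-\<close>. Through it the translation map
  of K enters the anti Yetter-Drinfeld computation.\<close>

lemma translation_comult:
  assumes F: "KK.bal F" and k: "k \<in> carrier K"
  shows "\<nu> k (\<lambda>p q. \<Delta> p (\<lambda>a b. F a (b \<star> q))) = F k \<one>\<^bsub>K\<^esub>"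
proof -
  have "KK.eval (left_hopf_map S K (left_translation S K k)) F =
      \<nu> k (\<lambda>p q. \<Delta> p (\<lambda>a b. F a (b \<star> q)))"
    using F k
    by (simp add: left_hopf_map_def ltensor_def Let_def KoK.eval_sweedler
      KK.eval_sweedler KK.eval_pure)
  then show ?thesis using F k by (simp add: hopf_map_translation KK.eval_pure)
qed

end

section \<open>Equivariant Galois extensions\<close>

context equivariant_galois
begin

sublocale co: right_comodule_over R B T r \<rho> ..

sublocale TT: tensor_product S T "\<lambda>t x. act (target K x) t" T "\<lambda>x t. act (source K x) t"
  by unfold_locales (auto simp: modalg.mod.act_scale_right)

abbreviation oneT (\<open>\<one>\<^sub>T\<close>) where "oneT \<equiv> \<one>\<^bsub>T\<^esub>"

abbreviation tmult (infixl \<open>\<cdot>\<close> 70) where "t \<cdot> u \<equiv> t \<otimes>\<^bsub>T\<^esub> u"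

abbreviation \<Gamma> where "\<Gamma> t F \<equiv> co.MB.eval (\<rho> t) F"

text \<open>The structure map from S to \<open>T\<close> of the module algebra:
  \<open>source K x\<close> and \<open>target K x\<close> turn out to act as left and right
  multiplication by \<open>\<phi> x\<close>. Although S sits inside \<open>T\<close>, no axiom says
  that \<open>\<phi>\<close> is the inclusion.\<close>

definition \<phi> where "\<phi> x = act (source K x) \<one>\<^sub>T"

lemma phi_closed [simp]: "x \<in> carrier S \<Longrightarrow> \<phi> x \<in> carrier T"
  by (simp add: \<phi>_def)

lemmas T_linear = comodalg.T.l_distr comodalg.T.r_distr modalg.mod.act_add_left modalg.mod.act_add_right
  comodalg.bimod.right.act_add_left comodalg.bimod.right.act_add_right comodalg.bimod.left.act_add_left
  comodalg.bimod.left.act_add_right B.B.l_distr B.B.r_distr tsum_add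

lemma act_prod_balanced:
  assumes p: "additive_functional T p" and t: "t \<in> carrier T" "u \<in> carrier T"
  shows "K.KK.bal (\<lambda>a b. p (act a t \<cdot> act b u))"
  using t by (intro balanced_mapI)
    (simp_all add: T_linear additive_functionalD[OF p] modalg.mod.act_mult modalg.act_target_source)

lemma act_prod_eval:
  assumes p: "additive_functional T p" and k: "k \<in> carrier K" and t: "t \<in> carrier T" "u \<in> carrier T"
  shows "p (act k (t \<cdot> u)) = K.\<Delta> k (\<lambda>a b. p (act a t \<cdot> act b u))"
  unfolding modalg.act_product[OF k t] using k t
  by (intro K.KK.functional_sweedler comodalg.T.abelian_group_axioms p) simp_all

text \<open>The coproduct of \<open>s(x)\<close> is \<open>s(x) (x) 1\<close>; apply the module
  algebra law to the product \<open>1 t\<close>.\<close>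

lemma act_source:
  assumes x: "x \<in> carrier S" and t: "t \<in> carrier T"
  shows "act (source K x) t = \<phi> x \<cdot> t"
proof (rule comodalg.T.space.functionals_separate)
  fix p assume p: "additive_functional T p"
  have "p (act (source K x) (\<one>\<^sub>T \<cdot> t)) = p (act (source K x) \<one>\<^sub>T \<cdot> act \<one>\<^bsub>K\<^esub> t)"
    using x t by (simp only: act_prod_eval[OF p] K.comult_eval_source act_prod_balanced[OF p]
      comodalg.T.one_closed K.source_closed)
  then show "p (act (source K x) t) = p (\<phi> x \<cdot> t)" using t by (simp add: modalg.mod.act_one \<phi>_def)
qed (use x t in simp_all)

lemma act_target:
  assumes x: "x \<in> carrier S" and t: "t \<in> carrier T"
  shows "act (target K x) t = t \<cdot> \<phi> x"
  using modalg.act_target_source[OF x t comodalg.T.one_closed] x t by (simp add: act_source)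

lemma TT_balancedI:
  assumes "\<And>t t' u. \<lbrakk>t \<in> carrier T; t' \<in> carrier T; u \<in> carrier T\<rbrakk> \<Longrightarrow> G (t \<oplus>\<^bsub>T\<^esub> t') u = G t u + G t' u"
    and "\<And>t u u'. \<lbrakk>t \<in> carrier T; u \<in> carrier T; u' \<in> carrier T\<rbrakk> \<Longrightarrow> G t (u \<oplus>\<^bsub>T\<^esub> u') = G t u + G t u'"
    and "\<And>t x u. \<lbrakk>t \<in> carrier T; x \<in> carrier S; u \<in> carrier T\<rbrakk> \<Longrightarrow> G t (\<phi> x \<cdot> u) = G (t \<cdot> \<phi> x) u"
  shows "TT.bal G"
  by (intro balanced_mapI) (simp_all add: assms act_source act_target)

lemma TT_balancedD:
  assumes "TT.bal G"
  shows "\<And>t t' u. \<lbrakk>t \<in> carrier T; t' \<in> carrier T; u \<in> carrier T\<rbrakk> \<Longrightarrow> G (t \<oplus>\<^bsub>T\<^esub> t') u = G t u + G t' u"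
    and "\<And>t u u'. \<lbrakk>t \<in> carrier T; u \<in> carrier T; u' \<in> carrier T\<rbrakk> \<Longrightarrow> G t (u \<oplus>\<^bsub>T\<^esub> u') = G t u + G t u'"
    and "\<And>t x u. \<lbrakk>t \<in> carrier T; x \<in> carrier S; u \<in> carrier T\<rbrakk> \<Longrightarrow> G t (\<phi> x \<cdot> u) = G (t \<cdot> \<phi> x) u"
  using balanced_mapD[OF assms] by (simp_all add: act_source[symmetric] act_target[symmetric])

section \<open>Structure of \<open>T\<close> forced by the independence of representatives\<close>

lemma coact_mult_reps:
  assumes F: "co.MB.bal F" and t: "t \<in> carrier T" "u \<in> carrier T" "xs \<in> \<rho> t" "ys \<in> \<rho> u"
  shows "\<Gamma> (t \<cdot> u) F = list_total xs (\<lambda>t0 t1. list_total ys (\<lambda>u0 u1. F (t0 \<cdot> u0) (t1 \<bullet> u1)))"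
proof -
  note L = co.MB.rep_in_lists[OF co.coact_closed[OF t(1)] t(3)] co.MB.rep_in_lists[OF co.coact_closed[OF t(2)] t(4)]
  let ?s = "\<lambda>t0 t1. sum_over co.MB.P ys (\<lambda>u0 u1. t0 \<cdot> u0 \<boxtimes>\<^bsub>co.MB.P\<^esub> (t1 \<bullet> u1))"
  note ev = co.MB.sum_over_functional[OF co.MB.tensor_abelian_group co.MB.functional_of_balanced[OF F]]
  have c: "?s t0 t1 \<in> carrier co.MB.P" if "t0 \<in> carrier T" "t1 \<in> carrier B" for t0 t1
    using that by (intro ev(1)[OF L(2)]) simp
  have e: "co.MB.eval (?s t0 t1) F = list_total ys (\<lambda>u0 u1. F (t0 \<cdot> u0) (t1 \<bullet> u1))"
    if "t0 \<in> carrier T" "t1 \<in> carrier B" for t0 t1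
  proof -
    have "co.MB.eval (?s t0 t1) F = list_total ys (\<lambda>u0 u1. co.MB.eval (t0 \<cdot> u0 \<boxtimes>\<^bsub>co.MB.P\<^esub> (t1 \<bullet> u1)) F)"
      using that by (intro ev(2)[OF L(2)]) simp
    also have "\<dots> = list_total ys (\<lambda>u0 u1. F (t0 \<cdot> u0) (t1 \<bullet> u1))"
      using that by (intro list_total_cong[OF L(2)]) (simp add: co.MB.eval_pure F)
    finally show ?thesis .
  qed
  have "\<Gamma> (t \<cdot> u) F = list_total xs (\<lambda>t0 t1. co.MB.eval (?s t0 t1) F)"
    unfolding comodalg.coact_mult[OF t] rtensor_def by (rule ev(2)[OF L(1) c])
  also have "\<dots> = list_total xs (\<lambda>t0 t1. list_total ys (\<lambda>u0 u1. F (t0 \<cdot> u0) (t1 \<bullet> u1)))"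
    by (rule list_total_cong[OF L(1) e])
  finally show ?thesis .
qed

lemma some_rep_coact: "t \<in> carrier T \<Longrightarrow> (SOME xs. xs \<in> \<rho> t) \<in> \<rho> t"
  using co.MB.some_rep[OF co.coact_closed] co.MB.cls_self[of "SOME xs. xs \<in> \<rho> t"] by simp

lemma coact_eval_mult:
  assumes F: "co.MB.bal F" and t: "t \<in> carrier T" "u \<in> carrier T"
  shows "\<Gamma> (t \<cdot> u) F = \<Gamma> t (\<lambda>t0 t1. \<Gamma> u (\<lambda>u0 u1. F (t0 \<cdot> u0) (t1 \<bullet> u1)))"
  using coact_mult_reps[OF F t some_rep_coact[OF t(1)] some_rep_coact[OF t(2)]] t
  by (simp add: co.MB.eval_some)

lemma list_total_some: "t \<in> carrier T \<Longrightarrow> list_total (SOME xs. xs \<in> \<rho> t) F = \<Gamma> t F"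
  by (simp add: co.MB.eval_some)

lemma coact_eval_one: "co.MB.bal F \<Longrightarrow> \<Gamma> \<one>\<^sub>T F = F \<one>\<^sub>T \<one>\<^sub>B"
  by (simp add: comodalg.coact_one rtensor_def co.MB.eval_pure)

lemma repI:
  assumes "xs \<in> co.MB.Ls" "X \<in> carrier co.MB.P"
    "\<And>F. co.MB.bal F \<Longrightarrow> list_total xs F = co.MB.eval X F"
  shows "xs \<in> X"
proof -
  have "co.MB.cls xs = X" using assms by (intro co.MB.tensor_eqI) (simp_all add: co.MB.eval_cls)
  then show ?thesis using co.MB.cls_self[OF assms(1)] by simp
qed

lemma balanced_minus:
  assumes "co.MB.bal F" "t \<in> carrier T" "b \<in> carrier B"
  shows "F t (\<ominus>\<^bsub>B\<^esub> b) = - F t b"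
proof -
  have "additive_functional B (F t)"
    using assms by (auto simp: additive_functional_def balanced_mapD)
  from B.B.additive_functional_minus[OF this B.B.zero_closed assms(3)]
    B.B.additive_functional_zero[OF this] show ?thesis
    using assms by (simp add: a_minus_def)
qed

lemma lact_eq: "\<lbrakk>x \<in> carrier R; t \<in> carrier T\<rbrakk> \<Longrightarrow> l x t = r \<one>\<^sub>T x \<cdot> t"
  using comodalg.balanced[of x "\<one>\<^sub>T" t] by simp

text \<open>The Takeuchi property of the coaction, hidden in the coaction of \<open>1t\<close> computed through a
  second representative of \<open>\<rho> 1\<close>.\<close>

lemma coact_eval_takeuchi:
  assumes F: "co.MB.bal F" and t: "t \<in> carrier T" and x: "x \<in> carrier R"
  shows "\<Gamma> t (\<lambda>t0 t1. F t0 (target B x \<bullet> t1)) = \<Gamma> t (\<lambda>t0 t1. F (l x t0) t1)"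
proof -
  \<comment> \<open>The first and third entries cancel because \<open>1x (x) 1 = 1 (x) t(x)\<close>,
    so the list represents the coaction of 1. Multiplied into the coaction of \<open>t\<close>, they
    give the difference of the two sides, which therefore vanishes.\<close>
  let ?xs = "[(r \<one>\<^sub>T x, \<one>\<^sub>B), (\<one>\<^sub>T, \<one>\<^sub>B), (\<one>\<^sub>T, \<ominus>\<^bsub>B\<^esub> target B x)]"
  have L: "(SOME ys. ys \<in> \<rho> t) \<in> co.MB.Ls" using t by (simp add: co.MB.some_rep)
  have "?xs \<in> \<rho> \<one>\<^sub>T"
    by (rule repI) (use x in \<open>simp_all add: coact_eval_one balanced_mapD balanced_minus\<close>)
  from coact_mult_reps[OF F _ t this some_rep_coact[OF t]]
  have "\<Gamma> t F = list_total (SOME xs. xs \<in> \<rho> t) (\<lambda>u0 u1. F (r \<one>\<^sub>T x \<cdot> u0) (\<one>\<^sub>B \<bullet> u1)) +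
      list_total (SOME xs. xs \<in> \<rho> t) (\<lambda>u0 u1. F (\<one>\<^sub>T \<cdot> u0) (\<one>\<^sub>B \<bullet> u1)) +
      list_total (SOME xs. xs \<in> \<rho> t) (\<lambda>u0 u1. F (\<one>\<^sub>T \<cdot> u0) (\<ominus>\<^bsub>B\<^esub> target B x \<bullet> u1))"
    using t by simp
  also have "\<dots> = \<Gamma> t (\<lambda>u0 u1. F (r \<one>\<^sub>T x \<cdot> u0) (\<one>\<^sub>B \<bullet> u1)) +
      \<Gamma> t (\<lambda>u0 u1. F (\<one>\<^sub>T \<cdot> u0) (\<one>\<^sub>B \<bullet> u1)) +
      \<Gamma> t (\<lambda>u0 u1. F (\<one>\<^sub>T \<cdot> u0) (\<ominus>\<^bsub>B\<^esub> target B x \<bullet> u1))"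
    using t by (simp only: list_total_some)
  also have "\<dots> = \<Gamma> t (\<lambda>u0 u1. F (l x u0) u1) + \<Gamma> t F +
      \<Gamma> t (\<lambda>u0 u1. F u0 (\<ominus>\<^bsub>B\<^esub> (target B x \<bullet> u1)))"
    using x by (simp add: lact_eq B.B.l_minus)
  finally have "0 = \<Gamma> t (\<lambda>u0 u1. F (l x u0) u1) + \<Gamma> t (\<lambda>u0 u1. F u0 (\<ominus>\<^bsub>B\<^esub> (target B x \<bullet> u1)))"
    by simp
  moreover have "\<Gamma> t (\<lambda>u0 u1. F u0 (\<ominus>\<^bsub>B\<^esub> (target B x \<bullet> u1))) + \<Gamma> t (\<lambda>u0 u1. F u0 (target B x \<bullet> u1)) =
      \<Gamma> t (\<lambda>u0 u1. 0)"
    unfolding tsum_add[symmetric] using F x by (simp add: balanced_minus)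
  moreover have "\<Gamma> t (\<lambda>u0 u1. 0) = 0"
    using tsum_add[of "carrier T" "carrier B" "\<rho> t" "\<lambda>_ _. 0" "\<lambda>_ _. 0"] by simp
  ultimately show ?thesis by (simp add: add_eq_0_iff)
qed

lemma counit_target_right:
  "\<lbrakk>b \<in> carrier B; x \<in> carrier R\<rbrakk> \<Longrightarrow> counit B (b \<bullet> target B x) = x \<otimes>\<^bsub>R\<^esub> counit B b"
  using B.counit_bilinear[of x "\<one>\<^bsub>R\<^esub>" b] by simp

lemma counit_balanced:
  assumes "additive_functional T p"
  shows "co.MB.bal (\<lambda>n b. p (r n (counit B b)))"
  by (intro balanced_mapI)
     (simp_all add: T_linear additive_functionalD[OF assms] B.counit_add counit_target_right
       comodalg.bimod.right.act_mult)

text \<open>The coaction of \<open>t (u x)\<close> is computed through a representative that shows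
  \<open>x\<close> at the far right of the second factor. There it acts on the whole product, and
  the counit translates the result back to \<open>T\<close>.\<close>

lemma ract_mult:
  assumes t: "t \<in> carrier T" "u \<in> carrier T" and x: "x \<in> carrier R"
  shows "r (t \<cdot> u) x = t \<cdot> r u x"
proof (rule comodalg.T.space.functionals_separate)
  fix p assume p: "additive_functional T p"
  define F where "F = (\<lambda>n b. p (r n (counit B b)))"
  have F: "co.MB.bal F" unfolding F_def by (rule counit_balanced[OF p])
  let ?ys = "SOME ys. ys \<in> \<rho> u"
  \<comment> \<open>The right linearity of the coaction, read as a concrete representative of the
    coaction of \<open>u x\<close>.\<close>
  let ?zs = "map (\<lambda>(n, b). (n, b \<bullet> source B x)) ?ys"
  have L: "?ys \<in> co.MB.Ls" using t by (simp add: co.MB.some_rep)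
  have "map (\<lambda>(n, b). (n, b \<bullet> source B x)) ys \<in> co.MB.Ls" if "ys \<in> co.MB.Ls" for ys
    using that x by (induction ys) auto
  then have Lz: "?zs \<in> co.MB.Ls" using L by blast
  have tot: "list_total (map (\<lambda>(n, b). (n, b \<bullet> source B x)) ys) G =
      list_total ys (\<lambda>n b. G n (b \<bullet> source B x))" for G ys
    by (induction ys) auto
  have "?zs \<in> \<rho> (r u x)"
    by (rule repI) (use Lz t x in \<open>simp_all add: tot co.coact_eval_act list_total_some\<close>)
  from coact_mult_reps[OF F t(1) _ some_rep_coact[OF t(1)] this]
  have "\<Gamma> (t \<cdot> r u x) F = list_total (SOME xs. xs \<in> \<rho> t)
      (\<lambda>t0 t1. list_total ?ys (\<lambda>u0 u1. F (t0 \<cdot> u0) (t1 \<bullet> (u1 \<bullet> source B x))))"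
    using t x by (simp add: tot)
  also have "\<dots> = \<Gamma> t (\<lambda>t0 t1. \<Gamma> u (\<lambda>u0 u1. F (t0 \<cdot> u0) (t1 \<bullet> u1 \<bullet> source B x)))"
    using t x by (simp add: list_total_some B.B.m_assoc)
  also have "\<dots> = \<Gamma> (r (t \<cdot> u) x) F"
    using t x F by (simp add: co.coact_eval_act coact_eval_mult co.MB.balanced_slot)
  finally show "p (r (t \<cdot> u) x) = p (t \<cdot> r u x)"
    using t x unfolding F_def by (simp add: co.coact_eval_counit p)
qed (use t x in simp_all)

lemma lact_mult:
  "\<lbrakk>x \<in> carrier R; t \<in> carrier T; u \<in> carrier T\<rbrakk> \<Longrightarrow> l x (t \<cdot> u) = l x t \<cdot> u"
  by (simp add: lact_eq comodalg.T.m_assoc)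

lemmas T_assoc = comodalg.T.m_assoc ract_mult comodalg.balanced lact_mult comodalg.bimod.actions_commute

lemma equivariant_reps:
  assumes F: "co.MB.bal F" and k: "k \<in> carrier K" and t: "t \<in> carrier T" "xs \<in> \<rho> t"
  shows "\<Gamma> (act k t) F = list_total xs (\<lambda>t0 t1. F (act k t0) t1)"
proof -
  note L = co.MB.rep_in_lists[OF co.coact_closed[OF t(1)] t(2)]
  have "\<Gamma> (act k t) F = list_total xs (\<lambda>t0 t1. co.MB.eval (act k t0 \<boxtimes>\<^bsub>co.MB.P\<^esub> t1) F)"
    unfolding equivariant[OF k t] rtensor_def using k
    by (intro co.MB.sum_over_functional(2)[OF co.MB.tensor_abelian_group co.MB.functional_of_balanced[OF F] L]) simp
  also have "\<dots> = list_total xs (\<lambda>t0 t1. F (act k t0) t1)"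
    using k by (intro list_total_cong[OF L]) (simp add: co.MB.eval_pure F)
  finally show ?thesis .
qed

text \<open>The pair \<open>(t x, 1)\<close>, \<open>(t, - t(x))\<close> cancels in the tensor
  product. Equivariance holds with and without this padding, so the pair still cancels after
  \<open>k\<close> has acted on the left entries; the counit extracts the claim.\<close>

lemma act_ract:
  assumes k: "k \<in> carrier K" and t: "t \<in> carrier T" and x: "x \<in> carrier R"
  shows "act k (r t x) = r (act k t) x"
proof (rule comodalg.T.space.functionals_separate)
  fix p assume p: "additive_functional T p"
  define F where "F = (\<lambda>n b. p (r n (counit B b)))"
  have F: "co.MB.bal F" unfolding F_def by (rule counit_balanced[OF p])
  let ?xs = "SOME xs. xs \<in> \<rho> t"
  let ?ys = "[(r t x, \<one>\<^sub>B), (t, \<ominus>\<^bsub>B\<^esub> target B x)] @ ?xs"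
  have L: "?xs \<in> co.MB.Ls" using t by (simp add: co.MB.some_rep)
  have "?ys \<in> \<rho> t"
    by (rule repI) (use L t x in \<open>simp_all add: balanced_mapD balanced_minus list_total_some\<close>)
  from equivariant_reps[OF F k t this] equivariant_reps[OF F k t some_rep_coact[OF t]]
  have "F (act k (r t x)) \<one>\<^sub>B + F (act k t) (\<ominus>\<^bsub>B\<^esub> target B x) = 0" by simp
  then have "F (act k (r t x)) \<one>\<^sub>B = F (act k t) (target B x)"
    using F k t x by (simp add: balanced_minus)
  moreover have "counit B (target B x) = x"
    using counit_target_right[of "\<one>\<^sub>B" x] x by (simp add: B.counit_one)
  ultimately show "p (act k (r t x)) = p (r (act k t) x)"
    using k t x by (simp add: F_def B.counit_one comodalg.bimod.right.act_one)
qed (use k t x in simp_all)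

lemma balanced_act:
  assumes F: "co.MB.bal F" and k: "k \<in> carrier K"
  shows "co.MB.bal (\<lambda>n b. F (act k n) b)"
  using k by (intro balanced_mapI) (simp_all add: T_linear balanced_mapD[OF F] act_ract)

lemma coact_eval_equivariant:
  assumes "co.MB.bal F" "k \<in> carrier K" "t \<in> carrier T"
  shows "\<Gamma> (act k t) F = \<Gamma> t (\<lambda>t0 t1. F (act k t0) t1)"
  using equivariant_reps[OF assms some_rep_coact[OF assms(3)]] assms
  by (simp add: co.MB.eval_some)

lemma balanced_target_left:
  assumes F: "co.MB.bal F" and x: "x \<in> carrier R"
  shows "co.MB.bal (\<lambda>n b. F n (target B x \<bullet> b))"
  using x by (intro balanced_mapI) (simp_all add: T_linear balanced_mapD[OF F] B.B.m_assoc)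

text \<open>The Takeuchi property and the counit law express the left action by the coaction,
  \<open>x t = t_0 eps(t(x) t_1)\<close>, and \<open>k\<close> passes through this expression by
  equivariance.\<close>

lemma act_lact:
  assumes k: "k \<in> carrier K" and t: "t \<in> carrier T" and x: "x \<in> carrier R"
  shows "act k (l x t) = l x (act k t)"
proof (rule comodalg.T.space.functionals_separate)
  fix p assume p: "additive_functional T p"
  have p1: "additive_functional T (\<lambda>y. p (l x y))" and p2: "additive_functional T (\<lambda>y. p (act k (l x y)))"
    and p3: "additive_functional T (\<lambda>y. p (act k y))"
    using p k x by (simp_all add: additive_functional_def T_linear)
  have F: "co.MB.bal (\<lambda>n b. p (r n (counit B b)))" "co.MB.bal (\<lambda>n b. p (act k (r n (counit B b))))"
    using counit_balanced[OF p] counit_balanced[OF p3] .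
  have "p (l x (act k t)) = \<Gamma> (act k t) (\<lambda>n b. p (l x (r n (counit B b))))"
    using co.coact_eval_counit[OF p1, of "act k t"] k t by simp
  also have "\<dots> = \<Gamma> (act k t) (\<lambda>n b. p (r (l x n) (counit B b)))"
    using x by (simp add: comodalg.bimod.actions_commute)
  also have "\<dots> = \<Gamma> (act k t) (\<lambda>n b. p (r n (counit B (target B x \<bullet> b))))"
    using coact_eval_takeuchi[OF F(1), of "act k t" x] k t x by simp
  also have "\<dots> = \<Gamma> t (\<lambda>n b. p (r (act k n) (counit B (target B x \<bullet> b))))"
    using k t x by (simp add: coact_eval_equivariant[OF balanced_target_left[OF F(1)]])
  also have "\<dots> = \<Gamma> t (\<lambda>n b. p (act k (r n (counit B (target B x \<bullet> b)))))"
    using k x by (simp add: act_ract)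
  also have "\<dots> = \<Gamma> t (\<lambda>n b. p (act k (r (l x n) (counit B b))))"
    using coact_eval_takeuchi[OF F(2) t x] .
  also have "\<dots> = \<Gamma> t (\<lambda>n b. p (act k (l x (r n (counit B b)))))"
    using x by (simp add: comodalg.bimod.actions_commute)
  also have "\<dots> = p (act k (l x t))" using co.coact_eval_counit[OF p2 t] .
  finally show "p (act k (l x t)) = p (l x (act k t))" ..
qed (use k t x in simp_all)

text \<open>Multiplication by \<open>\<phi> x\<close> is the action of \<open>source K x\<close>,
  hence covered by equivariance. This is what makes the Galois map respect the relations over
  S.\<close>

lemma coact_eval_phi_left:
  assumes "co.MB.bal F" "x \<in> carrier S" "t \<in> carrier T"
  shows "\<Gamma> (\<phi> x \<cdot> t) F = \<Gamma> t (\<lambda>t0 t1. F (\<phi> x \<cdot> t0) t1)"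
  using coact_eval_equivariant[OF assms(1), of "source K x" t] assms by (simp add: act_source)

lemma coact_eval_phi_right:
  assumes "co.MB.bal F" "x \<in> carrier S" "t \<in> carrier T"
  shows "\<Gamma> (t \<cdot> \<phi> x) F = \<Gamma> t (\<lambda>t0 t1. F (t0 \<cdot> \<phi> x) t1)"
  using coact_eval_equivariant[OF assms(1), of "target K x" t] assms by (simp add: act_target)

end

section \<open>The translation map of the Galois extension\<close>

context equivariant_galois
begin

lemma balanced_left_mult:
  assumes F: "co.MB.bal F" and u: "u \<in> carrier T"
  shows "co.MB.bal (\<lambda>t b. F (u \<cdot> t) b)"
  using u by (intro balanced_mapI) (simp_all add: T_linear balanced_mapD[OF F] ract_mult[symmetric])

lemma balanced_right_left_mult:
  assumes F: "co.MB.bal F" and c: "c \<in> carrier B"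
  shows "co.MB.bal (\<lambda>t b. F t (c \<bullet> b))"
  using c by (intro balanced_mapI) (simp_all add: T_linear balanced_mapD[OF F] B.B.m_assoc[symmetric])

lemma TT_balanced_left_mult:
  assumes G: "TT.bal G" and u: "u \<in> carrier T"
  shows "TT.bal (\<lambda>t t'. G (u \<cdot> t) t')"
  using u by (intro TT_balancedI)
    (simp_all add: T_linear TT_balancedD[OF G] comodalg.T.m_assoc[symmetric])

abbreviation can where "can F \<equiv> (\<lambda>t' t. \<Gamma> t (\<lambda>t0 t1. F (t' \<cdot> t0) t1))"

lemma galois_balanced:
  assumes F: "co.MB.bal F"
  shows "TT.bal (can F)"
  by (intro TT_balancedI)
    (simp_all add: T_linear balanced_mapD[OF F] co.coact_eval_plus balanced_left_mult[OF F]
      coact_eval_phi_left comodalg.T.m_assoc)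

lemma galois_map_closed: "X \<in> carrier TT.P \<Longrightarrow> galois_map R B T r \<rho> X \<in> carrier co.MB.P"
  by (simp add: galois_map_def rtensor_def Let_def)

lemma galois_map_eval:
  "\<lbrakk>X \<in> carrier TT.P; co.MB.bal F\<rbrakk> \<Longrightarrow> co.MB.eval (galois_map R B T r \<rho> X) F =
    TT.eval X (can F)"
  by (simp add: galois_map_def rtensor_def Let_def TT.eval_sweedler
      co.MB.eval_sweedler co.MB.eval_pure)

lemma galois_eqI:
  assumes "X \<in> carrier TT.P" "Y \<in> carrier TT.P"
    and "\<And>F. co.MB.bal F \<Longrightarrow> TT.eval X (can F) =
      TT.eval Y (can F)"
  shows "X = Y"
proof -
  have "galois_map R B T r \<rho> X = galois_map R B T r \<rho> Y"
    using assms by (intro co.MB.tensor_eqI) (simp_all add: galois_map_closed galois_map_eval)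
  then show ?thesis
    using galois_bij assms(1,2) by (auto simp: bij_betw_def galois_domain_def dest: inj_onD)
qed

abbreviation tr where "tr \<equiv> galois_translation R B S K T r \<rho> act"

abbreviation \<tau> where "\<tau> b G \<equiv> TT.eval (tr b) G"

lemma translation_closed [simp]: "b \<in> carrier B \<Longrightarrow> tr b \<in> carrier TT.P"
  and galois_map_translation:
    "b \<in> carrier B \<Longrightarrow> galois_map R B T r \<rho> (tr b) = \<one>\<^sub>T \<boxtimes>\<^bsub>co.MB.P\<^esub> b"
proof -
  assume b: "b \<in> carrier B"
  have "\<one>\<^sub>T \<boxtimes>\<^bsub>co.MB.P\<^esub> b \<in> galois_map R B T r \<rho> ` carrier TT.P"
    using galois_bij b by (simp add: bij_betw_def galois_domain_def rtensor_def)
  then show "tr b \<in> carrier TT.P" "galois_map R B T r \<rho> (tr b) = \<one>\<^sub>T \<boxtimes>\<^bsub>co.MB.P\<^esub> b"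
    by (auto simp: galois_translation_def galois_domain_def rtensor_def f_inv_into_f intro: inv_into_into)
qed

text \<open>In Sweedler notation: \<open>b\<^sub>- b\<^sub>+\<^sub>0 \<otimes> b\<^sub>+\<^sub>1 = 1 \<otimes> b\<close>.\<close>

lemma translation_coact:
  assumes "co.MB.bal F" "b \<in> carrier B"
  shows "\<tau> b (can F) = F \<one>\<^sub>T b"
  using galois_map_eval[OF translation_closed[OF assms(2)] assms(1)] assms
  by (simp add: galois_map_translation co.MB.eval_pure)

text \<open>By injectivity, \<open>tr b\<close> is the only element that the Galois map sends to
  \<open>1 (x) b\<close>.\<close>

lemma translation_eqI:
  assumes Y: "Y \<in> carrier TT.P" and b: "b \<in> carrier B" and G: "TT.bal G"
    and "\<And>F. co.MB.bal F \<Longrightarrow> TT.eval Y (can F) = F \<one>\<^sub>T b"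
  shows "\<tau> b G = TT.eval Y G"
proof -
  have "tr b = Y" using assms by (intro galois_eqI) (simp_all add: translation_coact)
  then show ?thesis by simp
qed

text \<open>In Sweedler notation: \<open>t\<^sub>0 t\<^sub>1\<^sub>- \<otimes> t\<^sub>1\<^sub>+ = 1 \<otimes> t\<close>.\<close>

lemma coact_translation:
  assumes G: "TT.bal G" and t: "t \<in> carrier T"
  shows "\<Gamma> t (\<lambda>t0 t1. \<tau> t1 (\<lambda>p q. G (t0 \<cdot> p) q)) = G \<one>\<^sub>T t"
proof -
  define Y where "Y = sweedler TT.P (\<rho> t) (\<lambda>t0 t1. sweedler TT.P (tr t1) (\<lambda>p q. (t0 \<cdot> p) \<boxtimes>\<^bsub>TT.P\<^esub> q))"
  have Yc: "Y \<in> carrier TT.P"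
    using t by (simp add: Y_def)
  have Y: "TT.eval Y G = \<Gamma> t (\<lambda>t0 t1. \<tau> t1 (\<lambda>p q. G (t0 \<cdot> p) q))" if "TT.bal G" for G
    using t that
    by (simp add: Y_def co.MB.eval_sweedler
        TT.eval_sweedler
        TT.eval_pure)
  have "Y = \<one>\<^sub>T \<boxtimes>\<^bsub>TT.P\<^esub> t"
  \<comment> \<open>The Galois map sends both elements to the coaction of \<open>t\<close>, since
    \<open>t_0 t_{1-} t_{1+0} (x) t_{1+1} = t_0 (x) t_1\<close>.\<close>
  proof (rule galois_eqI[OF Yc])
    fix F assume F: "co.MB.bal F"
    show "TT.eval Y (can F) =
        TT.eval (\<one>\<^sub>T \<boxtimes>\<^bsub>TT.P\<^esub> t) (can F)"
      using t F translation_coact[OF balanced_left_mult[OF F]]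
      by (simp add: Y galois_balanced TT.eval_pure comodalg.T.m_assoc)
  qed (use t in simp)
  then show ?thesis using Y[OF G] G t by (simp add: TT.eval_pure)
qed

lemma translation_plus:
  assumes "TT.bal G" "b \<in> carrier B" "b' \<in> carrier B"
  shows "\<tau> (b \<oplus>\<^bsub>B\<^esub> b') G = \<tau> b G + \<tau> b' G"
proof -
  have "\<tau> (b \<oplus>\<^bsub>B\<^esub> b') G = TT.eval (tr b \<oplus>\<^bsub>TT.P\<^esub> tr b') G"
    using assms
    by (intro translation_eqI) (simp_all add: TT.eval_add galois_balanced translation_coact balanced_mapD(2))
  then show ?thesis using assms by (simp add: TT.eval_add)
qed

lemma translation_scale:
  assumes G: "TT.bal G" and b: "b \<in> carrier B"
  shows "\<tau> (c \<odot>\<^bsub>B\<^esub> b) G = \<tau> b (\<lambda>p q. G (c \<odot>\<^bsub>T\<^esub> p) q)"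
proof -
  have "\<tau> (c \<odot>\<^bsub>B\<^esub> b) G = TT.eval (c \<odot>\<^bsub>TT.P\<^esub> tr b) G"
  proof (rule translation_eqI[OF _ _ G])
    fix F assume F: "co.MB.bal F"
    have e: "F (c \<odot>\<^bsub>T\<^esub> \<one>\<^sub>T) b = F \<one>\<^sub>T (c \<odot>\<^bsub>B\<^esub> b)"
    proof -
      \<comment> \<open>A complex scalar crosses the tensor sign as the multiple \<open>c 1\<close>
        of the unit of R.\<close>
      have "r \<one>\<^sub>T (c \<odot>\<^bsub>R\<^esub> \<one>\<^bsub>R\<^esub>) = c \<odot>\<^bsub>T\<^esub> \<one>\<^sub>T"
        by (simp add: comodalg.bimod.right.act_scale_right comodalg.bimod.right.act_one)
      moreover have "target B (c \<odot>\<^bsub>R\<^esub> \<one>\<^bsub>R\<^esub>) = c \<odot>\<^bsub>B\<^esub> \<one>\<^sub>B"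
        using B.target_hom by (simp add: calgebra_hom_def clinear_map_def opp_def)
      ultimately show ?thesis
        using balanced_mapD(3)[OF F, of "\<one>\<^sub>T" "c \<odot>\<^bsub>R\<^esub> \<one>\<^bsub>R\<^esub>" b] b
        by (simp add: B.B.smult_mult_right)
    qed
    show "TT.eval (c \<odot>\<^bsub>TT.P\<^esub> tr b) (can F) = F \<one>\<^sub>T (c \<odot>\<^bsub>B\<^esub> b)"
      using b e translation_coact[OF balanced_left_mult[OF F, of "c \<odot>\<^bsub>T\<^esub> \<one>\<^sub>T"] b]
      by (simp add: TT.eval_scale galois_balanced[OF F] comodalg.T.smult_mult_left)
  qed (use b in simp_all)
  then show ?thesis using assms by (simp add: TT.eval_scale)
qed

text \<open>\<open>g\<close> and \<open>h\<close> are applied entry by entry to the representative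
  of \<open>tr b\<close> that \<open>tsum\<close> selects. If the Galois map sends the resulting
  element to \<open>1 (x) b'\<close>, it is the translation of \<open>b'\<close>.\<close>

lemma translation_map:
  assumes b: "b \<in> carrier B" "b' \<in> carrier B" and G: "TT.bal G"
    and g: "\<And>p. p \<in> carrier T \<Longrightarrow> g p \<in> carrier T" and h: "\<And>q. q \<in> carrier T \<Longrightarrow> h q \<in> carrier T"
    and "\<And>F. co.MB.bal F \<Longrightarrow> \<tau> b (\<lambda>p q. \<Gamma> (h q) (\<lambda>q0 q1. F (g p \<cdot> q0) q1)) = F \<one>\<^sub>T b'"
  shows "\<tau> b' G = \<tau> b (\<lambda>p q. G (g p) (h q))"
proof -
  define Y where "Y = sweedler TT.P (tr b) (\<lambda>p q. g p \<boxtimes>\<^bsub>TT.P\<^esub> h q)"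
  have Yc: "Y \<in> carrier TT.P"
    using b by (simp add: Y_def g h)
  have Y: "TT.eval Y G = \<tau> b (\<lambda>p q. G (g p) (h q))" if "TT.bal G" for G
    using b that by (simp add: Y_def g h TT.eval_sweedler TT.eval_pure)
  show ?thesis
    using assms by (subst Y[symmetric], simp, intro translation_eqI[OF Yc]) (simp_all add: Y galois_balanced)
qed

text \<open>In \<open>b_- x b_{+0} (x) b_{+1}\<close> the scalar passes to \<open>b_{+0}\<close> by
  balancing and on to the last factor as \<open>t(x)\<close> by the Takeuchi property.\<close>

lemma translation_target_left:
  assumes G: "TT.bal G" and b: "b \<in> carrier B" and x: "x \<in> carrier R"
  shows "\<tau> (target B x \<bullet> b) G = \<tau> b (\<lambda>p q. G (r p x) q)"
proof (rule translation_map[OF _ _ G])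
  fix F assume F: "co.MB.bal F"
  have "\<tau> b (\<lambda>p q. \<Gamma> q (\<lambda>q0 q1. F (r p x \<cdot> q0) q1)) =
      \<tau> b (\<lambda>p q. \<Gamma> q (\<lambda>q0 q1. F (p \<cdot> q0) (target B x \<bullet> q1)))"
    using x by (simp add: comodalg.balanced coact_eval_takeuchi[OF balanced_left_mult[OF F]])
  also have "\<dots> = F \<one>\<^sub>T (target B x \<bullet> b)"
    using translation_coact[OF balanced_target_left[OF F x] b] .
  finally show "\<tau> b (\<lambda>p q. \<Gamma> q (\<lambda>q0 q1. F (r p x \<cdot> q0) q1)) = F \<one>\<^sub>T (target B x \<bullet> b)" .
qed (use b x in simp_all)

text \<open>The left action of \<open>x\<close> is multiplication by \<open>1x\<close>, which can be
  pulled out in front; then \<open>1x (x) b = 1 (x) b t(x)\<close>.\<close>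

lemma translation_target_right:
  assumes G: "TT.bal G" and b: "b \<in> carrier B" and x: "x \<in> carrier R"
  shows "\<tau> (b \<bullet> target B x) G = \<tau> b (\<lambda>p q. G (l x p) q)"
proof (rule translation_map[OF _ _ G])
  fix F assume F: "co.MB.bal F"
  have "\<tau> b (\<lambda>p q. \<Gamma> q (\<lambda>q0 q1. F (l x p \<cdot> q0) q1)) =
      \<tau> b (\<lambda>p q. \<Gamma> q (\<lambda>q0 q1. F (r \<one>\<^sub>T x \<cdot> (p \<cdot> q0)) q1))"
    using x by (simp add: lact_eq comodalg.T.m_assoc)
  also have "\<dots> = F (r \<one>\<^sub>T x) b"
    using translation_coact[OF balanced_left_mult[OF F, of "r \<one>\<^sub>T x"] b] x by simp
  also have "\<dots> = F \<one>\<^sub>T (b \<bullet> target B x)"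
    using x b by (simp add: balanced_mapD[OF F])
  finally show "\<tau> b (\<lambda>p q. \<Gamma> q (\<lambda>q0 q1. F (l x p \<cdot> q0) q1)) = F \<one>\<^sub>T (b \<bullet> target B x)" .
qed (use b x in simp_all)

lemma translation_source_right:
  assumes G: "TT.bal G" and b: "b \<in> carrier B" and x: "x \<in> carrier R"
  shows "\<tau> (b \<bullet> source B x) G = \<tau> b (\<lambda>p q. G p (r q x))"
proof (rule translation_map[OF _ _ G])
  fix F assume F: "co.MB.bal F"
  have "\<tau> b (\<lambda>p q. \<Gamma> (r q x) (\<lambda>q0 q1. F (p \<cdot> q0) q1)) =
      \<tau> b (\<lambda>p q. \<Gamma> q (\<lambda>q0 q1. F (p \<cdot> q0) (q1 \<bullet> source B x)))"
    using x by (simp add: co.coact_eval_act balanced_left_mult[OF F])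
  also have "\<dots> = F \<one>\<^sub>T (b \<bullet> source B x)"
    using translation_coact[OF co.MB.balanced_slot[OF F x] b] .
  finally show "\<tau> b (\<lambda>p q. \<Gamma> (r q x) (\<lambda>q0 q1. F (p \<cdot> q0) q1)) = F \<one>\<^sub>T (b \<bullet> source B x)" .
qed (use b x in simp_all)

lemma translation_one:
  assumes G: "TT.bal G" shows "\<tau> \<one>\<^sub>B G = G \<one>\<^sub>T \<one>\<^sub>T"
proof -
  have "\<tau> \<one>\<^sub>B G = TT.eval (\<one>\<^sub>T \<boxtimes>\<^bsub>TT.P\<^esub> \<one>\<^sub>T) G"
    by (rule translation_eqI[OF _ _ G]) (simp_all add: TT.eval_pure galois_balanced coact_eval_one)
  then show ?thesis using G by (simp add: TT.eval_pure)
qed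

lemma translation_target:
  assumes G: "TT.bal G" and x: "x \<in> carrier R"
  shows "\<tau> (target B x) G = G (r \<one>\<^sub>T x) \<one>\<^sub>T"
proof -
  have "\<tau> (target B x) G = TT.eval (r \<one>\<^sub>T x \<boxtimes>\<^bsub>TT.P\<^esub> \<one>\<^sub>T) G"
    using x by (intro translation_eqI[OF _ _ G])
      (simp_all add: TT.eval_pure galois_balanced coact_eval_one balanced_left_mult balanced_mapD(3))
  then show ?thesis using G x by (simp add: TT.eval_pure)
qed

lemma translation_source:
  assumes G: "TT.bal G" and x: "x \<in> carrier R"
  shows "\<tau> (source B x) G = G \<one>\<^sub>T (r \<one>\<^sub>T x)"
proof -
  have "\<tau> (source B x) G = TT.eval (\<one>\<^sub>T \<boxtimes>\<^bsub>TT.P\<^esub> r \<one>\<^sub>T x) G"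
    using x by (intro translation_eqI[OF _ _ G])
      (simp_all add: TT.eval_pure galois_balanced coact_eval_one co.coact_eval_act co.MB.balanced_slot)
  then show ?thesis using G x by (simp add: TT.eval_pure)
qed

text \<open>The Galois map carries the diagonal action of K to the action on the left factor alone,
  by equivariance and the module algebra law. So both sides are sent to \<open>(h 1) (x) b\<close>,
  and \<open>h 1 = s(eps h) 1\<close>.\<close>

lemma translation_invariant:
  assumes G: "TT.bal G" and b: "b \<in> carrier B" and h: "h \<in> carrier K"
  shows "K.\<Delta> h (\<lambda>h1 h2. \<tau> b (\<lambda>p q. G (act h1 p) (act h2 q))) = \<tau> b (\<lambda>p q. G (\<phi> (counit K h) \<cdot> p) q)"
proof -
  define X where "X = sweedler TT.P (comult K h) (\<lambda>h1 h2. sweedler TT.P (tr b)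
    (\<lambda>p q. act h1 p \<boxtimes>\<^bsub>TT.P\<^esub> act h2 q))"
  define Y where "Y = sweedler TT.P (tr b) (\<lambda>p q. (\<phi> (counit K h) \<cdot> p) \<boxtimes>\<^bsub>TT.P\<^esub> q)"
  have c: "X \<in> carrier TT.P" "Y \<in> carrier TT.P"
    using b h by (simp_all add: X_def Y_def)
  have X: "TT.eval X G = K.\<Delta> h (\<lambda>h1 h2. \<tau> b (\<lambda>p q. G (act h1 p) (act h2 q)))"
    and Y: "TT.eval Y G = \<tau> b (\<lambda>p q. G (\<phi> (counit K h) \<cdot> p) q)" if "TT.bal G" for G
    using b h that
    by (simp_all add: X_def Y_def K.KK.eval_sweedler
        TT.eval_sweedler
        TT.eval_pure)
  have "X = Y"
  proof (rule galois_eqI[OF c])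
    fix F assume F: "co.MB.bal F"
    have p: "additive_functional T (\<lambda>t. F t c)" if "c \<in> carrier B" for c
      using that by (simp add: additive_functional_def balanced_mapD[OF F])
    have "TT.eval X (can F) =
        K.\<Delta> h (\<lambda>h1 h2. \<tau> b (\<lambda>p q. \<Gamma> q (\<lambda>q0 q1. F (act h1 p \<cdot> act h2 q0) q1)))"
      by (simp add: X galois_balanced[OF F] coact_eval_equivariant balanced_left_mult[OF F])
    also have "\<dots> = \<tau> b (\<lambda>p q. \<Gamma> q (\<lambda>q0 q1. K.\<Delta> h (\<lambda>h1 h2. F (act h1 p \<cdot> act h2 q0) q1)))"
      by (subst tsum_swap) (rule tsum_ext[OF tsum_swap])
    also have "\<dots> = \<tau> b (\<lambda>p q. \<Gamma> q (\<lambda>q0 q1. F (act h (p \<cdot> q0)) q1))"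
      using h by (simp add: act_prod_eval[OF p h])
    also have "\<dots> = F (act h \<one>\<^sub>T) b"
      using translation_coact[OF balanced_act[OF F h] b] .
    also have "\<dots> = F (\<phi> (counit K h) \<cdot> \<one>\<^sub>T) b"
      using modalg.act_unit[OF h] h by (simp add: \<phi>_def)
    also have "\<dots> = \<tau> b (\<lambda>p q. \<Gamma> q (\<lambda>q0 q1. F (\<phi> (counit K h) \<cdot> (p \<cdot> q0)) q1))"
      using translation_coact[OF balanced_left_mult[OF F, of "\<phi> (counit K h)"] b] h by simp
    also have "\<dots> = TT.eval Y (can F)"
      using h by (simp add: Y galois_balanced[OF F] comodalg.T.m_assoc)
    finally show "TT.eval X (can F) =
        TT.eval Y (can F)" .
  qed
  then show ?thesis using X[OF G] Y[OF G] by simp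
qed

text \<open>In \<open>b'_- b_- b_{+0} b'_{+0} (x) b_{+1} b'_{+1}\<close> the inner translation
  collapses first, leaving \<open>b'_- b'_{+0} (x) b b'_{+1} = 1 (x) b b'\<close>.\<close>

lemma translation_mult:
  assumes G: "TT.bal G" and b: "b \<in> carrier B" "b' \<in> carrier B"
  shows "\<tau> (b \<bullet> b') G = \<tau> b' (\<lambda>p' q'. \<tau> b (\<lambda>p q. G (p' \<cdot> p) (q \<cdot> q')))"
proof -
  define Y where "Y = sweedler TT.P (tr b') (\<lambda>p' q'. sweedler TT.P (tr b) (\<lambda>p q. (p' \<cdot> p) \<boxtimes>\<^bsub>TT.P\<^esub> (q \<cdot> q')))"
  have Yc: "Y \<in> carrier TT.P"
    using b by (simp add: Y_def)
  have Y: "TT.eval Y G = \<tau> b' (\<lambda>p' q'. \<tau> b (\<lambda>p q. G (p' \<cdot> p) (q \<cdot> q')))" if "TT.bal G" for G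
    using b that by (simp add: Y_def TT.eval_sweedler TT.eval_pure)
  have "\<tau> (b \<bullet> b') G = TT.eval Y G"
  proof (rule translation_eqI[OF Yc _ G])
    fix F assume F: "co.MB.bal F"
    \<comment> \<open>Collapsing the translation of \<open>b\<close> requires this map to be
      balanced; a scalar crosses from \<open>t\<close> to \<open>c\<close> by the Takeuchi property
      for \<open>q'\<close>.\<close>
    have F1: "co.MB.bal (\<lambda>t c. \<Gamma> q' (\<lambda>q0 q1. F (p' \<cdot> t \<cdot> q0) (c \<bullet> q1)))"
      if pq: "p' \<in> carrier T" "q' \<in> carrier T" for p' q'
    proof (intro balanced_mapI)
      fix t x c assume a: "t \<in> carrier T" "x \<in> carrier R" "c \<in> carrier B"
      have "co.MB.bal (\<lambda>q0 q1. F (p' \<cdot> t \<cdot> q0) (c \<bullet> q1))"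
        using a pq by (intro balanced_mapI)
          (simp_all add: T_linear balanced_mapD[OF F] ract_mult[symmetric] B.B.m_assoc[symmetric])
      from coact_eval_takeuchi[OF this pq(2) a(2)]
      show "\<Gamma> q' (\<lambda>q0 q1. F (p' \<cdot> r t x \<cdot> q0) (c \<bullet> q1)) =
          \<Gamma> q' (\<lambda>q0 q1. F (p' \<cdot> t \<cdot> q0) (c \<bullet> target B x \<bullet> q1))"
        using a pq by (simp add: comodalg.T.m_assoc comodalg.balanced B.B.m_assoc)
    qed (use pq in \<open>simp_all add: T_linear balanced_mapD[OF F]\<close>)
    note F2 = balanced_right_left_mult[OF F b(1)]
    have "\<tau> b (\<lambda>p q. \<Gamma> (q \<cdot> q') (\<lambda>q0 q1. F (p' \<cdot> p \<cdot> q0) q1)) = \<Gamma> q' (\<lambda>q0 q1. F (p' \<cdot> q0) (b \<bullet> q1))"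
      if pq: "p' \<in> carrier T" "q' \<in> carrier T" for p' q'
    proof -
      have "\<tau> b (\<lambda>p q. \<Gamma> (q \<cdot> q') (\<lambda>q0 q1. F (p' \<cdot> p \<cdot> q0) q1)) =
          \<tau> b (\<lambda>p q. \<Gamma> q (\<lambda>t0 t1. \<Gamma> q' (\<lambda>u0 u1. F (p' \<cdot> p \<cdot> (t0 \<cdot> u0)) (t1 \<bullet> u1))))"
        using pq by (simp add: coact_eval_mult balanced_left_mult[OF F])
      also have "\<dots> = \<Gamma> q' (\<lambda>q0 q1. F (p' \<cdot> q0) (b \<bullet> q1))"
        using translation_coact[OF F1[OF pq] b(1)] pq by (simp add: comodalg.T.m_assoc)
      finally show ?thesis .
    qed
    then have "TT.eval Y (can F) =
        \<tau> b' (\<lambda>p' q'. \<Gamma> q' (\<lambda>q0 q1. F (p' \<cdot> q0) (b \<bullet> q1)))"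
      by (simp add: Y galois_balanced[OF F])
    also have "\<dots> = F \<one>\<^sub>T (b \<bullet> b')" using translation_coact[OF F2 b(2)] .
    finally show "TT.eval Y (can F) = F \<one>\<^sub>T (b \<bullet> b')" .
  qed (use b in simp)
  then show ?thesis using Y[OF G] by simp
qed

text \<open>In Sweedler notation: \<open>b\<^sub>- \<otimes> b\<^sub>+\<^sub>0 \<otimes> b\<^sub>+\<^sub>1 = b\<^sup>1\<^sub>- \<otimes> b\<^sup>1\<^sub>+ \<otimes> b\<^sup>2\<close>.\<close>

lemma translation_coact_right:
  assumes G1: "\<And>c. c \<in> carrier B \<Longrightarrow> TT.bal (\<lambda>p q. G p q c)"
    and G2: "\<And>p. p \<in> carrier T \<Longrightarrow> co.MB.bal (G p)"
    and b: "b \<in> carrier B"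
  shows "\<tau> b (\<lambda>p q. \<Gamma> q (G p)) = B.\<Delta> b (\<lambda>b1 b2. \<tau> b1 (\<lambda>p q. G p q b2))"
proof -
  let ?H = "\<lambda>t v w. \<tau> v (\<lambda>p q. G (t \<cdot> p) q w)"
  have TG: "TT.bal (\<lambda>p q. G (t \<cdot> p) q w)" if "t \<in> carrier T" "w \<in> carrier B" for t w
    by (rule TT_balanced_left_mult[OF G1[OF that(2)] that(1)])
  have H0: "co.MB.bal (\<lambda>t v. ?H t v w)" if "w \<in> carrier B" for w
    using that by (intro balanced_mapI)
      (simp_all add: T_linear TT_balancedD(1)[OF G1] translation_plus TG translation_target_right T_assoc)
  have H1: "co.MB.bal (\<lambda>t v. ?H (p \<cdot> t) v w)" if "p \<in> carrier T" "w \<in> carrier B" for p w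
    by (rule balanced_left_mult[OF H0[OF that(2)] that(1)])
  have H2: "B.BB.bal (?H t)" if t: "t \<in> carrier T" for t
    using t by (intro balanced_mapI)
      (simp_all add: translation_plus TG translation_source_right tsum_add balanced_mapD[OF G2])
  have H3: "co.MB.bal (\<lambda>t c. B.\<Delta> c (?H t))"
  proof (intro balanced_mapI)
    fix t x c assume a: "t \<in> carrier T" "x \<in> carrier R" "c \<in> carrier B"
    then show "B.\<Delta> c (?H (r t x)) = B.\<Delta> (c \<bullet> target B x) (?H t)"
      by (simp add: B.comult_eval_target_right H2 TG translation_target_right T_assoc)
  qed (simp_all add: T_linear TT_balancedD(1)[OF G1] B.self.coact_eval_plus H2)
  \<comment> \<open>The identity \<open>coact_translation\<close>, read backwards, replaces
    \<open>q_0\<close> by \<open>q_{00} q_{01-} (x) q_{01+}\<close>. Coassociativity turns the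
    second coaction into a coproduct, after which \<open>b_-\<close> meets \<open>b_{+0}\<close> and
    both disappear.\<close>
  have "\<Gamma> q (G p) = \<Gamma> q (\<lambda>q0 q1. B.\<Delta> q1 (?H (p \<cdot> q0)))" if pq: "p \<in> carrier T" "q \<in> carrier T" for p q
  proof -
    have "\<Gamma> q (G p) = \<Gamma> q (\<lambda>q0 q1. \<Gamma> q0 (\<lambda>u v. \<tau> v (\<lambda>p' q'. G (p \<cdot> (u \<cdot> p')) q' q1)))"
      using pq by (simp add: coact_translation[OF TG])
    also have "\<dots> = \<Gamma> q (\<lambda>q0 q1. \<Gamma> q0 (\<lambda>u v. ?H (p \<cdot> u) v q1))"
      using pq by (simp add: comodalg.T.m_assoc)
    also have "\<dots> = \<Gamma> q (\<lambda>q0 q1. B.\<Delta> q1 (?H (p \<cdot> q0)))"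
      using pq by (intro co.coact_eval_coassoc H1 H2) simp_all
    finally show ?thesis .
  qed
  then have "\<tau> b (\<lambda>p q. \<Gamma> q (G p)) = \<tau> b (\<lambda>p q. \<Gamma> q (\<lambda>q0 q1. B.\<Delta> q1 (?H (p \<cdot> q0))))"
    by simp
  also have "\<dots> = B.\<Delta> b (?H \<one>\<^sub>T)"
    using translation_coact[OF H3 b] .
  finally show ?thesis by simp
qed

text \<open>
  In Sweedler notation: \<open>b\<^sub>-\<^sub>0 \<otimes> b\<^sub>-\<^sub>1 \<otimes> b\<^sub>+ = b\<^sup>+\<^sub>- \<otimes> b\<^sup>- \<otimes> b\<^sup>+\<^sub>+\<close>. Both sides come from
  \<open>1 \<otimes> 1 \<otimes> b = b\<^sub>-\<^sub>0 b\<^sub>+\<^sub>0 \<otimes> b\<^sub>-\<^sub>1 b\<^sub>+\<^sub>1\<^sup>1 \<otimes> b\<^sub>+\<^sub>1\<^sup>2\<close>, by applying first the translation of the Hopf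
  algebroid and then that of the extension to the last factor.
\<close>

lemma translation_coact_left:
  assumes G1: "\<And>q. q \<in> carrier T \<Longrightarrow> co.MB.bal (\<lambda>p c. G p c q)"
    and G2: "\<And>c. c \<in> carrier B \<Longrightarrow> TT.bal (\<lambda>p q. G p c q)"
    and b: "b \<in> carrier B"
  shows "\<tau> b (\<lambda>p q. \<Gamma> p (\<lambda>p0 p1. G p0 p1 q)) = B.\<nu> b (\<lambda>e f. \<tau> f (\<lambda>p q. G p e q))"
proof -
  \<comment> \<open>\<open>?H t c d\<close> is the value of \<open>G\<close> at
    \<open>t d^+_-\<close>, \<open>c d^-\<close>, \<open>d^+_+\<close>; the right-hand side of the
    lemma is the case \<open>t = 1\<close>, \<open>c = 1\<close>, \<open>d = b\<close>.\<close>
  let ?N = "\<lambda>t c e f. \<tau> f (\<lambda>p q. G (t \<cdot> p) (c \<bullet> e) q)"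
  let ?H = "\<lambda>t c d. B.\<nu> d (?N t c)"
  have TG: "TT.bal (\<lambda>p q. G (t \<cdot> p) c q)" if "t \<in> carrier T" "c \<in> carrier B" for t c
    by (rule TT_balanced_left_mult[OF G2[OF that(2)] that(1)])
  have bal: "G t (c \<bullet> target B x) q = G (r t x) c q"
    if "t \<in> carrier T" "c \<in> carrier B" "q \<in> carrier T" "x \<in> carrier R" for t c q x
    using balanced_mapD(3)[OF G1] that by simp
  have N: "B.BoB.bal (?N t c)" if tc: "t \<in> carrier T" "c \<in> carrier B" for t c
    using tc by (intro balanced_mapI)
      (simp_all add: T_linear balanced_mapD(2)[OF G1] translation_plus TG translation_target_left
        B.B.m_assoc[symmetric] bal ract_mult)
  have NH: "?N (r t x) c e f = ?N t c e (f \<bullet> target B x)"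
    if "t \<in> carrier T" "c \<in> carrier B" "e \<in> carrier B" "f \<in> carrier B" "x \<in> carrier R" for t c e f x
    using that by (simp add: translation_target_right TG T_assoc)
  have H1: "co.MB.bal (\<lambda>t c. ?H t c d)" if d: "d \<in> carrier B" for d
  proof (intro balanced_mapI)
    fix t x c assume a: "t \<in> carrier T" "x \<in> carrier R" "c \<in> carrier B"
    then show "?H (r t x) c d = ?H t (c \<bullet> target B x) d"
      using d by (simp add: NH B.translation_target[OF N] B.B.m_assoc)
  qed (simp_all add: T_linear balanced_mapD[OF G1])
  have H2: "B.BB.bal (?H t)" if t: "t \<in> carrier T" for t
    using t by (intro balanced_mapI)
      (simp_all add: T_linear balanced_mapD[OF G1] B.translation_plus N B.translation_mult_target B.B.m_assoc)
  have H3: "co.MB.bal (\<lambda>t d. \<Gamma> t (\<lambda>t0 t1. ?H t0 t1 d))"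
    by (intro balanced_mapI)
      (simp_all add: co.coact_eval_plus H1 tsum_add balanced_mapD(2)[OF H2] co.coact_eval_act
        balanced_mapD(3)[OF H2])
  have key: "\<Gamma> q (\<lambda>q0 q1. \<Gamma> (p \<cdot> q0) (\<lambda>t0 t1. ?H t0 t1 q1)) = \<Gamma> p (\<lambda>p0 p1. G p0 p1 q)"
    if pq: "p \<in> carrier T" "q \<in> carrier T" for p q
  proof -
    \<comment> \<open>Coassociativity gathers the components of \<open>q\<close> in B into one
      coproduct \<open>d_1 (x) d_2\<close>. Then \<open>d_1 d_2^- (x) d_2^+ = 1 (x) d\<close>
      removes the Hopf translation, and \<open>q_0 q_{1-} (x) q_{1+} = 1 (x) q\<close> removes the
      Galois translation.\<close>
    have inner: "\<Gamma> q (\<lambda>q0 q1. \<Gamma> q0 (\<lambda>u v. ?H (p0 \<cdot> u) (p1 \<bullet> v) q1)) = G p0 p1 q"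
      if p01: "p0 \<in> carrier T" "p1 \<in> carrier B" for p0 p1
    proof -
      have L: "TT.bal (\<lambda>s q. G (p0 \<cdot> s) p1 q)" using TG p01 .
      have "\<Gamma> q (\<lambda>q0 q1. \<Gamma> q0 (\<lambda>u v. ?H (p0 \<cdot> u) (p1 \<bullet> v) q1)) =
          \<Gamma> q (\<lambda>q0 q1. B.\<Delta> q1 (\<lambda>d1 d2. ?H (p0 \<cdot> q0) (p1 \<bullet> d1) d2))"
      proof (rule co.coact_eval_coassoc[OF pq(2)])
        fix d assume d: "d \<in> carrier B"
        show "co.MB.bal (\<lambda>u v. ?H (p0 \<cdot> u) (p1 \<bullet> v) d)"
          by (rule balanced_left_mult[OF balanced_right_left_mult[OF H1[OF d] p01(2)] p01(1)])
      next
        fix u assume u: "u \<in> carrier T"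
        show "B.BB.bal (\<lambda>v d. ?H (p0 \<cdot> u) (p1 \<bullet> v) d)"
          using B.balanced_mult_left[OF H2, of "p0 \<cdot> u" p1] p01 u by simp
      qed
      also have "\<dots> = \<Gamma> q (\<lambda>q0 q1. B.\<Delta> q1 (\<lambda>d1 d2. B.\<nu> d2 (\<lambda>e f. ?N (p0 \<cdot> q0) p1 (d1 \<bullet> e) f)))"
        using p01 by (simp add: B.B.m_assoc)
      also have "\<dots> = \<Gamma> q (\<lambda>q0 q1. \<tau> q1 (\<lambda>s q'. G (p0 \<cdot> (q0 \<cdot> s)) p1 q'))"
      proof (rule tsum_ext)
        fix q0 q1 assume q01: "q0 \<in> carrier T" "q1 \<in> carrier B"
        show "B.\<Delta> q1 (\<lambda>d1 d2. B.\<nu> d2 (\<lambda>e f. ?N (p0 \<cdot> q0) p1 (d1 \<bullet> e) f)) =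
            \<tau> q1 (\<lambda>s q'. G (p0 \<cdot> (q0 \<cdot> s)) p1 q')"
          using B.comult_translation[OF N[of "p0 \<cdot> q0" p1] q01(2)] p01 q01
          by (simp add: comodalg.T.m_assoc)
      qed
      also have "\<dots> = G p0 p1 q"
        using coact_translation[OF L pq(2)] p01 by simp
      finally show ?thesis .
    qed
    have "\<Gamma> q (\<lambda>q0 q1. \<Gamma> (p \<cdot> q0) (\<lambda>t0 t1. ?H t0 t1 q1)) =
        \<Gamma> q (\<lambda>q0 q1. \<Gamma> p (\<lambda>p0 p1. \<Gamma> q0 (\<lambda>u v. ?H (p0 \<cdot> u) (p1 \<bullet> v) q1)))"
      using pq by (simp add: coact_eval_mult[OF H1])
    also have "\<dots> = \<Gamma> p (\<lambda>p0 p1. \<Gamma> q (\<lambda>q0 q1. \<Gamma> q0 (\<lambda>u v. ?H (p0 \<cdot> u) (p1 \<bullet> v) q1)))"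
      by (rule tsum_swap)
    also have "\<dots> = \<Gamma> p (\<lambda>p0 p1. G p0 p1 q)"
      by (rule tsum_ext[OF inner])
    finally show ?thesis .
  qed
  have "\<tau> b (\<lambda>p q. \<Gamma> p (\<lambda>p0 p1. G p0 p1 q)) =
      \<tau> b (\<lambda>p q. \<Gamma> q (\<lambda>q0 q1. \<Gamma> (p \<cdot> q0) (\<lambda>t0 t1. ?H t0 t1 q1)))"
    by (rule tsum_ext[OF key[symmetric]])
  also have "\<dots> = \<Gamma> \<one>\<^sub>T (\<lambda>t0 t1. ?H t0 t1 b)"
    using translation_coact[OF H3 b] .
  also have "\<dots> = ?H \<one>\<^sub>T \<one>\<^sub>B b"
    using coact_eval_one[OF H1[OF b]] .
  finally show ?thesis by simp
qed

end

section \<open>The induced action evaluated on balanced maps\<close>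

locale sayd_extension =
    equivariant_galois R B S K T l r \<rho> act + sayd: right_left_SAYD S K M lM actM \<rho>M
  for R B S K T l r \<rho> act M lM actM \<rho>M
begin

sublocale com: left_comodule_over S K M lM \<rho>M ..

sublocale MT: tensor_product K M actM T act
  by unfold_locales (auto simp: sayd.mod.act_scale_left)

abbreviation \<Lambda> where "\<Lambda> m F \<equiv> com.KM.eval (\<rho>M m) F"

lemmas M_linear = T_linear sayd.mod.act_add_left sayd.mod.act_add_right
  sayd.comod.M.act_add_left sayd.comod.M.act_add_right K.K.l_distr K.K.r_distr

lemma counit_source_left:
  "\<lbrakk>k \<in> carrier K; x \<in> carrier S\<rbrakk> \<Longrightarrow> counit K (source K x \<star> k) = x \<otimes>\<^bsub>S\<^esub> counit K k"
  using K.counit_bilinear[of x "\<one>\<^bsub>S\<^esub>" k] by simp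

lemma counit_target_left:
  "\<lbrakk>k \<in> carrier K; x \<in> carrier S\<rbrakk> \<Longrightarrow> counit K (target K x \<star> k) = counit K k \<otimes>\<^bsub>S\<^esub> x"
  using K.counit_bilinear[of "\<one>\<^bsub>S\<^esub>" x k] by simp

lemma right_action_eval:
  assumes p: "additive_functional M p" and m: "m \<in> carrier M" and x: "x \<in> carrier S"
  shows "\<Lambda> m (\<lambda>k n. p (lM (counit K (k \<star> source K x)) n)) = p (actM m (source K x))"
  unfolding sayd.right_action[OF x m, symmetric] left_comodule_right_action_def
  using m x by (intro com.KM.functional_sweedler[symmetric] sayd.mod.M.abelian_group_axioms p) simp_all

lemma stable_eval:
  assumes p: "additive_functional M p" and m: "m \<in> carrier M"
  shows "\<Lambda> m (\<lambda>k n. p (actM n k)) = p m"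
proof -
  have "p (sweedler M (\<rho>M m) (\<lambda>k n. actM n k)) = \<Lambda> m (\<lambda>k n. p (actM n k))"
    using m by (intro com.KM.functional_sweedler sayd.mod.M.abelian_group_axioms p) simp_all
  then show ?thesis by (simp add: sayd.stable[OF m])
qed

lemma anti_yetter_drinfeld_eval:
  assumes F: "com.KM.bal F" and m: "m \<in> carrier M" and h: "h \<in> carrier K"
  shows "\<Lambda> (actM m h) F =
    K.\<Delta> h (\<lambda>h1 h2. K.\<nu> h2 (\<lambda>e f. \<Lambda> m (\<lambda>k n. F (f \<star> k \<star> h1) (actM n e))))"
  unfolding sayd.anti_yetter_drinfeld[OF h m] ltensor_def using F m h
  by (simp add: K.KK.eval_sweedler K.KoK.eval_sweedler
      com.KM.eval_sweedler com.KM.eval_pure)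

text \<open>SAYD condition (i) writes \<open>m_0 s(x)\<close> through the counit. Coassociativity
  moves that counit onto \<open>m_{-1}\<close>, where the Takeuchi property of K and the counit law
  give \<open>m_{-1} t(x)\<close>.\<close>

lemma M_takeuchi:
  assumes F: "com.KM.bal F" and m: "m \<in> carrier M" and x: "x \<in> carrier S"
  shows "\<Lambda> m (\<lambda>k n. F (k \<star> target K x) n) = \<Lambda> m (\<lambda>k n. F k (actM n (source K x)))"
proof -
  let ?G = "\<lambda>k k' n. F k (lM (counit K (k' \<star> source K x)) n)"
  have p1: "additive_functional M (F k)" if "k \<in> carrier K" for k
    using that by (simp add: additive_functional_def balanced_mapD[OF F])
  have p2: "additive_functional K (\<lambda>k. F (k \<star> target K x) n)" if "n \<in> carrier M" for n
    using that x by (simp add: additive_functional_def M_linear balanced_mapD[OF F])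
  have F2: "K.KK.bal (\<lambda>k1 k2. F (target K (counit K k2) \<star> k1) n)" if n: "n \<in> carrier M" for n
    using n by (intro balanced_mapI)
      (simp_all add: M_linear balanced_mapD[OF F] K.counit_add K.target_add K.target_mult
        counit_source_left K.K.m_assoc)
  have "\<Lambda> m (\<lambda>k n. F k (actM n (source K x))) = \<Lambda> m (\<lambda>k n. \<Lambda> n (?G k))"
    using x by (simp add: right_action_eval[OF p1])
  also have "\<dots> = \<Lambda> m (\<lambda>k n. K.\<Delta> k (\<lambda>k1 k2. ?G k1 k2 n))"
  proof (rule com.coact_eval_coassoc[OF m, symmetric])
    fix n assume n: "n \<in> carrier M"
    show "K.KK.bal (\<lambda>k k'. ?G k k' n)"
      using n x by (intro balanced_mapI)
        (simp_all add: M_linear balanced_mapD[OF F] K.counit_add K.K.m_assoc counit_source_left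
          sayd.comod.M.act_mult)
  next
    fix k assume k: "k \<in> carrier K"
    show "com.KM.bal (?G k)"
      using k x by (intro balanced_mapI)
        (simp_all add: M_linear balanced_mapD[OF F] K.counit_add K.K.m_assoc counit_target_left
          sayd.comod.M.act_mult)
  qed
  also have "\<dots> = \<Lambda> m (\<lambda>k n. K.\<Delta> k (\<lambda>k1 k2. F (target K (counit K (k2 \<star> source K x)) \<star> k1) n))"
    using x by (simp add: balanced_mapD[OF F])
  also have "\<dots> = \<Lambda> m (\<lambda>k n. K.\<Delta> k (\<lambda>k1 k2. F (target K (counit K k2) \<star> (k1 \<star> target K x)) n))"
    using x by (simp add: K.comult_eval_takeuchi[OF F2, symmetric])
  also have "\<dots> = \<Lambda> m (\<lambda>k n. K.\<Delta> k (\<lambda>k1 k2. F (target K (counit K k2) \<star> k1 \<star> target K x) n))"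
    using x by (simp add: K.K.m_assoc)
  also have "\<dots> = \<Lambda> m (\<lambda>k n. F (k \<star> target K x) n)"
    by (simp add: K.comult_eval_counit_right[OF p2])
  finally show ?thesis ..
qed

lemma balanced_phi_left:
  assumes "MT.bal P" "n \<in> carrier M" "t \<in> carrier T" "x \<in> carrier S"
  shows "P n (\<phi> x \<cdot> t) = P (actM n (source K x)) t"
  using balanced_mapD(3)[OF assms(1), of n "source K x" t] assms by (simp add: act_source)

lemma balanced_phi_right:
  assumes "MT.bal P" "n \<in> carrier M" "t \<in> carrier T" "x \<in> carrier S"
  shows "P n (t \<cdot> \<phi> x) = P (lM x n) t"
  using balanced_mapD(3)[OF assms(1), of n "target K x" t] assms
  by (simp add: act_target sayd.left_action)

lemma KM_balanced:
  assumes P: "MT.bal P" and u: "u \<in> carrier T" "v \<in> carrier T"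
  shows "com.KM.bal (\<lambda>k n. P n (u \<cdot> act k v))"
  using u by (intro balanced_mapI)
    (simp_all add: M_linear balanced_mapD(1,2)[OF P] modalg.mod.act_mult act_target balanced_phi_right[OF P]
      comodalg.T.m_assoc[symmetric])

text \<open>
  For a balanced \<open>P\<close>, thought of as a functional on \<open>M \<otimes>\<^sub>\<K> T\<close>, the number \<open>A b P m t\<close> is the value of
  \<open>P\<close> at \<open>b \<triangleright> (m \<otimes> t)\<close>, and \<open>W P m u\<close> is the map of \<open>b\<^sub>-\<close> and \<open>b\<^sub>+\<close> behind it, with \<open>u\<close> in place of \<open>t\<close>.
\<close>

definition W where "W P m u p q = \<Lambda> m (\<lambda>k n. P n (q \<cdot> act k (u \<cdot> p)))"

definition A where "A b P m t = \<tau> b (W P m t)"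

context
  fixes P assumes P: "MT.bal P"
begin

text \<open>Multiplying \<open>b_-\<close> by \<open>\<phi> x\<close> puts \<open>t(x)\<close>
  behind \<open>m_{-1}\<close>; \<open>M_takeuchi\<close> turns it into \<open>s(x)\<close> on
  \<open>m_0\<close>, which is multiplication of \<open>b_+\<close> by \<open>\<phi> x\<close>.
  Hence the formula for the action respects the tensor product over S.\<close>

lemma W_TT: "\<lbrakk>m \<in> carrier M; u \<in> carrier T\<rbrakk> \<Longrightarrow> TT.bal (W P m u)"
proof (intro TT_balancedI)
  fix p x q assume a: "m \<in> carrier M" "u \<in> carrier T" "p \<in> carrier T" "x \<in> carrier S" "q \<in> carrier T"
  have "W P m u (p \<cdot> \<phi> x) q = \<Lambda> m (\<lambda>k n. P n (q \<cdot> act (k \<star> target K x) (u \<cdot> p)))"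
    using a by (simp add: W_def modalg.mod.act_mult act_target comodalg.T.m_assoc)
  also have "\<dots> = \<Lambda> m (\<lambda>k n. P (actM n (source K x)) (q \<cdot> act k (u \<cdot> p)))"
    using a by (intro M_takeuchi KM_balanced P) simp_all
  also have "\<dots> = W P m u p (\<phi> x \<cdot> q)"
    using a by (simp add: W_def balanced_phi_left[OF P, symmetric] comodalg.T.m_assoc)
  finally show "W P m u p (\<phi> x \<cdot> q) = W P m u (p \<cdot> \<phi> x) q" ..
qed (simp_all add: W_def M_linear balanced_mapD(1,2)[OF P])

lemma W_assoc:
  "\<lbrakk>u \<in> carrier T; v \<in> carrier T; p \<in> carrier T\<rbrakk> \<Longrightarrow> W P m (u \<cdot> v) p q = W P m u (v \<cdot> p) q"
  by (simp add: W_def comodalg.T.m_assoc)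

lemma W_add:
  "\<lbrakk>u \<in> carrier T; v \<in> carrier T; p \<in> carrier T; q \<in> carrier T\<rbrakk> \<Longrightarrow>
    W P m (u \<oplus>\<^bsub>T\<^esub> v) p q = W P m u p q + W P m v p q"
  by (simp add: W_def M_linear balanced_mapD(2)[OF P])

lemma W_plus:
  "\<lbrakk>m \<in> carrier M; m' \<in> carrier M; u \<in> carrier T; p \<in> carrier T; q \<in> carrier T\<rbrakk> \<Longrightarrow>
    W P (m \<oplus>\<^bsub>M\<^esub> m') u p q = W P m u p q + W P m' u p q"
  by (simp add: W_def com.coact_eval_plus KM_balanced[OF P])

lemma W_lact:
  "\<lbrakk>m \<in> carrier M; x \<in> carrier S; u \<in> carrier T; p \<in> carrier T; q \<in> carrier T\<rbrakk> \<Longrightarrow>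
    W P (lM x m) u p q = W P m u p (q \<cdot> \<phi> x)"
  by (simp add: W_def com.coact_eval_act KM_balanced[OF P] modalg.mod.act_mult act_source comodalg.T.m_assoc)

text \<open>Balancing moves \<open>h_2^-\<close> from \<open>m_0\<close> to \<open>T\<close>, where
  it acts on a product with \<open>h_2^+\<close> inside its second factor. By the defining equation
  of the translation of \<open>h_2\<close> the pair reduces to \<open>h_2\<close> acting on
  \<open>q\<close> alone.\<close>

lemma W_anti_yetter_drinfeld:
  assumes m: "m \<in> carrier M" and h: "h \<in> carrier K" and t: "u \<in> carrier T" "p \<in> carrier T" "q \<in> carrier T"
  shows "W P (actM m h) u p q = K.\<Delta> h (\<lambda>h1 h2. K.\<Delta> h1 (\<lambda>a c. W P m (act a u) (act c p) (act h2 q)))"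
proof -
  have inner: "K.\<nu> h2 (\<lambda>e f. P (actM n e) (q \<cdot> act (f \<star> k \<star> h1) (u \<cdot> p))) =
      K.\<Delta> h1 (\<lambda>a c. P n (act h2 q \<cdot> act k (act a u \<cdot> act c p)))"
    if c: "h1 \<in> carrier K" "h2 \<in> carrier K" "k \<in> carrier K" "n \<in> carrier M" for h1 h2 k n
  proof -
    let ?w = "act (k \<star> h1) (u \<cdot> p)"
    have pn: "additive_functional T (P n)"
      using c by (simp add: additive_functional_def balanced_mapD(2)[OF P])
    have pk: "additive_functional T (\<lambda>y. P n (act h2 q \<cdot> act k y))"
      using c t by (simp add: additive_functional_def M_linear balanced_mapD(2)[OF P])
    have "K.\<nu> h2 (\<lambda>e f. P (actM n e) (q \<cdot> act (f \<star> k \<star> h1) (u \<cdot> p))) =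
        K.\<nu> h2 (\<lambda>e f. P n (act e (q \<cdot> act f ?w)))"
      using c t by (simp add: balanced_mapD(3)[OF P] modalg.mod.act_mult)
    also have "\<dots> = K.\<nu> h2 (\<lambda>e f. K.\<Delta> e (\<lambda>a d. P n (act a q \<cdot> act (d \<star> f) ?w)))"
      using c t by (simp add: act_prod_eval[OF pn] modalg.mod.act_mult)
    also have "\<dots> = P n (act h2 q \<cdot> ?w)"
      using K.translation_comult[OF act_prod_balanced[OF pn t(3), of ?w] c(2)] c t
      by (simp add: modalg.mod.act_one)
    also have "\<dots> = K.\<Delta> h1 (\<lambda>a c. P n (act h2 q \<cdot> act k (act a u \<cdot> act c p)))"
      using c t by (simp add: modalg.mod.act_mult act_prod_eval[OF pk])
    finally show ?thesis .
  qed
  have "W P (actM m h) u p q = K.\<Delta> h (\<lambda>h1 h2. K.\<nu> h2 (\<lambda>e f.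
      \<Lambda> m (\<lambda>k n. P (actM n e) (q \<cdot> act (f \<star> k \<star> h1) (u \<cdot> p)))))"
    unfolding W_def using t by (intro anti_yetter_drinfeld_eval KM_balanced P m h) simp_all
  also have "\<dots> = K.\<Delta> h (\<lambda>h1 h2. \<Lambda> m (\<lambda>k n. K.\<nu> h2 (\<lambda>e f.
      P (actM n e) (q \<cdot> act (f \<star> k \<star> h1) (u \<cdot> p)))))"
    by (rule tsum_ext[OF tsum_swap])
  also have "\<dots> = K.\<Delta> h (\<lambda>h1 h2. \<Lambda> m (\<lambda>k n.
      K.\<Delta> h1 (\<lambda>a c. P n (act h2 q \<cdot> act k (act a u \<cdot> act c p)))))"
    by (intro tsum_ext inner)
  also have "\<dots> = K.\<Delta> h (\<lambda>h1 h2. K.\<Delta> h1 (\<lambda>a c. W P m (act a u) (act c p) (act h2 q)))"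
    unfolding W_def by (rule tsum_ext[OF tsum_swap])
  finally show ?thesis .
qed

text \<open>The anti Yetter-Drinfeld condition lets three factors of \<open>h\<close> act on
  \<open>t\<close>, \<open>b_-\<close> and \<open>b_+\<close>. Invariance replaces the last two by
  \<open>\<phi>\<close> of a counit, which slides to \<open>t\<close> as the action of
  \<open>target K\<close>; the counit law restores \<open>h\<close>.\<close>

lemma A_act:
  assumes m: "m \<in> carrier M" and h: "h \<in> carrier K" and b: "b \<in> carrier B" and t: "t \<in> carrier T"
  shows "A b P (actM m h) t = A b P m (act h t)"
proof -
  let ?G = "\<lambda>a c d. \<tau> b (\<lambda>p q. W P m (act a t) (act c p) (act d q))"
  have G1: "K.KK.bal (\<lambda>a c. ?G a c d)" if d: "d \<in> carrier K" for d
    using m t d by (intro balanced_mapI)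
      (simp_all add: M_linear W_add TT_balancedD(1)[OF W_TT] modalg.mod.act_mult act_source act_target W_assoc)
  have G2: "K.KK.bal (?G a)" if a: "a \<in> carrier K" for a
    using m t a by (intro balanced_mapI)
      (simp_all add: M_linear TT_balancedD[OF W_TT] modalg.mod.act_mult act_source act_target)
  have Ge: "additive_functional K (\<lambda>a. \<tau> b (\<lambda>p q. W P m (act a t) p q))"
    using m t by (simp add: additive_functional_def M_linear W_add)
  have "A b P (actM m h) t =
      \<tau> b (\<lambda>p q. K.\<Delta> h (\<lambda>h1 h2. K.\<Delta> h1 (\<lambda>a c. W P m (act a t) (act c p) (act h2 q))))"
    unfolding A_def using m h t by (simp add: W_anti_yetter_drinfeld)
  also have "\<dots> = K.\<Delta> h (\<lambda>h1 h2. K.\<Delta> h1 (\<lambda>a c. ?G a c h2))"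
    by (subst tsum_swap) (rule tsum_ext[OF tsum_swap])
  \<comment> \<open>Regrouping puts the factors acting on \<open>b_-\<close> and \<open>b_+\<close>
    into a single coproduct, the form required by \<open>translation_invariant\<close>.\<close>
  also have "\<dots> = K.\<Delta> h (\<lambda>a d. K.\<Delta> d (?G a))"
    by (rule K.self.coact_eval_coassoc[OF h G1 G2])
  also have "\<dots> = K.\<Delta> h (\<lambda>a d. \<tau> b (\<lambda>p q. W P m (act a t) (\<phi> (counit K d) \<cdot> p) q))"
    using m t b by (simp add: translation_invariant[OF W_TT])
  also have "\<dots> = K.\<Delta> h (\<lambda>a d. \<tau> b (\<lambda>p q. W P m (act (target K (counit K d) \<star> a) t) p q))"
    using t by (simp add: modalg.mod.act_mult act_target W_assoc)
  also have "\<dots> = A b P m (act h t)"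
    unfolding A_def by (rule K.comult_eval_counit_right[OF Ge h])
  finally show ?thesis .
qed

lemma A_balanced: "b \<in> carrier B \<Longrightarrow> MT.bal (A b P)"
  by (rule balanced_mapI) (simp_all add: A_act, simp_all add: A_def W_plus W_add tsum_add)

lemma A_plus:
  "\<lbrakk>b \<in> carrier B; b' \<in> carrier B; m \<in> carrier M; t \<in> carrier T\<rbrakk> \<Longrightarrow>
    A (b \<oplus>\<^bsub>B\<^esub> b') P m t = A b P m t + A b' P m t"
  by (simp add: A_def translation_plus W_TT)

lemma A_scale:
  "\<lbrakk>b \<in> carrier B; m \<in> carrier M; t \<in> carrier T\<rbrakk> \<Longrightarrow>
    A (c \<odot>\<^bsub>B\<^esub> b) P m t = A b P m (c \<odot>\<^bsub>T\<^esub> t)"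
  by (simp add: A_def translation_scale W_TT)
     (simp add: W_def comodalg.T.smult_mult_left comodalg.T.smult_mult_right)

text \<open>Stability transported to \<open>T\<close>:
  \<open>m_0 (x) m_{-1} t = m_0 m_{-1} (x) t = m (x) t\<close>.\<close>

lemma stable_balanced:
  assumes m: "m \<in> carrier M" and t: "t \<in> carrier T"
  shows "\<Lambda> m (\<lambda>k n. P n (act k t)) = P m t"
proof -
  have "additive_functional M (\<lambda>n. P n t)"
    using t by (simp add: additive_functional_def balanced_mapD(1)[OF P])
  from stable_eval[OF this m] show ?thesis using t by (simp add: balanced_mapD(3)[OF P])
qed

lemma A_one: "\<lbrakk>m \<in> carrier M; t \<in> carrier T\<rbrakk> \<Longrightarrow> A \<one>\<^sub>B P m t = P m t"
  by (simp add: A_def translation_one W_TT) (simp add: W_def stable_balanced)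

lemma A_target: "\<lbrakk>m \<in> carrier M; t \<in> carrier T; x \<in> carrier R\<rbrakk> \<Longrightarrow> A (target B x) P m t = P m (r t x)"
  by (simp add: A_def translation_target W_TT) (simp add: W_def ract_mult[symmetric] stable_balanced)

text \<open>The scalar from \<open>b_+\<close> passes inside the action of \<open>m_{-1}\<close> by
  \<open>act_lact\<close>, and stability then removes \<open>m_{-1}\<close>.\<close>

lemma A_source: "\<lbrakk>m \<in> carrier M; t \<in> carrier T; x \<in> carrier R\<rbrakk> \<Longrightarrow> A (source B x) P m t = P m (l x t)"
  by (simp add: A_def translation_source W_TT)
     (simp add: W_def lact_eq[symmetric] act_lact[symmetric] stable_balanced)

lemma A_stable:
  assumes m: "m \<in> carrier M" and t: "t \<in> carrier T"
  shows "\<Gamma> t (\<lambda>t0 t1. A t1 P m t0) = P m t"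
proof -
  have "\<Gamma> t (\<lambda>t0 t1. A t1 P m t0) = \<Gamma> t (\<lambda>t0 t1. \<tau> t1 (\<lambda>p q. W P m \<one>\<^sub>T (t0 \<cdot> p) q))"
    using m by (simp add: A_def W_assoc[symmetric])
  also have "\<dots> = W P m \<one>\<^sub>T \<one>\<^sub>T t"
    using m t by (intro coact_translation W_TT) simp_all
  \<comment> \<open>What remains is \<open>m_0 (x) t (m_{-1} 1)\<close>. The unit axiom replaces
    \<open>m_{-1}\<close> by its counit, which the counit law of the comodule absorbs.\<close>
  also have "\<dots> = \<Lambda> m (\<lambda>k n. P n (t \<cdot> \<phi> (counit K k)))"
    unfolding W_def \<phi>_def by (rule tsum_cong) (simp_all, subst modalg.act_unit, simp_all)
  also have "\<dots> = \<Lambda> m (\<lambda>k n. P (lM (counit K k) n) t)"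
    using t by (simp add: balanced_phi_right[OF P])
  also have "\<dots> = P m t"
    using m t by (intro com.coact_eval_counit[where p = "\<lambda>n. P n t"])
      (simp_all add: additive_functional_def balanced_mapD(1)[OF P])
  finally show ?thesis .
qed

text \<open>Stability read backwards, \<open>n (x) q z = n_0 (x) n_{-1} (q z)\<close>; the module
  algebra law and coassociativity then distribute the inserted factor over \<open>q\<close> and
  \<open>z\<close>.\<close>

lemma balanced_expand:
  assumes n: "n \<in> carrier M" and t: "q \<in> carrier T" "z \<in> carrier T"
  shows "P n (q \<cdot> z) = \<Lambda> n (\<lambda>k o1. \<Lambda> o1 (\<lambda>k' o2. P o2 (act k q \<cdot> act k' z)))"
proof -
  have p: "additive_functional T (P n)" if "n \<in> carrier M" for n
    using that by (simp add: additive_functional_def balanced_mapD(2)[OF P])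
  have "P n (q \<cdot> z) = \<Lambda> n (\<lambda>k o1. P o1 (act k (q \<cdot> z)))"
    using n t by (simp add: stable_balanced)
  also have "\<dots> = \<Lambda> n (\<lambda>k o1. K.\<Delta> k (\<lambda>k1 k2. P o1 (act k1 q \<cdot> act k2 z)))"
    using t by (simp add: act_prod_eval[OF p])
  also have "\<dots> = \<Lambda> n (\<lambda>k o1. \<Lambda> o1 (\<lambda>k' o2. P o2 (act k q \<cdot> act k' z)))"
    using t by (intro com.coact_eval_coassoc n act_prod_balanced p KM_balanced P) simp_all
  finally show ?thesis .
qed

lemma W_KM_balanced:
  assumes "u \<in> carrier T" "p \<in> carrier T" "q \<in> carrier T"
  shows "com.KM.bal (\<lambda>k n. W P n u p (act k q))"
  using assms by (intro balanced_mapI)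
    (simp_all add: M_linear W_plus TT_balancedD[OF W_TT] modalg.mod.act_mult act_target W_lact)

text \<open>
  The key step for associativity of the action. Stability of \<open>m\<^sub>0\<close> produces two further factors of the
  iterated coaction of \<open>m\<close>; the invariance of \<open>b\<^sub>- \<otimes> b\<^sub>+\<close> under \<open>\<K>\<close> absorbs them.
\<close>

lemma A_translation_absorb:
  assumes m: "m \<in> carrier M" and b: "b \<in> carrier B" and x: "x \<in> carrier T" "x' \<in> carrier T"
  shows "\<tau> b (\<lambda>p q. \<Lambda> m (\<lambda>k n. P n (q \<cdot> (x' \<cdot> act k (x \<cdot> p))))) =
    \<Lambda> m (\<lambda>k n. A b P n (x' \<cdot> act k x))"
proof -
  let ?u = "\<lambda>k. x' \<cdot> act k x"
  have step: "\<Lambda> m (\<lambda>k n. P n (q \<cdot> (x' \<cdot> act k (x \<cdot> p)))) =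
      \<Lambda> m (\<lambda>k n. \<Lambda> n (\<lambda>k' n'. K.\<Delta> k' (\<lambda>k2 k3. W P n' (?u k) (act k2 p) (act k3 q))))"
    if t: "p \<in> carrier T" "q \<in> carrier T" for p q
  proof -
    let ?G = "\<lambda>k1 k2 n. \<Lambda> n (\<lambda>k' n'. W P n' (?u k1) (act k2 p) (act k' q))"
    have inner: "P n (q \<cdot> (x' \<cdot> act k (x \<cdot> p))) = K.\<Delta> k (\<lambda>k1 k2. ?G k1 k2 n)"
      if kn: "k \<in> carrier K" "n \<in> carrier M" for k n
    proof -
      have e: "P o2 (act k' q \<cdot> act k'' (x' \<cdot> act k (x \<cdot> p))) =
          K.\<Delta> k (\<lambda>k1 k2. P o2 (act k' q \<cdot> act k'' (?u k1 \<cdot> act k2 p)))"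
        if c: "k' \<in> carrier K" "k'' \<in> carrier K" "o2 \<in> carrier M" for k' k'' o2
      proof -
        have "additive_functional T (\<lambda>y. P o2 (act k' q \<cdot> act k'' (x' \<cdot> y)))"
          using c t x by (simp add: additive_functional_def M_linear balanced_mapD(2)[OF P])
        from act_prod_eval[OF this kn(1) x(1) t(1)] show ?thesis
          using c t x by (simp add: comodalg.T.m_assoc)
      qed
      have "P n (q \<cdot> (x' \<cdot> act k (x \<cdot> p))) =
          \<Lambda> n (\<lambda>k' o1. \<Lambda> o1 (\<lambda>k'' o2. P o2 (act k' q \<cdot> act k'' (x' \<cdot> act k (x \<cdot> p)))))"
        using kn t x by (intro balanced_expand) simp_all
      also have "\<dots> = \<Lambda> n (\<lambda>k' o1. \<Lambda> o1 (\<lambda>k'' o2.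
          K.\<Delta> k (\<lambda>k1 k2. P o2 (act k' q \<cdot> act k'' (?u k1 \<cdot> act k2 p)))))"
        by (intro tsum_ext e)
      also have "\<dots> = \<Lambda> n (\<lambda>k' o1. K.\<Delta> k (\<lambda>k1 k2. W P o1 (?u k1) (act k2 p) (act k' q)))"
        unfolding W_def by (rule tsum_ext[OF tsum_swap])
      also have "\<dots> = K.\<Delta> k (\<lambda>k1 k2. ?G k1 k2 n)"
        by (rule tsum_swap)
      finally show ?thesis .
    qed
    have G1: "K.KK.bal (\<lambda>k1 k2. ?G k1 k2 n)" if n: "n \<in> carrier M" for n
      using t x n by (intro balanced_mapI)
        (simp_all add: M_linear W_add TT_balancedD(1)[OF W_TT] modalg.mod.act_mult act_source act_target
          comodalg.T.m_assoc[symmetric], simp add: W_assoc)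
    have G2: "com.KM.bal (?G k1)" if k1: "k1 \<in> carrier K" for k1
      using t x k1 by (intro balanced_mapI)
        (simp_all add: M_linear TT_balancedD(1)[OF W_TT] com.coact_eval_plus W_KM_balanced com.coact_eval_act
          modalg.mod.act_mult act_source act_target TT_balancedD(3)[OF W_TT])
    \<comment> \<open>Coassociativity is used twice: once to separate the factor acting on
      \<open>x\<close>, and once to gather those acting on \<open>p\<close> and \<open>q\<close>
      into a single coproduct for \<open>translation_invariant\<close>.\<close>
    have "\<Lambda> m (\<lambda>k n. P n (q \<cdot> (x' \<cdot> act k (x \<cdot> p)))) = \<Lambda> m (\<lambda>k n. K.\<Delta> k (\<lambda>k1 k2. ?G k1 k2 n))"
      by (rule tsum_ext[OF inner])
    also have "\<dots> = \<Lambda> m (\<lambda>k n. \<Lambda> n (?G k))"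
      by (rule com.coact_eval_coassoc[OF m G1 G2])
    also have "\<dots> = \<Lambda> m (\<lambda>k n. \<Lambda> n (\<lambda>k' n'. K.\<Delta> k' (\<lambda>k2 k3. W P n' (?u k) (act k2 p) (act k3 q))))"
    proof (rule tsum_ext)
      fix k n assume kn: "k \<in> carrier K" "n \<in> carrier M"
      show "\<Lambda> n (?G k) = \<Lambda> n (\<lambda>k' n'. K.\<Delta> k' (\<lambda>k2 k3. W P n' (?u k) (act k2 p) (act k3 q)))"
      proof (rule com.coact_eval_coassoc[OF kn(2), symmetric])
        fix n' assume n': "n' \<in> carrier M"
        show "K.KK.bal (\<lambda>k2 k3. W P n' (?u k) (act k2 p) (act k3 q))"
          using t x kn n' by (intro balanced_mapI)
            (simp_all add: M_linear TT_balancedD[OF W_TT] modalg.mod.act_mult act_source act_target)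
      qed (use t x kn in \<open>simp add: W_KM_balanced\<close>)
    qed
    finally show ?thesis .
  qed
  have "\<tau> b (\<lambda>p q. \<Lambda> m (\<lambda>k n. P n (q \<cdot> (x' \<cdot> act k (x \<cdot> p))))) =
      \<tau> b (\<lambda>p q. \<Lambda> m (\<lambda>k n. \<Lambda> n (\<lambda>k' n'. K.\<Delta> k' (\<lambda>k2 k3. W P n' (?u k) (act k2 p) (act k3 q)))))"
    by (rule tsum_ext[OF step])
  also have "\<dots> = \<Lambda> m (\<lambda>k n. \<Lambda> n (\<lambda>k' n'. K.\<Delta> k' (\<lambda>k2 k3.
      \<tau> b (\<lambda>p q. W P n' (?u k) (act k2 p) (act k3 q)))))"
    by (subst tsum_swap, rule tsum_ext, subst tsum_swap,
        rule tsum_ext, rule tsum_swap)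
  also have "\<dots> = \<Lambda> m (\<lambda>k n. \<Lambda> n (\<lambda>k' n'. \<tau> b (\<lambda>p q. W P n' (?u k) (\<phi> (counit K k') \<cdot> p) q)))"
    using b x by (simp add: translation_invariant[OF W_TT])
  \<comment> \<open>The counit left by invariance moves from \<open>b_-\<close> to the argument in
    \<open>T\<close>, then to the argument in \<open>M\<close> as a left S-action, where the counit
    law removes it.\<close>
  also have "\<dots> = \<Lambda> m (\<lambda>k n. \<Lambda> n (\<lambda>k' n'. A b P n' (?u k \<cdot> \<phi> (counit K k'))))"
  proof (intro tsum_ext)
    fix k n k' n' assume c: "k \<in> carrier K" "k' \<in> carrier K"
    show "\<tau> b (\<lambda>p q. W P n' (?u k) (\<phi> (counit K k') \<cdot> p) q) = A b P n' (?u k \<cdot> \<phi> (counit K k'))"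
      unfolding A_def using c x by (intro tsum_ext W_assoc[symmetric]) simp_all
  qed
  also have "\<dots> = \<Lambda> m (\<lambda>k n. \<Lambda> n (\<lambda>k' n'. A b P (lM (counit K k') n') (?u k)))"
    using b x by (simp add: balanced_phi_right[OF A_balanced])
  also have "\<dots> = \<Lambda> m (\<lambda>k n. A b P n (?u k))"
  proof (rule tsum_ext)
    fix k n assume kn: "k \<in> carrier K" "n \<in> carrier M"
    show "\<Lambda> n (\<lambda>k' n'. A b P (lM (counit K k') n') (?u k)) = A b P n (?u k)"
      using kn b x by (intro com.coact_eval_counit[where p = "\<lambda>n. A b P n (?u k)"])
        (simp_all add: additive_functional_def balanced_mapD(1)[OF A_balanced])
  qed
  finally show ?thesis .
qed

end

text \<open>\<open>A b\<close> acts on functionals, so composites appear in reverse order.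
  Multiplicativity splits \<open>tr (b b')\<close>, and the inner sum over \<open>tr b\<close> is
  exactly what \<open>A_translation_absorb\<close> evaluates.\<close>

lemma A_mult:
  assumes P: "MT.bal P" and b: "b \<in> carrier B" "b' \<in> carrier B" and m: "m \<in> carrier M" and t: "t \<in> carrier T"
  shows "A (b \<bullet> b') P m t = A b' (A b P) m t"
proof -
  have "A (b \<bullet> b') P m t = \<tau> b' (\<lambda>p' q'. \<tau> b (\<lambda>p q. W P m t (p' \<cdot> p) (q \<cdot> q')))"
    unfolding A_def by (rule translation_mult[OF W_TT[OF P m t] b])
  also have "\<dots> = \<tau> b' (\<lambda>p' q'. \<tau> b (\<lambda>p q. \<Lambda> m (\<lambda>k n. P n (q \<cdot> (q' \<cdot> act k (t \<cdot> p' \<cdot> p))))))"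
    using t by (simp add: W_def comodalg.T.m_assoc)
  also have "\<dots> = \<tau> b' (\<lambda>p' q'. \<Lambda> m (\<lambda>k n. A b P n (q' \<cdot> act k (t \<cdot> p'))))"
    using t by (simp add: A_translation_absorb[OF P m b(1)])
  finally show ?thesis by (simp add: A_def[of b'] W_def)
qed

lemma W_ract:
  assumes "MT.bal P" "m \<in> carrier M" "u \<in> carrier T" "p \<in> carrier T" "q \<in> carrier T" "x \<in> carrier R"
  shows "W P m u p (r q x) = W P m (l x u) p q"
  using assms by (simp add: W_def comodalg.balanced act_lact[symmetric] lact_mult)

text \<open>
  A functional on \<open>(M \<otimes> T) \<otimes> \<B>\<close> is treated as a map \<open>\<Phi>\<close> of three arguments. Both sides become
  sums over \<open>b\<^sub>- \<otimes> b\<^sub>+\<close> after the coaction is applied to \<open>b\<^sub>+\<close> and to \<open>b\<^sub>-\<close>.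
\<close>

lemma A_coact:
  assumes P1: "\<And>c. c \<in> carrier B \<Longrightarrow> MT.bal (\<lambda>m t. \<Phi> m t c)"
    and P2: "\<And>m. m \<in> carrier M \<Longrightarrow> co.MB.bal (\<Phi> m)"
    and b: "b \<in> carrier B" and m: "m \<in> carrier M" and t: "t \<in> carrier T"
  shows "A b (\<lambda>m t. \<Gamma> t (\<Phi> m)) m t =
    B.\<Delta> b (\<lambda>b1 b2. B.\<nu> b1 (\<lambda>e f. \<Gamma> t (\<lambda>t0 t1. A f (\<lambda>m t. \<Phi> m t (b2 \<bullet> t1 \<bullet> e)) m t0)))"
proof -
  let ?W = "\<lambda>c. W (\<lambda>m t. \<Phi> m t c) m"
  \<comment> \<open>The element of B is the product of the coaction components \<open>c\<close> of
    \<open>b_+\<close>, \<open>t1\<close> of \<open>t\<close> and \<open>p1\<close> of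
    \<open>b_-\<close>, in the order in which these factors occur in the action. In the end
    \<open>c\<close> becomes \<open>b^2\<close> and \<open>p1\<close> becomes
    \<open>b^{1-}\<close>.\<close>
  let ?F = "\<lambda>t0 t1 q c p0 p1. ?W (c \<bullet> t1 \<bullet> p1) t0 p0 q"
  have WW: "?W c t0 p0 q = \<Lambda> m (\<lambda>k n. \<Phi> n (q \<cdot> act k (t0 \<cdot> p0)) c)" for c t0 p0 q
    by (simp add: W_def)
  have Wc: "?W (c \<oplus>\<^bsub>B\<^esub> d) t0 p0 q = ?W c t0 p0 q + ?W d t0 p0 q"
    if "c \<in> carrier B" "d \<in> carrier B" "t0 \<in> carrier T" "p0 \<in> carrier T" "q \<in> carrier T" for c d t0 p0 q
    using that by (simp add: WW balanced_mapD(2)[OF P2] tsum_add)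
  have Wx: "?W c t0 (r p0 x) q = ?W (c \<bullet> target B x) t0 p0 q"
    if "c \<in> carrier B" "x \<in> carrier R" "t0 \<in> carrier T" "p0 \<in> carrier T" "q \<in> carrier T" for c x t0 p0 q
    using that by (simp add: WW ract_mult[symmetric] act_ract balanced_mapD(3)[OF P2])
  have TTW: "TT.bal (?W c u)" if "c \<in> carrier B" "u \<in> carrier T" for c u
    using W_TT[OF P1 m] that .
  have Wu: "?W c (u \<oplus>\<^bsub>T\<^esub> v) p q = ?W c u p q + ?W c v p q"
    if "c \<in> carrier B" "u \<in> carrier T" "v \<in> carrier T" "p \<in> carrier T" "q \<in> carrier T" for c u v p q
    using W_add[OF P1] that by simp
  have F1: "co.MB.bal (?F t0 t1 q c)"
    if "t0 \<in> carrier T" "t1 \<in> carrier B" "q \<in> carrier T" "c \<in> carrier B" for t0 t1 q c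
    using that by (intro balanced_mapI)
      (simp_all add: M_linear TT_balancedD(1)[OF TTW] Wc Wx B.B.m_assoc)
  \<comment> \<open>Scalars cross here because of the Takeuchi property for \<open>p\<close>,
    available once its coaction has been summed.\<close>
  have F2: "co.MB.bal (\<lambda>t0 t1. \<Gamma> p (?F t0 t1 q c))"
    if "p \<in> carrier T" "q \<in> carrier T" "c \<in> carrier B" for p q c
  proof (intro balanced_mapI)
    fix t0 x t1 assume a: "t0 \<in> carrier T" "x \<in> carrier R" "t1 \<in> carrier B"
    have "\<Gamma> p (?F (r t0 x) t1 q c) = \<Gamma> p (\<lambda>p0 p1. ?F t0 t1 q c (l x p0) p1)"
      using a that by (simp add: WW comodalg.balanced)
    also have "\<dots> = \<Gamma> p (\<lambda>p0 p1. ?F t0 t1 q c p0 (target B x \<bullet> p1))"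
      using a that by (simp add: coact_eval_takeuchi[OF F1])
    also have "\<dots> = \<Gamma> p (?F t0 (t1 \<bullet> target B x) q c)"
      using a that by (simp add: B.B.m_assoc)
    finally show "\<Gamma> p (?F (r t0 x) t1 q c) = \<Gamma> p (?F t0 (t1 \<bullet> target B x) q c)" .
  qed (use that in \<open>simp_all add: M_linear Wu Wc\<close>)
  have F3: "co.MB.bal (\<lambda>p0 p1. \<Gamma> t (\<lambda>t0 t1. ?F t0 t1 q c p0 p1))"
    if "q \<in> carrier T" "c \<in> carrier B" for q c
    using that by (intro balanced_mapI) (simp_all add: tsum_add balanced_mapD[OF F1])
  let ?G = "\<lambda>p q c. \<Gamma> p (\<lambda>p0 p1. \<Gamma> t (\<lambda>t0 t1. ?F t0 t1 q c p0 p1))"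
  have G1: "TT.bal (\<lambda>p q. ?G p q c)" if c: "c \<in> carrier B" for c
  proof (intro TT_balancedI)
    fix p x q assume a: "p \<in> carrier T" "x \<in> carrier S" "q \<in> carrier T"
    then show "?G p (\<phi> x \<cdot> q) c = ?G (p \<cdot> \<phi> x) q c"
      using c t by (simp add: coact_eval_phi_right[OF F3] TT_balancedD(3)[OF TTW])
  qed (use c t in \<open>simp_all add: co.coact_eval_plus F3 TT_balancedD(2)[OF TTW] tsum_add\<close>)
  have G2: "co.MB.bal (?G p)" if p: "p \<in> carrier T" for p
  proof (intro balanced_mapI)
    fix q x c assume a: "q \<in> carrier T" "x \<in> carrier R" "c \<in> carrier B"
    \<comment> \<open>The scalar passes from \<open>q\<close> through the action of K to
      \<open>t0\<close> as a left action, and the Takeuchi property for \<open>t\<close> sends it to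
      the slot in B.\<close>
    have "?G p (r q x) c = \<Gamma> t (\<lambda>t0 t1. \<Gamma> p (?F (l x t0) t1 q c))"
      using a by (subst tsum_swap) (simp add: W_ract[OF P1 m])
    also have "\<dots> = \<Gamma> t (\<lambda>t0 t1. \<Gamma> p (?F t0 (target B x \<bullet> t1) q c))"
      using a p t by (simp add: coact_eval_takeuchi[OF F2])
    also have "\<dots> = ?G p q (c \<bullet> target B x)"
      using a by (subst tsum_swap) (simp add: B.B.m_assoc)
    finally show "?G p (r q x) c = ?G p q (c \<bullet> target B x)" .
  qed (use p in \<open>simp_all add: M_linear TT_balancedD(2)[OF TTW] Wc\<close>)
  have expand: "\<Gamma> (q \<cdot> act k (t \<cdot> p)) (\<Phi> n) =
      \<Gamma> q (\<lambda>q0 c. \<Gamma> p (\<lambda>p0 p1. \<Gamma> t (\<lambda>t0 t1. \<Phi> n (q0 \<cdot> act k (t0 \<cdot> p0)) (c \<bullet> t1 \<bullet> p1))))"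
    if a: "p \<in> carrier T" "q \<in> carrier T" "k \<in> carrier K" "n \<in> carrier M" for p q k n
  proof -
    have e: "\<Gamma> (act k (t \<cdot> p)) (\<lambda>u c'. \<Phi> n (q0 \<cdot> u) (c \<bullet> c')) =
        \<Gamma> p (\<lambda>p0 p1. \<Gamma> t (\<lambda>t0 t1. \<Phi> n (q0 \<cdot> act k (t0 \<cdot> p0)) (c \<bullet> t1 \<bullet> p1)))"
      if "q0 \<in> carrier T" "c \<in> carrier B" for q0 c
    proof -
      have bal: "co.MB.bal (\<lambda>u c'. \<Phi> n (q0 \<cdot> u) (c \<bullet> c'))"
        by (rule balanced_left_mult[OF balanced_right_left_mult[OF P2[OF a(4)] that(2)] that(1)])
      have "\<Gamma> (act k (t \<cdot> p)) (\<lambda>u c'. \<Phi> n (q0 \<cdot> u) (c \<bullet> c')) =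
          \<Gamma> t (\<lambda>t0 t1. \<Gamma> p (\<lambda>p0 p1. \<Phi> n (q0 \<cdot> act k (t0 \<cdot> p0)) (c \<bullet> (t1 \<bullet> p1))))"
        using a t by (simp add: coact_eval_equivariant[OF bal] coact_eval_mult[OF balanced_act[OF bal a(3)]])
      also have "\<dots> = \<Gamma> p (\<lambda>p0 p1. \<Gamma> t (\<lambda>t0 t1. \<Phi> n (q0 \<cdot> act k (t0 \<cdot> p0)) (c \<bullet> t1 \<bullet> p1)))"
        using that by (subst tsum_swap) (simp add: B.B.m_assoc)
      finally show ?thesis .
    qed
    show ?thesis using a t by (simp add: coact_eval_mult[OF P2] e)
  qed
  have "A b (\<lambda>m t. \<Gamma> t (\<Phi> m)) m t = \<tau> b (\<lambda>p q. \<Lambda> m (\<lambda>k n.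
      \<Gamma> q (\<lambda>q0 c. \<Gamma> p (\<lambda>p0 p1. \<Gamma> t (\<lambda>t0 t1. \<Phi> n (q0 \<cdot> act k (t0 \<cdot> p0)) (c \<bullet> t1 \<bullet> p1))))))"
    unfolding A_def W_def by (intro tsum_ext expand)
  also have "\<dots> = \<tau> b (\<lambda>p q. \<Gamma> q (?G p))"
    unfolding W_def
    by (rule tsum_ext, subst tsum_swap, rule tsum_ext,
        subst tsum_swap, rule tsum_ext, rule tsum_swap)
  also have "\<dots> = B.\<Delta> b (\<lambda>b1 b2. \<tau> b1 (\<lambda>p q. ?G p q b2))"
    by (rule translation_coact_right[OF G1 G2 b])
  also have "\<dots> = B.\<Delta> b (\<lambda>b1 b2. B.\<nu> b1 (\<lambda>e f. \<tau> f (\<lambda>p q. \<Gamma> t (\<lambda>t0 t1. ?F t0 t1 q b2 p e))))"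
  proof (rule tsum_ext)
    fix b1 b2 assume c: "b1 \<in> carrier B" "b2 \<in> carrier B"
    show "\<tau> b1 (\<lambda>p q. ?G p q b2) = B.\<nu> b1 (\<lambda>e f. \<tau> f (\<lambda>p q. \<Gamma> t (\<lambda>t0 t1. ?F t0 t1 q b2 p e)))"
    proof (rule translation_coact_left[OF F3 _ c(1)])
      fix e assume "e \<in> carrier B"
      then show "TT.bal (\<lambda>p q. \<Gamma> t (\<lambda>t0 t1. ?F t0 t1 q b2 p e))"
        using c by (intro TT_balancedI) (simp_all add: TT_balancedD[OF TTW] tsum_add)
    qed (use c in simp_all)
  qed
  also have "\<dots> = B.\<Delta> b (\<lambda>b1 b2. B.\<nu> b1 (\<lambda>e f. \<Gamma> t (\<lambda>t0 t1. A f (\<lambda>m t. \<Phi> m t (b2 \<bullet> t1 \<bullet> e)) m t0)))"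
    unfolding A_def by (intro tsum_ext tsum_swap)
  finally show ?thesis .
qed

end

section \<open>The induced module\<close>

context sayd_extension
begin

lemma canonical_left_action:
  assumes p: "additive_functional T p" and t: "t \<in> carrier T" and x: "x \<in> carrier R"
  shows "\<Gamma> t (\<lambda>t0 t1. p (r t0 (counit B (source B x \<bullet> t1)))) = p (l x t)"
proof -
  \<comment> \<open>The counit of \<open>t(x)\<close> is \<open>x\<close>, so the multiplicativity
    of the counit exchanges \<open>t(x)\<close> and \<open>s(x)\<close> at the left.\<close>
  have e: "counit B (source B x \<bullet> c) = counit B (target B x \<bullet> c)" if "c \<in> carrier B" for c
    using B.counit_mult[of "target B x" c] counit_target_right[of "\<one>\<^sub>B" x] that x
    by (simp add: B.counit_one)
  have "\<Gamma> t (\<lambda>t0 t1. p (r t0 (counit B (source B x \<bullet> t1)))) =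
      \<Gamma> t (\<lambda>t0 t1. p (r (l x t0) (counit B t1)))"
    using coact_eval_takeuchi[OF counit_balanced[OF p] t x] by (simp add: e)
  also have "\<dots> = \<Gamma> t (\<lambda>t0 t1. p (l x (r t0 (counit B t1))))"
    using x by (simp add: comodalg.bimod.actions_commute)
  also have "\<dots> = p (l x t)"
    using p x t by (intro co.coact_eval_counit[where p = "\<lambda>t. p (l x t)"])
      (simp_all add: additive_functional_def M_linear)
  finally show ?thesis .
qed

lemma balanced_ract: "\<lbrakk>MT.bal P; x \<in> carrier R\<rbrakk> \<Longrightarrow> MT.bal (\<lambda>m t. P m (r t x))"
  by (intro balanced_mapI) (simp_all add: M_linear balanced_mapD act_ract[symmetric])

text \<open>Multiples of the unit of K are balanced, so scalars may sit on either factor; the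
  induced module scales the left one, while the action and the coaction work on the right
  one.\<close>

lemma balanced_scale:
  assumes P: "MT.bal P" and n: "n \<in> carrier M" "t \<in> carrier T"
  shows "P (c \<odot>\<^bsub>M\<^esub> n) t = P n (c \<odot>\<^bsub>T\<^esub> t)"
proof -
  have "actM n (c \<odot>\<^bsub>K\<^esub> \<one>\<^bsub>K\<^esub>) = c \<odot>\<^bsub>M\<^esub> n" "act (c \<odot>\<^bsub>K\<^esub> \<one>\<^bsub>K\<^esub>) t = c \<odot>\<^bsub>T\<^esub> t"
    using n by (simp_all add: sayd.mod.act_scale_right sayd.mod.act_one modalg.mod.act_scale_left
        modalg.mod.act_one)
  then show ?thesis using balanced_mapD(3)[OF P, of n "c \<odot>\<^bsub>K\<^esub> \<one>\<^bsub>K\<^esub>" t] n by simp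
qed

lemma A_scale_left:
  assumes P: "MT.bal P" and "b \<in> carrier B" "m \<in> carrier M" "t \<in> carrier T"
  shows "A b P (c \<odot>\<^bsub>M\<^esub> m) t = A b (\<lambda>m t. P (c \<odot>\<^bsub>M\<^esub> m) t) m t"
  using assms
  by (simp add: A_def W_def com.coact_eval_scale KM_balanced balanced_scale modalg.mod.act_scale_left
      comodalg.T.smult_mult_right)

section \<open>The induced module as an R-module and comodule\<close>

abbreviation Mt where "Mt \<equiv> MT.P"

abbreviation pt (infixl \<open>\<otimes>t\<close> 65) where "m \<otimes>t t \<equiv> m \<boxtimes>\<^bsub>Mt\<^esub> t"

abbreviation rMt where "rMt \<equiv> induced_ract Mt r"

lemma rMt_closed [simp]: "\<lbrakk>X \<in> carrier Mt; x \<in> carrier R\<rbrakk> \<Longrightarrow> rMt X x \<in> carrier Mt"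
  by (simp add: induced_ract_def)

lemma rMt_functional:
  "\<lbrakk>additive_functional Mt p; X \<in> carrier Mt; x \<in> carrier R\<rbrakk> \<Longrightarrow>
    p (rMt X x) = MT.eval X (\<lambda>m t. p (m \<otimes>t r t x))"
  unfolding induced_ract_def by (intro MT.functional_sweedler MT.tensor_abelian_group) simp_all

lemma rMt_eval:
  "\<lbrakk>MT.bal P; X \<in> carrier Mt; x \<in> carrier R\<rbrakk> \<Longrightarrow> MT.eval (rMt X x) P = MT.eval X (\<lambda>m t. P m (r t x))"
  using rMt_functional[OF MT.functional_of_balanced] by (simp add: MT.eval_pure)

lemma rMt_pure: "\<lbrakk>m \<in> carrier M; t \<in> carrier T; x \<in> carrier R\<rbrakk> \<Longrightarrow> rMt (m \<otimes>t t) x = m \<otimes>t r t x"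
  by (intro MT.tensor_eqI) (simp_all add: rMt_eval MT.eval_pure balanced_ract)

lemma scale_pure: "\<lbrakk>m \<in> carrier M; t \<in> carrier T\<rbrakk> \<Longrightarrow> c \<odot>\<^bsub>Mt\<^esub> (m \<otimes>t t) = (c \<odot>\<^bsub>M\<^esub> m) \<otimes>t t"
  by (simp add: MT.pure_tensor_eq MT.scale_cls_single)

lemma scale_balanced: "MT.bal P \<Longrightarrow> MT.bal (\<lambda>m t. P (c \<odot>\<^bsub>M\<^esub> m) t)"
  by (intro balanced_mapI)
     (simp_all add: M_linear balanced_mapD sayd.mod.M.scale_add_right sayd.mod.act_scale_left[symmetric])

lemma rMt_right_module: "right_module R Mt rMt"
proof (intro right_module.intro right_module_axioms.intro)
  show "calgebra R" "module complex_ring Mt" by (rule B.R.calgebra_axioms, rule MT.tensor_module)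
next
  fix X assume X: "X \<in> carrier Mt"
  have "rMt X (x \<oplus>\<^bsub>R\<^esub> y) = rMt X x \<oplus>\<^bsub>Mt\<^esub> rMt X y" if "x \<in> carrier R" "y \<in> carrier R" for x y
    using X that
    by (intro MT.tensor_eqI) (simp_all add: rMt_eval MT.eval_add M_linear balanced_mapD)
  moreover have "rMt X (c \<odot>\<^bsub>R\<^esub> x) = c \<odot>\<^bsub>Mt\<^esub> rMt X x" if x: "x \<in> carrier R" for x c
  proof (rule MT.tensor_eqI)
    fix P assume P: "MT.bal P"
    show "MT.eval (rMt X (c \<odot>\<^bsub>R\<^esub> x)) P = MT.eval (c \<odot>\<^bsub>Mt\<^esub> rMt X x) P"
      using X x P
      by (simp add: rMt_eval MT.eval_scale scale_balanced balanced_scale[OF P, symmetric]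
          comodalg.bimod.right.act_scale_right)
  qed (use X x in simp_all)
  ultimately show "clinear_map R Mt (rMt X)" using X by (simp add: clinear_map_def)
next
  fix x assume x: "x \<in> carrier R"
  have "rMt (X \<oplus>\<^bsub>Mt\<^esub> Y) x = rMt X x \<oplus>\<^bsub>Mt\<^esub> rMt Y x" if "X \<in> carrier Mt" "Y \<in> carrier Mt" for X Y
    using x that by (intro MT.tensor_eqI) (simp_all add: rMt_eval MT.eval_add balanced_ract)
  moreover have "rMt (c \<odot>\<^bsub>Mt\<^esub> X) x = c \<odot>\<^bsub>Mt\<^esub> rMt X x" if "X \<in> carrier Mt" for X c
    using x that
    by (intro MT.tensor_eqI) (simp_all add: rMt_eval MT.eval_scale scale_balanced balanced_ract)
  ultimately show "clinear_map Mt Mt (\<lambda>X. rMt X x)" using x by (simp add: clinear_map_def)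
next
  fix x y X assume "x \<in> carrier R" "y \<in> carrier R" "X \<in> carrier Mt"
  then show "rMt X (x \<otimes>\<^bsub>R\<^esub> y) = rMt (rMt X x) y"
    by (intro MT.tensor_eqI) (simp_all add: rMt_eval balanced_ract comodalg.bimod.right.act_mult)
next
  fix X assume "X \<in> carrier Mt"
  then show "rMt X \<one>\<^bsub>R\<^esub> = X"
    by (intro MT.tensor_eqI) (simp_all add: rMt_eval comodalg.bimod.right.act_one)
qed

sublocale ind: right_module_over R B Mt rMt
  by (intro right_module_over.intro B.right_bialgebroid_axioms rMt_right_module)

lemma MtB_balanced:
  assumes F: "ind.MB.bal F"
  shows "\<And>c. c \<in> carrier B \<Longrightarrow> MT.bal (\<lambda>m t. F (m \<otimes>t t) c)"
    and "\<And>m. m \<in> carrier M \<Longrightarrow> co.MB.bal (\<lambda>t c. F (m \<otimes>t t) c)"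
proof -
  show "MT.bal (\<lambda>m t. F (m \<otimes>t t) c)" if "c \<in> carrier B" for c
    using that by (intro MT.balanced_pure[where p = "\<lambda>X. F X c"])
      (simp add: additive_functional_def balanced_mapD[OF F])
  show "co.MB.bal (\<lambda>t c. F (m \<otimes>t t) c)" if "m \<in> carrier M" for m
    using that by (intro balanced_mapI)
      (simp_all add: MT.pure_tensor_add_right balanced_mapD(1,2)[OF F] rMt_pure[symmetric] balanced_mapD(3)[OF F])
qed

text \<open>Balancing over K is equivariance: \<open>k\<close> passes from \<open>m\<close> to
  \<open>t_0\<close> and then out of the coaction of \<open>t\<close>.\<close>

lemma coact_balanced:
  assumes P1: "\<And>c. c \<in> carrier B \<Longrightarrow> MT.bal (\<lambda>m t. \<Phi> m t c)"
    and P2: "\<And>m. m \<in> carrier M \<Longrightarrow> co.MB.bal (\<Phi> m)"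
  shows "MT.bal (\<lambda>m t. \<Gamma> t (\<Phi> m))"
  by (intro balanced_mapI)
     (simp_all add: balanced_mapD[OF P1] tsum_add co.coact_eval_plus P2 coact_eval_equivariant)

abbreviation \<rho>Mt where "\<rho>Mt \<equiv> induced_coact R B Mt r \<rho>"

lemma \<rho>Mt_closed [simp]: "X \<in> carrier Mt \<Longrightarrow> \<rho>Mt X \<in> carrier ind.MB.P"
  by (simp add: induced_coact_def rtensor_def Let_def)

lemma \<rho>Mt_eval:
  assumes F: "ind.MB.bal F" and X: "X \<in> carrier Mt"
  shows "ind.MB.eval (\<rho>Mt X) F = MT.eval X (\<lambda>m t. \<Gamma> t (\<lambda>t0 t1. F (m \<otimes>t t0) t1))"
  using assms
  by (simp add: induced_coact_def rtensor_def Let_def MT.eval_sweedler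
      co.MB.eval_sweedler ind.MB.eval_pure)

lemma \<rho>Mt_balanced: "ind.MB.bal F \<Longrightarrow> MT.bal (\<lambda>m t. \<Gamma> t (\<lambda>t0 t1. F (m \<otimes>t t0) t1))"
  by (rule coact_balanced) (rule MtB_balanced, assumption, assumption)+

lemma \<rho>Mt_right_linear:
  assumes X: "X \<in> carrier Mt" and x: "x \<in> carrier R"
  shows "\<rho>Mt (rMt X x) = ind.MB.ract2 (\<rho>Mt X) x"
proof (rule ind.MB.tensor_eqI)
  fix F assume F: "ind.MB.bal F"
  show "ind.MB.eval (\<rho>Mt (rMt X x)) F = ind.MB.eval (ind.MB.ract2 (\<rho>Mt X) x) F"
    using X x
    by (simp add: ind.MB.eval_ract2 F \<rho>Mt_eval rMt_eval \<rho>Mt_balanced[OF F] ind.MB.balanced_slot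
        co.coact_eval_act[OF MtB_balanced(2)[OF F]])
qed (use X x in \<open>simp_all add: ind.MB.eval_ract2\<close>)

lemma \<rho>Mt_linear: "clinear_map Mt ind.MB.P \<rho>Mt"
  unfolding clinear_map_def
proof (intro conjI ballI allI)
  fix X Y assume "X \<in> carrier Mt" "Y \<in> carrier Mt"
  then show "\<rho>Mt (X \<oplus>\<^bsub>Mt\<^esub> Y) = \<rho>Mt X \<oplus>\<^bsub>ind.MB.P\<^esub> \<rho>Mt Y"
    by (intro ind.MB.tensor_eqI) (simp_all add: \<rho>Mt_eval MT.eval_add ind.MB.eval_add \<rho>Mt_balanced)
next
  fix c X assume X: "X \<in> carrier Mt"
  show "\<rho>Mt (c \<odot>\<^bsub>Mt\<^esub> X) = c \<odot>\<^bsub>ind.MB.P\<^esub> \<rho>Mt X"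
  proof (rule ind.MB.tensor_eqI)
    fix F assume F: "ind.MB.bal F"
    have F': "ind.MB.bal (\<lambda>Y b. F (c \<odot>\<^bsub>Mt\<^esub> Y) b)"
      by (intro balanced_mapI)
         (simp_all add: balanced_mapD[OF F] MT.P.scale_add_right ind.M.act_scale_left[symmetric])
    show "ind.MB.eval (\<rho>Mt (c \<odot>\<^bsub>Mt\<^esub> X)) F = ind.MB.eval (c \<odot>\<^bsub>ind.MB.P\<^esub> \<rho>Mt X) F"
      using X by (simp add: \<rho>Mt_eval F F' MT.eval_scale ind.MB.eval_scale \<rho>Mt_balanced[OF F] scale_pure)
  qed (use X in simp_all)
qed auto

text \<open>For fixed \<open>m\<close> this is coassociativity of \<open>T\<close>. The work lies in
  showing both integrands \<open>L\<close> and \<open>R\<close> balanced, so that the coaction may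
  be evaluated on pure tensors.\<close>

lemma \<rho>Mt_coassociative: "right_coassociative R B Mt rMt \<rho>Mt"
proof -
  interpret Q: tensor_product R ind.MB.P ind.MB.ract2 B "\<lambda>x b. b \<bullet> target B x" by (rule ind.MB.iterated)
  let ?L = "\<lambda>X. sweedler Q.P (\<rho>Mt X) (\<lambda>Y b. \<rho>Mt Y \<boxtimes>\<^bsub>Q.P\<^esub> b)"
  let ?R = "\<lambda>X. sweedler Q.P (\<rho>Mt X) (\<lambda>Y b. sweedler Q.P (comult B b)
    (\<lambda>b1 b2. (Y \<boxtimes>\<^bsub>ind.MB.P\<^esub> b1) \<boxtimes>\<^bsub>Q.P\<^esub> b2))"
  have "?L X = ?R X"
    if X: "X \<in> carrier Mt" for X
  proof (rule Q.tensor_eqI)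
    show "(?L X) \<in> carrier Q.P"
      using X by simp
    show "(?R X)
        \<in> carrier Q.P"
      using X by simp
  next
    fix F assume F: "Q.bal F"
    let ?G = "\<lambda>m u b c. F ((m \<otimes>t u) \<boxtimes>\<^bsub>ind.MB.P\<^esub> b) c"
    have p: "additive_functional ind.MB.P (\<lambda>Z. F Z c)" if "c \<in> carrier B" for c
      using that by (simp add: additive_functional_def balanced_mapD(1)[OF F])
    have bal: "ind.MB.bal (\<lambda>Y b. F (Y \<boxtimes>\<^bsub>ind.MB.P\<^esub> b) c)" if "c \<in> carrier B" for c
      using ind.MB.balanced_pure[OF p[OF that]] .
    have ract2: "ind.MB.ract2 (Y \<boxtimes>\<^bsub>ind.MB.P\<^esub> b) x = Y \<boxtimes>\<^bsub>ind.MB.P\<^esub> (b \<bullet> source B x)"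
      if "Y \<in> carrier Mt" "b \<in> carrier B" "x \<in> carrier R" for Y b x
      using that by (intro ind.MB.tensor_eqI)
        (simp_all add: ind.MB.eval_ract2 ind.MB.eval_pure ind.MB.balanced_slot)
    have bal2: "B.BB.bal (\<lambda>b c. F (Y \<boxtimes>\<^bsub>ind.MB.P\<^esub> b) c)" if Y: "Y \<in> carrier Mt" for Y
      using Y by (intro balanced_mapI)
        (simp_all add: ind.MB.pure_tensor_add_right balanced_mapD(1,2)[OF F] ract2[symmetric] balanced_mapD(3)[OF F])
    have L: "ind.MB.bal (\<lambda>Y b. F (\<rho>Mt Y) b)"
      by (intro balanced_mapI)
         (simp_all add: clinear_mapD(2)[OF \<rho>Mt_linear] balanced_mapD[OF F] \<rho>Mt_right_linear)
    have R: "ind.MB.bal (\<lambda>Y b. B.\<Delta> b (\<lambda>b1 b2. F (Y \<boxtimes>\<^bsub>ind.MB.P\<^esub> b1) b2))"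
      by (intro balanced_mapI)
         (simp_all add: balanced_mapD[OF bal] tsum_add B.self.coact_eval_plus bal2 B.comult_eval_target_right)
    have e: "F (\<rho>Mt (m \<otimes>t t)) c = \<Gamma> t (\<lambda>u b. ?G m u b c)"
      if "m \<in> carrier M" "t \<in> carrier T" "c \<in> carrier B" for m t c
      using ind.MB.eval_functional[OF p[OF that(3)], of "\<rho>Mt (m \<otimes>t t)"] that
      by (simp add: \<rho>Mt_eval[OF bal[OF that(3)]] MT.eval_pure[OF \<rho>Mt_balanced[OF bal[OF that(3)]]])
    have co: "\<Gamma> t (\<lambda>t0 t1. F (\<rho>Mt (m \<otimes>t t0)) t1) = \<Gamma> t (\<lambda>t0 t1. B.\<Delta> t1 (\<lambda>b1 b2. ?G m t0 b1 b2))"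
      if m: "m \<in> carrier M" and t: "t \<in> carrier T" for m t
    proof -
      have "\<Gamma> t (\<lambda>t0 t1. F (\<rho>Mt (m \<otimes>t t0)) t1) = \<Gamma> t (\<lambda>t0 t1. \<Gamma> t0 (\<lambda>u b. ?G m u b t1))"
        using m by (simp add: e)
      also have "\<dots> = \<Gamma> t (\<lambda>t0 t1. B.\<Delta> t1 (?G m t0))"
        using m by (intro co.coact_eval_coassoc t MtB_balanced(2)[OF bal] bal2) simp_all
      finally show ?thesis .
    qed
    have "Q.eval (?L X) F =
        ind.MB.eval (\<rho>Mt X) (\<lambda>Y b. F (\<rho>Mt Y) b)"
      using X F by (simp add: ind.MB.eval_sweedler Q.eval_pure)
    also have "\<dots> = ind.MB.eval (\<rho>Mt X) (\<lambda>Y b. B.\<Delta> b (\<lambda>b1 b2. F (Y \<boxtimes>\<^bsub>ind.MB.P\<^esub> b1) b2))"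
      using X by (simp add: \<rho>Mt_eval[OF L] \<rho>Mt_eval[OF R] co)
    also have "\<dots> = Q.eval (?R X) F"
      using X F by (simp add: ind.MB.eval_sweedler
          B.BB.eval_sweedler Q.eval_pure)
    finally show "Q.eval (?L X) F =
        Q.eval (?R X) F" .
  qed
  then show ?thesis
    by (simp add: right_coassociative_def rtensor2_def rtensor_def Let_def)
qed

lemma counit_functional_balanced:
  assumes p: "additive_functional Mt p" and x: "x \<in> carrier R"
  shows "ind.MB.bal (\<lambda>Y b. p (rMt Y (counit B (source B x \<bullet> b))))"
proof (intro balanced_mapI)
  fix Y y b assume "Y \<in> carrier Mt" "y \<in> carrier R" "b \<in> carrier B"
  then show "p (rMt (rMt Y y) (counit B (source B x \<bullet> b))) =
      p (rMt Y (counit B (source B x \<bullet> (b \<bullet> target B y))))"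
    using x by (simp add: ind.M.act_mult[symmetric] B.B.m_assoc[symmetric] counit_target_right)
qed (use x in \<open>simp_all add: ind.M.act_add_left ind.M.act_add_right B.B.r_distr B.counit_add
    additive_functionalD[OF p]\<close>)

text \<open>Stated with a scalar \<open>x\<close> to serve twice: \<open>x = 1\<close> gives the
  counit law, and general \<open>x\<close> identifies the canonical left action of R.\<close>

lemma \<rho>Mt_counit:
  assumes p: "additive_functional Mt p" and X: "X \<in> carrier Mt" and x: "x \<in> carrier R"
  shows "p (sweedler Mt (\<rho>Mt X) (\<lambda>Y b. rMt Y (counit B (source B x \<bullet> b)))) =
    MT.eval X (\<lambda>m t. p (m \<otimes>t l x t))"
proof -
  have "p (sweedler Mt (\<rho>Mt X) (\<lambda>Y b. rMt Y (counit B (source B x \<bullet> b)))) =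
      ind.MB.eval (\<rho>Mt X) (\<lambda>Y b. p (rMt Y (counit B (source B x \<bullet> b))))"
    using X x by (intro ind.MB.functional_sweedler MT.tensor_abelian_group p) simp_all
  also have "\<dots> = MT.eval X (\<lambda>m t. \<Gamma> t (\<lambda>t0 t1. p (m \<otimes>t r t0 (counit B (source B x \<bullet> t1)))))"
    using X x by (simp add: \<rho>Mt_eval[OF counit_functional_balanced[OF p x]] rMt_pure)
  also have "\<dots> = MT.eval X (\<lambda>m t. p (m \<otimes>t l x t))"
  proof (rule tsum_ext)
    fix m t assume "m \<in> carrier M" "t \<in> carrier T"
    then show "\<Gamma> t (\<lambda>t0 t1. p (m \<otimes>t r t0 (counit B (source B x \<bullet> t1)))) = p (m \<otimes>t l x t)"
      using x by (intro canonical_left_action[where p = "\<lambda>t. p (m \<otimes>t t)"])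
        (simp_all add: additive_functional_def MT.pure_tensor_add_right additive_functionalD[OF p])
  qed
  finally show ?thesis .
qed

lemma \<rho>Mt_right_comodule: "right_comodule R B Mt rMt \<rho>Mt"
proof (intro right_comodule.intro right_comodule_axioms.intro rMt_right_module \<rho>Mt_coassociative)
  show "clinear_map Mt (rtensor R B Mt rMt) \<rho>Mt" using \<rho>Mt_linear by (simp add: rtensor_def)
next
  fix x X assume "x \<in> carrier R" "X \<in> carrier Mt"
  then show "\<rho>Mt (rMt X x) = sweedler (rtensor R B Mt rMt) (\<rho>Mt X)
      (\<lambda>n b. n \<boxtimes>\<^bsub>rtensor R B Mt rMt\<^esub> (b \<bullet> source B x))"
    by (simp add: \<rho>Mt_right_linear rtensor_def)
next
  fix X assume X: "X \<in> carrier Mt"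
  \<comment> \<open>The factor \<open>source B\<close> of the unit is inserted to match
    \<open>\<rho>Mt_counit\<close> at \<open>x = 1\<close>; it is removed again below.\<close>
  have "sweedler Mt (\<rho>Mt X) (\<lambda>n b. rMt n (counit B (source B \<one>\<^bsub>R\<^esub> \<bullet> b))) = X"
  proof (rule MT.P.functionals_separate)
    fix p assume p: "additive_functional Mt p"
    show "p (sweedler Mt (\<rho>Mt X) (\<lambda>n b. rMt n (counit B (source B \<one>\<^bsub>R\<^esub> \<bullet> b)))) = p X"
      using \<rho>Mt_counit[OF p X, of "\<one>\<^bsub>R\<^esub>"] MT.eval_functional[OF p X]
      by (simp add: comodalg.bimod.left.act_one)
  qed (use X in \<open>auto simp: MT.tensor_abelian_group intro!: ind.MB.sweedler_closed\<close>)
  moreover have "sweedler Mt (\<rho>Mt X) (\<lambda>n b. rMt n (counit B (source B \<one>\<^bsub>R\<^esub> \<bullet> b))) =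
      sweedler Mt (\<rho>Mt X) (\<lambda>n b. rMt n (counit B b))"
    using X by (intro MT.P.functionals_separate)
      (auto simp: ind.MB.functional_sweedler MT.tensor_abelian_group intro!: ind.MB.sweedler_closed)
  ultimately show "sweedler Mt (\<rho>Mt X) (\<lambda>n b. rMt n (counit B b)) = X" by simp
qed

section \<open>The action of B and the SAYD conditions on the induced module\<close>

abbreviation actMt where "actMt \<equiv> induced_act Mt T act \<rho>M tr"

lemma actMt_closed [simp]: "\<lbrakk>b \<in> carrier B; X \<in> carrier Mt\<rbrakk> \<Longrightarrow> actMt b X \<in> carrier Mt"
  by (simp add: induced_act_def)

lemma actMt_eval:
  assumes P: "MT.bal P" and b: "b \<in> carrier B" and X: "X \<in> carrier Mt"
  shows "MT.eval (actMt b X) P = MT.eval X (A b P)"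
proof -
  have "MT.eval (actMt b X) P = MT.eval X (\<lambda>m t. \<Lambda> m (\<lambda>k n. \<tau> b (\<lambda>p q. P n (q \<cdot> act k (t \<cdot> p)))))"
    using assms
    by (simp add: induced_act_def MT.eval_sweedler
        com.KM.eval_sweedler TT.eval_sweedler MT.eval_pure)
  also have "\<dots> = MT.eval X (A b P)"
    unfolding A_def W_def by (intro tsum_ext tsum_swap)
  finally show ?thesis .
qed

lemma actMt_functional:
  assumes p: "additive_functional Mt p" and "b \<in> carrier B" "m \<in> carrier M" "t \<in> carrier T"
  shows "p (actMt b (m \<otimes>t t)) = A b (\<lambda>m t. p (m \<otimes>t t)) m t"
  using MT.eval_functional[OF p, of "actMt b (m \<otimes>t t)"] MT.balanced_pure[OF p] assms
  by (simp add: actMt_eval MT.eval_pure A_balanced)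

lemma actMt_left_module: "left_module B Mt actMt"
proof (intro left_module.intro left_module_axioms.intro)
  show "calgebra B" "module complex_ring Mt" by (rule B.B.calgebra_axioms, rule MT.tensor_module)
next
  fix X assume X: "X \<in> carrier Mt"
  have "actMt (b \<oplus>\<^bsub>B\<^esub> b') X = actMt b X \<oplus>\<^bsub>Mt\<^esub> actMt b' X" if "b \<in> carrier B" "b' \<in> carrier B" for b b'
    using X that
    by (intro MT.tensor_eqI) (simp_all add: actMt_eval MT.eval_add A_plus tsum_add)
  moreover have "actMt (c \<odot>\<^bsub>B\<^esub> b) X = c \<odot>\<^bsub>Mt\<^esub> actMt b X" if b: "b \<in> carrier B" for b c
  proof (rule MT.tensor_eqI)
    fix P assume P: "MT.bal P"
    show "MT.eval (actMt (c \<odot>\<^bsub>B\<^esub> b) X) P = MT.eval (c \<odot>\<^bsub>Mt\<^esub> actMt b X) P"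
      using X b P
      by (simp add: actMt_eval MT.eval_scale scale_balanced A_scale A_scale_left[symmetric]
          balanced_scale[OF A_balanced, symmetric])
  qed (use X b in simp_all)
  ultimately show "clinear_map B Mt (\<lambda>b. actMt b X)" using X by (simp add: clinear_map_def)
next
  fix b assume b: "b \<in> carrier B"
  have "actMt b (X \<oplus>\<^bsub>Mt\<^esub> Y) = actMt b X \<oplus>\<^bsub>Mt\<^esub> actMt b Y" if "X \<in> carrier Mt" "Y \<in> carrier Mt" for X Y
    using b that by (intro MT.tensor_eqI) (simp_all add: actMt_eval MT.eval_add A_balanced)
  moreover have "actMt b (c \<odot>\<^bsub>Mt\<^esub> X) = c \<odot>\<^bsub>Mt\<^esub> actMt b X" if "X \<in> carrier Mt" for X c
    using b that by (intro MT.tensor_eqI)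
      (simp_all add: actMt_eval MT.eval_scale A_balanced scale_balanced A_scale_left)
  ultimately show "clinear_map Mt Mt (actMt b)" using b by (simp add: clinear_map_def)
next
  fix b b' X assume "b \<in> carrier B" "b' \<in> carrier B" "X \<in> carrier Mt"
  then show "actMt (b \<bullet> b') X = actMt b (actMt b' X)"
    by (intro MT.tensor_eqI) (simp_all add: actMt_eval A_balanced A_mult)
next
  fix X assume "X \<in> carrier Mt"
  then show "actMt \<one>\<^sub>B X = X"
    by (intro MT.tensor_eqI) (simp_all add: actMt_eval A_one)
qed

lemma rMt_eq: "\<lbrakk>x \<in> carrier R; X \<in> carrier Mt\<rbrakk> \<Longrightarrow> rMt X x = actMt (target B x) X"
  by (intro MT.tensor_eqI) (simp_all add: actMt_eval rMt_eval A_target)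

lemma actMt_source:
  assumes x: "x \<in> carrier R" and X: "X \<in> carrier Mt"
  shows "right_comodule_left_action B Mt rMt \<rho>Mt x X = actMt (source B x) X"
  unfolding right_comodule_left_action_def
proof (rule MT.P.functionals_separate)
  fix p assume p: "additive_functional Mt p"
  show "p (sweedler Mt (\<rho>Mt X) (\<lambda>Y b. rMt Y (counit B (source B x \<bullet> b)))) = p (actMt (source B x) X)"
    using \<rho>Mt_counit[OF p X x] MT.eval_functional[OF p, of "actMt (source B x) X"] X x
    by (simp add: actMt_eval MT.balanced_pure[OF p] A_source)
qed (use x X in \<open>auto simp: MT.tensor_abelian_group intro!: ind.MB.sweedler_closed\<close>)

lemma actMt_coact:
  assumes b: "b \<in> carrier B" and X: "X \<in> carrier Mt"
  shows "\<rho>Mt (actMt b X) =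
    sweedler ind.MB.P (comult B b) (\<lambda>b1 b2.
      sweedler ind.MB.P (right_translation R B b1) (\<lambda>e f.
        sweedler ind.MB.P (\<rho>Mt X) (\<lambda>Y c. actMt f Y \<boxtimes>\<^bsub>ind.MB.P\<^esub> (b2 \<bullet> c \<bullet> e))))"
    (is "_ = ?R")
proof (rule ind.MB.tensor_eqI)
  interpret act: left_module B Mt actMt by (rule actMt_left_module)
  show "?R \<in> carrier ind.MB.P"
    using b X by simp
  fix F assume F: "ind.MB.bal F"
  note bal = MtB_balanced[OF F]
  have pF: "additive_functional Mt (\<lambda>Y. F Y c)" if "c \<in> carrier B" for c
    using that by (simp add: additive_functional_def balanced_mapD[OF F])
  let ?O = "\<lambda>Y c. B.\<Delta> b (\<lambda>b1 b2. B.\<nu> b1 (\<lambda>e f. F (actMt f Y) (b2 \<bullet> c \<bullet> e)))"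
  have inner: "B.BoB.bal (\<lambda>e f. F (actMt f Y) (d \<bullet> e))" if "Y \<in> carrier Mt" "d \<in> carrier B" for Y d
    using that by (intro balanced_mapI)
      (simp_all add: M_linear act.act_add_left balanced_mapD(1,2)[OF F] B.B.m_assoc[symmetric]
        balanced_mapD(3)[OF F, symmetric] rMt_eq act.act_mult)
  \<comment> \<open>The right-hand side can be evaluated on pure tensors of the induced module only
    if it is balanced over R; the scalar crosses by
    \<open>b^- (x) b^+ t(x) = t(x) b^- (x) b^+\<close>.\<close>
  have O: "ind.MB.bal ?O"
  proof (intro balanced_mapI)
    fix Y x c assume a: "Y \<in> carrier Mt" "x \<in> carrier R" "c \<in> carrier B"
    have "?O (rMt Y x) c = B.\<Delta> b (\<lambda>b1 b2. B.\<nu> b1 (\<lambda>e f. F (actMt (f \<bullet> target B x) Y) (b2 \<bullet> c \<bullet> e)))"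
      using a by (simp add: rMt_eq act.act_mult)
    also have "\<dots> = B.\<Delta> b (\<lambda>b1 b2. B.\<nu> b1 (\<lambda>e f. F (actMt f Y) (b2 \<bullet> c \<bullet> (target B x \<bullet> e))))"
    proof (rule tsum_ext)
      fix b1 b2 assume "b1 \<in> carrier B" "b2 \<in> carrier B"
      then show "B.\<nu> b1 (\<lambda>e f. F (actMt (f \<bullet> target B x) Y) (b2 \<bullet> c \<bullet> e)) =
          B.\<nu> b1 (\<lambda>e f. F (actMt f Y) (b2 \<bullet> c \<bullet> (target B x \<bullet> e)))"
        using a by (intro B.translation_target[OF inner]) simp_all
    qed
    also have "\<dots> = ?O Y (c \<bullet> target B x)"
      using a by (simp add: B.B.m_assoc)
    finally show "?O (rMt Y x) c = ?O Y (c \<bullet> target B x)" .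
  qed (simp_all add: M_linear act.act_add_right balanced_mapD[OF F])
  have "ind.MB.eval (\<rho>Mt (actMt b X)) F = MT.eval X (A b (\<lambda>m t. \<Gamma> t (\<lambda>t0 t1. F (m \<otimes>t t0) t1)))"
    using b X by (simp add: \<rho>Mt_eval[OF F] actMt_eval[OF \<rho>Mt_balanced[OF F]])
  also have "\<dots> = MT.eval X (\<lambda>m t. B.\<Delta> b (\<lambda>b1 b2. B.\<nu> b1 (\<lambda>e f.
      \<Gamma> t (\<lambda>t0 t1. A f (\<lambda>m t. F (m \<otimes>t t) (b2 \<bullet> t1 \<bullet> e)) m t0))))"
    by (intro tsum_ext A_coact[OF bal b])
  also have "\<dots> = MT.eval X (\<lambda>m t. B.\<Delta> b (\<lambda>b1 b2. B.\<nu> b1 (\<lambda>e f.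
      \<Gamma> t (\<lambda>t0 t1. F (actMt f (m \<otimes>t t0)) (b2 \<bullet> t1 \<bullet> e)))))"
    by (simp add: actMt_functional[OF pF])
  also have "\<dots> = MT.eval X (\<lambda>m t. \<Gamma> t (\<lambda>t0 t1. ?O (m \<otimes>t t0) t1))"
    by (rule tsum_ext[OF trans[OF tsum_ext[OF tsum_swap] tsum_swap]])
  also have "\<dots> = ind.MB.eval (\<rho>Mt X) ?O"
    using X by (simp only: \<rho>Mt_eval[OF O])
  also have "\<dots> = B.\<Delta> b (\<lambda>b1 b2. ind.MB.eval (\<rho>Mt X) (\<lambda>Y c. B.\<nu> b1 (\<lambda>e f. F (actMt f Y) (b2 \<bullet> c \<bullet> e))))"
    by (rule tsum_swap)
  also have "\<dots> = B.\<Delta> b (\<lambda>b1 b2. B.\<nu> b1 (\<lambda>e f. ind.MB.eval (\<rho>Mt X) (\<lambda>Y c. F (actMt f Y) (b2 \<bullet> c \<bullet> e))))"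
    by (rule tsum_ext[OF tsum_swap])
  also have "\<dots> = ind.MB.eval ?R F"
    using b X F
    by (simp add: B.BB.eval_sweedler B.BoB.eval_sweedler
        ind.MB.eval_sweedler ind.MB.eval_pure)
  finally show "ind.MB.eval (\<rho>Mt (actMt b X)) F = ind.MB.eval ?R F" .
qed (use b X in simp)

lemma actMt_stable:
  assumes X: "X \<in> carrier Mt"
  shows "sweedler Mt (\<rho>Mt X) (\<lambda>Y c. actMt c Y) = X"
proof (rule MT.P.functionals_separate)
  interpret act: left_module B Mt actMt by (rule actMt_left_module)
  fix p assume p: "additive_functional Mt p"
  have bal: "ind.MB.bal (\<lambda>Y c. p (actMt c Y))"
    by (intro balanced_mapI)
       (simp_all add: act.act_add_left act.act_add_right additive_functionalD[OF p] rMt_eq act.act_mult)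
  have "p (sweedler Mt (\<rho>Mt X) (\<lambda>Y c. actMt c Y)) = ind.MB.eval (\<rho>Mt X) (\<lambda>Y c. p (actMt c Y))"
    using X by (intro ind.MB.functional_sweedler MT.tensor_abelian_group p) simp_all
  also have "\<dots> = MT.eval X (\<lambda>m t. \<Gamma> t (\<lambda>t0 t1. A t1 (\<lambda>m t. p (m \<otimes>t t)) m t0))"
    using X by (simp add: \<rho>Mt_eval[OF bal] actMt_functional[OF p])
  also have "\<dots> = MT.eval X (\<lambda>m t. p (m \<otimes>t t))"
    by (simp add: A_stable[OF MT.balanced_pure[OF p]])
  also have "\<dots> = p X" using MT.eval_functional[OF p X] .
  finally show "p (sweedler Mt (\<rho>Mt X) (\<lambda>Y c. actMt c Y)) = p X" .
qed (use X in \<open>auto simp: MT.tensor_abelian_group intro!: ind.MB.sweedler_closed\<close>)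

lemma induced_SAYD: "left_right_SAYD R B Mt rMt actMt \<rho>Mt"
  by (intro left_right_SAYD.intro left_right_SAYD_axioms.intro actMt_left_module \<rho>Mt_right_comodule
      rMt_eq actMt_source actMt_stable)
    (simp_all add: actMt_coact rtensor_def)

text \<open>For each entry of \<open>bs\<close>, \<open>KM_balanced\<close> gives independence of
  the representative \<open>ms\<close>. For \<open>bs\<close> it comes from \<open>W_TT\<close>,
  which concerns the sum over the whole coaction of \<open>m\<close>; hence the interchange of the
  two sums.\<close>

lemma actMt_pure:
  assumes b: "b \<in> carrier B" and m: "m \<in> carrier M" and t: "t \<in> carrier T"
    and ms: "ms \<in> \<rho>M m" and bs: "bs \<in> tr b"
  shows "actMt b (m \<otimes>t t) =
    sum_over Mt ms (\<lambda>k n. sum_over Mt bs (\<lambda>p q. n \<otimes>t (q \<cdot> act k (t \<cdot> p))))"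
proof (rule MT.P.functionals_separate)
  note Lm = com.KM.rep_in_lists[OF com.coact_closed[OF m] ms]
  note Lb = TT.rep_in_lists[OF translation_closed[OF b] bs]
  have c: "sum_over Mt bs (\<lambda>p q. n \<otimes>t (q \<cdot> act k (t \<cdot> p))) \<in> carrier Mt"
    if "k \<in> carrier K" "n \<in> carrier M" for k n
    using that t by (intro MT.P.sum_over_closed[OF Lb]) simp_all
  then show "sum_over Mt ms (\<lambda>k n. sum_over Mt bs (\<lambda>p q. n \<otimes>t (q \<cdot> act k (t \<cdot> p)))) \<in> carrier Mt"
    by (rule MT.P.sum_over_closed[OF Lm])
  fix f assume f: "additive_functional Mt f"
  let ?P = "\<lambda>m t. f (m \<otimes>t t)"
  note P = MT.balanced_pure[OF f]
  have "f (sum_over Mt ms (\<lambda>k n. sum_over Mt bs (\<lambda>p q. n \<otimes>t (q \<cdot> act k (t \<cdot> p))))) =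
      list_total ms (\<lambda>k n. f (sum_over Mt bs (\<lambda>p q. n \<otimes>t (q \<cdot> act k (t \<cdot> p)))))"
    by (rule com.KM.sum_over_functional(2)[OF MT.tensor_abelian_group f Lm c])
  also have "\<dots> = list_total ms (\<lambda>k n. list_total bs (\<lambda>p q. ?P n (q \<cdot> act k (t \<cdot> p))))"
    using t by (intro list_total_cong[OF Lm] TT.sum_over_functional(2)[OF MT.tensor_abelian_group f Lb]) simp_all
  also have "\<dots> = list_total bs (\<lambda>p q. list_total ms (\<lambda>k n. ?P n (q \<cdot> act k (t \<cdot> p))))"
    by (rule list_total_swap)
  also have "\<dots> = list_total bs (W ?P m t)"
    unfolding W_def using t m ms
    by (intro list_total_cong[OF Lb] com.KM.eval_rep[symmetric] KM_balanced P) simp_all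
  also have "\<dots> = A b ?P m t"
    unfolding A_def by (rule TT.eval_rep[symmetric, OF translation_closed[OF b] bs W_TT[OF P m t]])
  finally show "f (actMt b (m \<otimes>t t)) =
      f (sum_over Mt ms (\<lambda>k n. sum_over Mt bs (\<lambda>p q. n \<otimes>t (q \<cdot> act k (t \<cdot> p)))))"
    using actMt_functional[OF f b m t] by simp
qed (use b m t in simp)

lemma \<rho>Mt_pure:
  assumes m: "m \<in> carrier M" and t: "t \<in> carrier T" and ts: "ts \<in> \<rho> t"
  shows "\<rho>Mt (m \<otimes>t t) = sum_over ind.MB.P ts (\<lambda>t0 t1. (m \<otimes>t t0) \<boxtimes>\<^bsub>ind.MB.P\<^esub> t1)"
proof (rule ind.MB.tensor_eqI)
  note L = co.MB.rep_in_lists[OF co.coact_closed[OF t] ts]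
  show "sum_over ind.MB.P ts (\<lambda>t0 t1. (m \<otimes>t t0) \<boxtimes>\<^bsub>ind.MB.P\<^esub> t1) \<in> carrier ind.MB.P"
    using m by (intro ind.MB.P.sum_over_closed[OF L]) simp_all
  fix F assume F: "ind.MB.bal F"
  note bal = MtB_balanced[OF F]
  have "ind.MB.eval (sum_over ind.MB.P ts (\<lambda>t0 t1. (m \<otimes>t t0) \<boxtimes>\<^bsub>ind.MB.P\<^esub> t1)) F =
      list_total ts (\<lambda>t0 t1. ind.MB.eval ((m \<otimes>t t0) \<boxtimes>\<^bsub>ind.MB.P\<^esub> t1) F)"
    using m by (intro co.MB.sum_over_functional(2)[OF ind.MB.tensor_abelian_group
      ind.MB.functional_of_balanced[OF F] L]) simp_all
  also have "\<dots> = list_total ts (\<lambda>t0 t1. F (m \<otimes>t t0) t1)"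
    using m by (intro list_total_cong[OF L]) (simp add: ind.MB.eval_pure F)
  also have "\<dots> = \<Gamma> t (\<lambda>t0 t1. F (m \<otimes>t t0) t1)"
    by (rule co.MB.eval_rep[symmetric, OF co.coact_closed[OF t] ts bal(2)[OF m]])
  finally show "ind.MB.eval (\<rho>Mt (m \<otimes>t t)) F =
      ind.MB.eval (sum_over ind.MB.P ts (\<lambda>t0 t1. (m \<otimes>t t0) \<boxtimes>\<^bsub>ind.MB.P\<^esub> t1)) F"
    using m t by (simp add: \<rho>Mt_eval[OF F] MT.eval_pure[OF \<rho>Mt_balanced[OF F]])
qed (use m t in simp)

end

theorem theorem3p3:
  fixes R :: "(complex, 'r) module"
    and B :: "('r, 'b) bialgebroid"
    and T :: "(complex, 't) module"
    and lT :: "'r \<Rightarrow> 't \<Rightarrow> 't" and rT :: "'t \<Rightarrow> 'r \<Rightarrow> 't"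
    and \<rho>T :: "'t \<Rightarrow> ('t \<times> 'b) list set"
    and S :: "(complex, 't) module"
    and K :: "('t, 'k) bialgebroid"
    and actT :: "'k \<Rightarrow> 't \<Rightarrow> 't"
    and M :: "(complex, 'm) module"
    and lM :: "'t \<Rightarrow> 'm \<Rightarrow> 'm" and actM :: "'m \<Rightarrow> 'k \<Rightarrow> 'm"
    and \<rho>M :: "'m \<Rightarrow> ('k \<times> 'm) list set"
  assumes "calgebra R"
    and "right_times_hopf R B"
    and "comodule_algebra R B T lT rT \<rho>T"
    and "S = coinvariants R B T rT \<rho>T"
    and "left_times_hopf S K"
    and "module_algebra S K T actT"
    and "right_left_SAYD S K M lM actM \<rho>M"
    and "equivariant_galois R B S K T lT rT \<rho>T actT"
  shows
    "let Mt = induced K M actM T actT;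
         \<tau> = galois_translation R B S K T rT \<rho>T actT;
         rMt = induced_ract Mt rT;
         actMt = induced_act Mt T actT \<rho>M \<tau>;
         \<rho>Mt = induced_coact R B Mt rT \<rho>T;
         MtB = rtensor R B Mt rMt
     in left_right_SAYD R B Mt rMt actMt \<rho>Mt \<and>
        (\<forall>b\<in>carrier B. \<forall>m\<in>carrier M. \<forall>t\<in>carrier T. \<forall>ms\<in>\<rho>M m. \<forall>bs\<in>\<tau> b.
          actMt b (m \<boxtimes>\<^bsub>Mt\<^esub> t) =
          sum_over Mt ms (\<lambda>k n. sum_over Mt bs (\<lambda>bminus bplus.
            n \<boxtimes>\<^bsub>Mt\<^esub> (bplus \<otimes>\<^bsub>T\<^esub> actT k (t \<otimes>\<^bsub>T\<^esub> bminus))))) \<and>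
        (\<forall>m\<in>carrier M. \<forall>t\<in>carrier T. \<forall>ts\<in>\<rho>T t.
          \<rho>Mt (m \<boxtimes>\<^bsub>Mt\<^esub> t) =
          sum_over MtB ts (\<lambda>t0 t1. (m \<boxtimes>\<^bsub>Mt\<^esub> t0) \<boxtimes>\<^bsub>MtB\<^esub> t1)) \<and>
        (\<forall>m\<in>carrier M. \<forall>t\<in>carrier T. \<forall>x\<in>carrier R.
          rMt (m \<boxtimes>\<^bsub>Mt\<^esub> t) x = m \<boxtimes>\<^bsub>Mt\<^esub> rT t x)"
proof -
  interpret sayd_extension R B S K T lT rT \<rho>T actT M lM actM \<rho>M
    by (rule sayd_extension.intro[OF assms(8,7)])
  show ?thesis
    unfolding induced_def Let_def rtensor_def
    by (intro conjI ballI; (rule induced_SAYD | rule actMt_pure | rule \<rho>Mt_pure | rule rMt_pure); assumption)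
qed

end
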